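(* Let $B,V\in\mathbb{R}^{d\times d}$ with $B$ invertible. Let $\rho_0\in\mathcal{P}(\mathbb{S}^{d-1})$ have a Lipschitz continuous density $f_0$ with respect to the surface measure $\mathcal{H}^{d-1}$ on $\mathbb{S}^{d-1}$ with $\ell_0:=\min_{x\in\mathbb{S}^{d-1}}f_0(x)>0$. Then there exist constants $C_1>C_0>0$, where $C_0$ depends only on $d,\sigma_{\max}(B),\sigma_{\max}(V)$ and $C_1$ depends only on $d,\sigma_{\max}(B),\sigma_{\max}(V),\sigma_{\min}(B),\ell_0$, such that the following holds for every $\beta>0$ and $T>0$. Let $(\rho_t^\beta)_{t\in[0,T]}$ and $(\rho_t)_{t\in[0,T]}$ be weak solutions of $$\partial_t\rho_t^\beta=-\operatorname{div}\left(\rho_t^\beta\,\mathrm{P}_x\left(\int_{\mathbb{S}^{d-1}}\frac{\exp(\beta\langle x,By\rangle)}{\int_{\mathbb{S}^{d-1}}\exp(\beta\langle x,Bz\rangle)\,\mathrm{d}\rho_t^\beta(z)}\,Vy\,\mathrm{d}\rho_t^\beta(y)\right)\right)$$ and $$\partial_t\rho_t=-\operatorname{div}\left(\rho_t\,\mathrm{P}_x\left(\frac{VB^\top x}{\|B^\top x\|}\right)\right),$$ respectively, with the same initial datum $\rho_0^\beta=\rho_0$. Then for all $t\in[0,T]$ $$W_2(\rho_t^\beta,\rho_t)\le2\sqrt{\frac{\log(\beta+1)}{\beta}}\left(e^{C_1t}-e^{C_0t}\right).$$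
   Context: $\mathbb{S}^{d-1}$ is the Euclidean unit sphere in $\mathbb{R}^d$, and $\mathcal{P}(\mathbb{S}^{d-1})$ the set of Borel probability measures on it. $\mathrm{P}_x(y)=y-\langle x,y\rangle x$ is the orthogonal projection onto the tangent space of the sphere at $x$; $\operatorname{div}$ and $\nabla$ are the manifold divergence and gradient on the sphere. A weak solution of $\partial_t\rho_t=-\operatorname{div}(\rho_t v_t)$ is a (narrowly continuous) curve of probability measures on $\mathbb{S}^{d-1}$ with $\frac{\mathrm{d}}{\mathrm{d}t}\int\varphi\,\mathrm{d}\rho_t=\int\langle\nabla\varphi,v_t\rangle\,\mathrm{d}\rho_t$ (for a.e. $t$, in integrated form) for all smooth $\varphi:\mathbb{S}^{d-1}\to\mathbb{R}$. $W_2$ is the 2-Wasserstein distance with cost $\|x-y\|^2$, $\|\cdot\|$ being the Euclidean norm of $\mathbb{R}^d$. $\sigma_{\min},\sigma_{\max}$ denote the smallest and largest singular values of a matrix. *)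

theory Defs
  imports "HOL-Probability.Probability"
begin

section \<open>Hausdorff measure\<close>

text \<open>
  The factor \<^term>\<open>unit_ball_vol (real k)\<close> makes the \<open>k\<close>-dimensional Hausdorff measure
  agree with \<open>k\<close>-dimensional volume on smooth submanifolds. Empty covering sets
  contribute 0 also for \<open>k = 0\<close>, so that the 0-dimensional measure is the counting measure.
\<close>

definition hausdorff_gauge :: "nat \<Rightarrow> 'a::metric_space set \<Rightarrow> ennreal" where
  "hausdorff_gauge k E =
     (if E = {} then 0 else ennreal (unit_ball_vol (real k) * (diameter E / 2) ^ k))"

definition hausdorff_covers :: "real \<Rightarrow> 'a::metric_space set \<Rightarrow> (nat \<Rightarrow> 'a set) set" where
  "hausdorff_covers \<delta> A = {E. A \<subseteq> (\<Union>i. E i) \<and> (\<forall>i. bounded (E i) \<and> diameter (E i) \<le> \<delta>)}"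

definition hausdorff_content :: "nat \<Rightarrow> real \<Rightarrow> 'a::metric_space set \<Rightarrow> ennreal" where
  "hausdorff_content k \<delta> A = (INF E\<in>hausdorff_covers \<delta> A. \<Sum>i. hausdorff_gauge k (E i))"

definition hausdorff_outer :: "nat \<Rightarrow> 'a::metric_space set \<Rightarrow> ennreal" where
  "hausdorff_outer k A = (SUP \<delta>\<in>{0<..}. hausdorff_content k \<delta> A)"

definition hausdorff_measure :: "nat \<Rightarrow> 'a::metric_space measure" where
  "hausdorff_measure k = measure_of UNIV (sets borel) (hausdorff_outer k)"

lemma space_hausdorff_measure [simp]: "space (hausdorff_measure k) = UNIV"
  by (simp add: hausdorff_measure_def space_measure_of_conv)

lemma sets_hausdorff_measure [simp, measurable_cong]: "sets (hausdorff_measure k) = sets borel"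
  by (metis hausdorff_measure_def sets.sets_measure_of_eq space_borel)

text \<open>
  Since \<^const>\<open>measure_of\<close> returns the null measure on a set function that is not countably
  additive, we check that the Hausdorff outer measure is additive on Borel sets.
\<close>

lemma hausdorff_content_mono: "A \<subseteq> B \<Longrightarrow> hausdorff_content k \<delta> A \<le> hausdorff_content k \<delta> B"
  unfolding hausdorff_content_def hausdorff_covers_def
  by (rule INF_superset_mono) auto

lemma hausdorff_content_antimono:
  "\<delta> \<le> \<delta>' \<Longrightarrow> hausdorff_content k \<delta>' A \<le> hausdorff_content k \<delta> A"
  unfolding hausdorff_content_def hausdorff_covers_def
  by (rule INF_superset_mono) (auto intro: order_trans)

lemma hausdorff_outer_mono: "A \<subseteq> B \<Longrightarrow> hausdorff_outer k A \<le> hausdorff_outer k B"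
  unfolding hausdorff_outer_def by (rule SUP_mono') (rule hausdorff_content_mono)

lemma hausdorff_outer_empty: "hausdorff_outer k {} = 0"
proof -
  have "hausdorff_content k \<delta> ({}::'a set) \<le> 0" if "0 < \<delta>" for \<delta>
    unfolding hausdorff_content_def
    by (rule INF_lower2[of "\<lambda>_. {}"])
       (use that in \<open>auto simp: hausdorff_covers_def hausdorff_gauge_def\<close>)
  then have "hausdorff_outer k ({}::'a set) \<le> 0"
    unfolding hausdorff_outer_def by (intro SUP_least) simp
  then show ?thesis by simp
qed

lemma hausdorff_content_countably_subadditive:
  "hausdorff_content k \<delta> (\<Union>i. A i) \<le> (\<Sum>n. hausdorff_content k \<delta> (A n))"
proof (rule ennreal_le_epsilon)
  fix e :: real assume "0 < e" "(\<Sum>n. hausdorff_content k \<delta> (A n)) < top"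
  then have *: "\<And>n. hausdorff_content k \<delta> (A n) < hausdorff_content k \<delta> (A n) + e * (1/2)^Suc n"
    by (auto simp add: less_top dest!: ennreal_suminf_lessD)
  have "\<exists>E. E \<in> hausdorff_covers \<delta> (A n) \<and>
      (\<Sum>i. hausdorff_gauge k (E i)) \<le> hausdorff_content k \<delta> (A n) + e * (1/2)^Suc n" for n
    using *[of n] unfolding hausdorff_content_def INF_less_iff by (meson less_imp_le)
  then obtain B
    where B: "\<And>n. B n \<in> hausdorff_covers \<delta> (A n)"
      and Ble: "\<And>n. (\<Sum>i. hausdorff_gauge k (B n i)) \<le> hausdorff_content k \<delta> (A n) + e * (1/2)^Suc n"
    by metis
  define C where "C = case_prod B o prod_decode"
  have C: "C \<in> hausdorff_covers \<delta> (\<Union>i. A i)"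
    using B unfolding hausdorff_covers_def C_def
    by (auto simp: split_def subset_eq) (metis prod.sel prod_encode_inverse)
  have "hausdorff_content k \<delta> (\<Union>i. A i) \<le> (\<Sum>i. hausdorff_gauge k (C i))"
    unfolding hausdorff_content_def by (rule INF_lower[OF C])
  also have "\<dots> = (\<Sum>n. \<Sum>i. hausdorff_gauge k (B n i))"
    unfolding C_def comp_def by (intro suminf_ennreal_2dimen) auto
  also have "\<dots> \<le> (\<Sum>n. hausdorff_content k \<delta> (A n) + e * (1/2) ^ Suc n)"
    by (intro suminf_le allI Ble) auto
  also have "... = (\<Sum>n. hausdorff_content k \<delta> (A n)) + (\<Sum>n. ennreal e * ennreal ((1/2) ^ Suc n))"
    using \<open>0 < e\<close> by (subst suminf_add[symmetric])
                     (auto simp del: ennreal_suminf_cmult simp add: ennreal_mult[symmetric])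
  also have "\<dots> = (\<Sum>n. hausdorff_content k \<delta> (A n)) + e"
    unfolding ennreal_suminf_cmult
    by (subst suminf_ennreal_eq[OF zero_le_power power_half_series]) auto
  finally show "hausdorff_content k \<delta> (\<Union>i. A i) \<le> (\<Sum>n. hausdorff_content k \<delta> (A n)) + e" .
qed

lemma hausdorff_outer_countably_subadditive:
  "hausdorff_outer k (\<Union>i. A i) \<le> (\<Sum>n. hausdorff_outer k (A n))"
proof -
  have "hausdorff_content k \<delta> (\<Union>i. A i) \<le> (\<Sum>n. hausdorff_outer k (A n))" if "0 < \<delta>" for \<delta>
  proof -
    have "(\<Sum>n. hausdorff_content k \<delta> (A n)) \<le> (\<Sum>n. hausdorff_outer k (A n))"
      unfolding hausdorff_outer_def using that by (intro suminf_le SUP_upper) auto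
    then show ?thesis
      using hausdorff_content_countably_subadditive order_trans by blast
  qed
  then show ?thesis
    by (subst hausdorff_outer_def) (auto intro: SUP_least)
qed

lemma outer_measure_space_hausdorff: "outer_measure_space (Pow UNIV) (hausdorff_outer k)"
  unfolding outer_measure_space_def
  by (auto simp: positive_def increasing_def countably_subadditive_def hausdorff_outer_empty
      intro: hausdorff_outer_mono hausdorff_outer_countably_subadditive)

lemma hausdorff_content_separated:
  fixes A B :: "'a::metric_space set"
  assumes sep: "\<And>x y. x \<in> A \<Longrightarrow> y \<in> B \<Longrightarrow> \<delta> < dist x y"
  shows "hausdorff_content k \<delta> A + hausdorff_content k \<delta> B \<le> hausdorff_content k \<delta> (A \<union> B)"
proof -
  have "hausdorff_content k \<delta> A + hausdorff_content k \<delta> B \<le> (\<Sum>i. hausdorff_gauge k (E i))"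
    if E: "E \<in> hausdorff_covers \<delta> (A \<union> B)" for E
  proof -
    define F where "F i = (if E i \<inter> A = {} then {} else E i)" for i
    define G where "G i = (if E i \<inter> B = {} then {} else E i)" for i
    have diam: "bounded (E i)" "diameter (E i) \<le> \<delta>" for i
      using E by (auto simp: hausdorff_covers_def)
    have disj: "E i \<inter> A = {} \<or> E i \<inter> B = {}" for i
      using sep diam[of i] diameter_bounded_bound[of "E i"]
      by (meson disjoint_iff not_le order_trans)
    have dfg: "diameter (F i) \<le> \<delta>" "diameter (G i) \<le> \<delta>" "bounded (F i)" "bounded (G i)" for i
      using diam[of i] diameter_ge_0[of "E i"] by (auto simp: F_def G_def)
    have cov: "A \<subseteq> (\<Union>i. F i)" "B \<subseteq> (\<Union>i. G i)"
      using E unfolding hausdorff_covers_def F_def G_def by fastforce+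
    have "hausdorff_content k \<delta> A + hausdorff_content k \<delta> B
        \<le> (\<Sum>i. hausdorff_gauge k (F i)) + (\<Sum>i. hausdorff_gauge k (G i))"
      unfolding hausdorff_content_def
      by (intro add_mono INF_lower) (use dfg cov in \<open>auto simp: hausdorff_covers_def\<close>)
    also have "\<dots> = (\<Sum>i. hausdorff_gauge k (F i) + hausdorff_gauge k (G i))"
      by (intro suminf_add) auto
    also have "\<dots> \<le> (\<Sum>i. hausdorff_gauge k (E i))"
      using disj by (intro suminf_le) (auto simp: F_def G_def hausdorff_gauge_def)
    finally show ?thesis .
  qed
  then show ?thesis
    by (subst (3) hausdorff_content_def) (rule INF_greatest)
qed

lemma hausdorff_outer_separated:
  fixes A B :: "'a::metric_space set"
  assumes "0 < e" and sep: "\<And>x y. x \<in> A \<Longrightarrow> y \<in> B \<Longrightarrow> e \<le> dist x y"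
  shows "hausdorff_outer k A + hausdorff_outer k B \<le> hausdorff_outer k (A \<union> B)"
proof -
  have ne: "{0<..} \<noteq> ({}::real set)" by (rule greaterThan_non_empty)
  have "hausdorff_content k s A + hausdorff_content k t B \<le> hausdorff_outer k (A \<union> B)"
    if "0 < s" "0 < t" for s t
  proof -
    define \<delta> where "\<delta> = min (e / 2) (min s t)"
    have \<delta>: "0 < \<delta>" "\<delta> < e" "\<delta> \<le> s" "\<delta> \<le> t"
      using that \<open>0 < e\<close> by (auto simp: \<delta>_def)
    have "hausdorff_content k s A + hausdorff_content k t B
        \<le> hausdorff_content k \<delta> A + hausdorff_content k \<delta> B"
      by (intro add_mono hausdorff_content_antimono \<delta>)
    also have "\<dots> \<le> hausdorff_content k \<delta> (A \<union> B)"
      using sep \<delta> by (intro hausdorff_content_separated) force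
    also have "\<dots> \<le> hausdorff_outer k (A \<union> B)"
      unfolding hausdorff_outer_def using \<delta> by (intro SUP_upper) auto
    finally show ?thesis .
  qed
  then have "(SUP s\<in>{0<..}. SUP t\<in>{0<..}. hausdorff_content k s A + hausdorff_content k t B)
      \<le> hausdorff_outer k (A \<union> B)"
    by (auto intro!: SUP_least)
  also have "(SUP s\<in>{0<..}. SUP t\<in>{0<..}. hausdorff_content k s A + hausdorff_content k t B)
      = hausdorff_outer k A + hausdorff_outer k B"
    by (simp add: hausdorff_outer_def ennreal_SUP_add_left[OF ne] ennreal_SUP_add_right[OF ne, symmetric])
  finally show ?thesis .
qed

lemma hausdorff_outer_closed_split:
  fixes C :: "'a::metric_space set"
  assumes C: "closed C"
  shows "hausdorff_outer k (A \<inter> C) + hausdorff_outer k (A - C) \<le> hausdorff_outer k A"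
proof (cases "C = {} \<or> hausdorff_outer k A = top")
  case True
  then show ?thesis by (auto simp: hausdorff_outer_empty)
next
  case False
  then have ne: "C \<noteq> {}" and fin: "hausdorff_outer k A < top"
    by (auto simp: less_top)
  let ?H = "hausdorff_outer k :: 'a set \<Rightarrow> ennreal"
  define D where "D n = {x\<in>A. 1 / real (Suc n) \<le> infdist x C}" for n
  define R where "R n = D (Suc n) - D n" for n
  have DA: "D n \<subseteq> A" for n by (auto simp: D_def)
  have Dmono: "D m \<subseteq> D n" if "m \<le> n" for m n
    using that unfolding D_def by (auto elim!: order_trans[rotated] simp: frac_le)
  have close: "?H (A \<inter> C) + ?H (D n) \<le> ?H A" for n
  proof -
    have "?H (A \<inter> C) + ?H (D n) \<le> ?H ((A \<inter> C) \<union> D n)"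
    proof (rule hausdorff_outer_separated)
      fix x y assume "x \<in> A \<inter> C" "y \<in> D n"
      then show "1 / real (Suc n) \<le> dist x y"
        using infdist_le[of x C y] by (auto simp: D_def dist_commute)
    qed simp
    also have "\<dots> \<le> ?H A" by (rule hausdorff_outer_mono) (auto simp: D_def)
    finally show ?thesis .
  qed
  have step: "?H (D m) + ?H (R (Suc m)) \<le> ?H (D (Suc (Suc m)))" for m
  proof -
    have "?H (D m) + ?H (R (Suc m)) \<le> ?H (D m \<union> R (Suc m))"
    proof (rule hausdorff_outer_separated)
      show "0 < 1 / real (Suc m) - 1 / real (Suc (Suc m))"
        using frac_less2[of 1 1 "real (Suc m)" "real (Suc (Suc m))"] by simp
      fix x y assume x: "x \<in> D m" and y: "y \<in> R (Suc m)"
      then have "1 / real (Suc m) \<le> infdist x C" "infdist y C < 1 / real (Suc (Suc m))"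
        by (auto simp: D_def R_def)
      then show "1 / real (Suc m) - 1 / real (Suc (Suc m)) \<le> dist x y"
        using infdist_triangle[of x C y] by linarith
    qed
    also have "\<dots> \<le> ?H (D (Suc (Suc m)))"
      using Dmono[of m "Suc (Suc m)"] by (intro hausdorff_outer_mono) (auto simp: R_def)
    finally show ?thesis .
  qed
  have odd: "(\<Sum>i<N. ?H (R (2 * i + 1 + j))) \<le> ?H (D (2 * N + j))" for N j
  proof (induction N)
    case (Suc N)
    then show ?case
      using step[of "2 * N + j"] by (auto intro: order_trans add_right_mono)
  qed simp
  have split: "(\<Sum>i<2 * N. ?H (R (Suc i)))
      = (\<Sum>i<N. ?H (R (2 * i + 1 + 0))) + (\<Sum>i<N. ?H (R (2 * i + 1 + 1)))" for N
    by (induction N) (auto simp: algebra_simps)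
  have bound: "(\<Sum>i<N. ?H (R (Suc i))) \<le> ?H A + ?H A" for N
  proof -
    have "(\<Sum>i<N. ?H (R (Suc i))) \<le> (\<Sum>i<2 * N. ?H (R (Suc i)))"
      by (intro sum_mono2) auto
    also have "\<dots> \<le> ?H A + ?H A"
      unfolding split
      by (intro add_mono order_trans[OF odd] hausdorff_outer_mono DA)
    finally show ?thesis .
  qed
  define S where "S = (\<Sum>i. ?H (R (Suc i)))"
  have "S \<le> ?H A + ?H A"
    unfolding S_def by (intro suminf_le_const bound) auto
  also have "\<dots> < top" using fin by simp
  finally have Sfin: "S < top" .
  have cover: "?H (A - C) \<le> ?H (D (Suc n)) + (\<Sum>i. ?H (R (Suc (i + n))))" for n
  proof -
    have "A - C \<subseteq> D (Suc n) \<union> (\<Union>i. R (Suc (i + n)))"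
    proof
      fix x assume x: "x \<in> A - C"
      then have "0 < infdist x C"
        using C ne by (metis DiffD2 in_closed_iff_infdist_zero infdist_nonneg less_le)
      then obtain m where "inverse (real (Suc m)) < infdist x C"
        using reals_Archimedean by blast
      then have "x \<in> D m" using x by (simp add: D_def inverse_eq_divide)
      define p where "p = (LEAST m. x \<in> D m)"
      have p: "x \<in> D p" "\<And>q. q < p \<Longrightarrow> x \<notin> D q"
        unfolding p_def using \<open>x \<in> D m\<close> by (auto intro: LeastI dest: not_less_Least)
      show "x \<in> D (Suc n) \<union> (\<Union>i. R (Suc (i + n)))"
      proof (cases "p \<le> Suc n")
        case True
        then show ?thesis using Dmono p by blast
      next
        case False
        then obtain i where i: "p = Suc (Suc (i + n))"
          by (metis add.commute less_iff_Suc_add not_le add_Suc)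
        then have "x \<in> R (Suc (i + n))" using p by (auto simp: R_def)
        then show ?thesis by blast
      qed
    qed
    then have "?H (A - C) \<le> ?H (D (Suc n) \<union> (\<Union>i. R (Suc (i + n))))"
      by (rule hausdorff_outer_mono)
    also have "D (Suc n) \<union> (\<Union>i. R (Suc (i + n)))
        = (\<Union>i. case i of 0 \<Rightarrow> D (Suc n) | Suc i \<Rightarrow> R (Suc (i + n)))"
      by (auto split: nat.splits)
    also have "?H \<dots> \<le> (\<Sum>i. ?H (case i of 0 \<Rightarrow> D (Suc n) | Suc i \<Rightarrow> R (Suc (i + n))))"
      by (rule hausdorff_outer_countably_subadditive)
    also have "\<dots> = ?H (D (Suc n)) + (\<Sum>i. ?H (R (Suc (i + n))))"
      using suminf_offset[of "\<lambda>i. ?H (case i of 0 \<Rightarrow> D (Suc n) | Suc i \<Rightarrow> R (Suc (i + n)))" 1]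
      by simp
    finally show ?thesis .
  qed
  show ?thesis
  proof (rule ennreal_le_epsilon)
    fix e :: real assume e: "0 < e"
    have "(\<lambda>n. \<Sum>i<n. ?H (R (Suc i))) \<longlonglongrightarrow> S"
      unfolding S_def by (intro summable_LIMSEQ) simp
    then have "(\<lambda>n. (\<Sum>i<n. ?H (R (Suc i))) + e) \<longlonglongrightarrow> S + e"
      by (intro tendsto_add tendsto_const)
    moreover have "S < S + e" using Sfin e by (auto simp: less_top)
    ultimately have "\<forall>\<^sub>F n in sequentially. S < (\<Sum>i<n. ?H (R (Suc i))) + e"
      by (rule order_tendstoD(1))
    then obtain n where n: "S < (\<Sum>i<n. ?H (R (Suc i))) + e"
      by (auto simp: eventually_sequentially)
    let ?P = "\<Sum>i<n. ?H (R (Suc i))"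
    have "S = ?P + (\<Sum>i. ?H (R (Suc (i + n))))"
      unfolding S_def
      by (subst suminf_offset[where i=n]) (auto simp: add.commute)
    moreover have "?P < top"
      by (rule le_less_trans[OF bound]) (simp add: fin)
    moreover have "S \<le> ?P + e" using n by (rule less_imp_le)
    ultimately have tail: "(\<Sum>i. ?H (R (Suc (i + n)))) \<le> e"
      by (metis ennreal_add_left_cancel_le less_irrefl infinity_ennreal_def)
    have "?H (A \<inter> C) + ?H (A - C) \<le> ?H (A \<inter> C) + (?H (D (Suc n)) + e)"
      by (intro add_mono order_refl order_trans[OF cover[of n]] tail)
    also have "\<dots> \<le> ?H A + e"
      using close[of "Suc n"] by (simp add: add.assoc[symmetric] add_right_mono)
    finally show "?H (A \<inter> C) + ?H (A - C) \<le> ?H A + e" .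
  qed
qed

lemma emeasure_hausdorff_measure:
  assumes "A \<in> sets borel"
  shows "emeasure (hausdorff_measure k) A = hausdorff_outer k A"
proof -
  let ?L = "lambda_system UNIV (Pow UNIV) (hausdorff_outer k :: 'a set \<Rightarrow> ennreal)"
  have ms: "measure_space UNIV ?L (hausdorff_outer k)"
    by (intro sigma_algebra.caratheodory_lemma sigma_algebra_Pow outer_measure_space_hausdorff)
  then have sa: "sigma_algebra UNIV ?L" by (simp add: measure_space_def)
  have "C \<in> ?L" if "closed C" for C
  proof -
    have "hausdorff_outer k (x \<inter> C) + hausdorff_outer k (x - C) = hausdorff_outer k x" for x
    proof (rule antisym)
      have "hausdorff_outer k (\<Union>i::nat. if i = 0 then x \<inter> C else if i = 1 then x - C else {})
          \<le> (\<Sum>i::nat. hausdorff_outer k (if i = 0 then x \<inter> C else if i = 1 then x - C else {}))"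
        by (rule hausdorff_outer_countably_subadditive)
      also have "\<dots> = (\<Sum>i<2::nat. hausdorff_outer k (if i = 0 then x \<inter> C else if i = 1 then x - C else {}))"
        by (rule suminf_finite) (auto simp: hausdorff_outer_empty)
      also have "\<dots> = hausdorff_outer k (x \<inter> C) + hausdorff_outer k (x - C)"
        by (simp add: numeral_2_eq_2)
      also have "(\<Union>i::nat. if i = 0 then x \<inter> C else if i = 1 then x - C else {}) = x"
        by (auto split: if_splits)
      finally show "hausdorff_outer k x \<le> hausdorff_outer k (x \<inter> C) + hausdorff_outer k (x - C)" .
    qed (rule hausdorff_outer_closed_split[OF that])
    moreover have "C \<inter> x = x \<inter> C" "(UNIV - C) \<inter> x = x - C" for x by auto
    ultimately show ?thesis
      unfolding lambda_system_def by simp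
  qed
  then have "sets borel \<subseteq> ?L"
    unfolding borel_eq_closed
    by (subst sets_measure_of) (auto intro!: sigma_algebra.sigma_sets_subset[OF sa, simplified])
  with ms have ca: "countably_additive (sets borel) (hausdorff_outer k :: 'a set \<Rightarrow> ennreal)"
    by (auto simp: measure_space_def countably_additive_def)
  show ?thesis
    unfolding hausdorff_measure_def
    using sets.sigma_algebra_axioms[of "borel :: 'a measure"] ca assms
    by (intro emeasure_measure_of_sigma) (auto simp: positive_def hausdorff_outer_empty)
qed

section \<open>Measures on the sphere\<close>

abbreviation usphere :: "'a::euclidean_space set" where
  "usphere \<equiv> sphere 0 1"

definition surface_measure :: "'a::euclidean_space measure" where
  "surface_measure = restrict_space (hausdorff_measure (DIM('a) - 1)) usphere"

definition sphere_probs :: "'a::euclidean_space measure set" where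
  "sphere_probs = {\<mu>. prob_space \<mu> \<and> sets \<mu> = sets (restrict_space borel usphere)}"

text \<open>
  Couplings live on the product of the two measurable spaces; the marginal conditions
  force them to be probability measures when the marginals are.
\<close>

definition couplings :: "'a measure \<Rightarrow> 'a measure \<Rightarrow> ('a \<times> 'a) measure set" where
  "couplings \<mu> \<nu> = {\<pi>. sets \<pi> = sets (\<mu> \<Otimes>\<^sub>M \<nu>) \<and> distr \<pi> \<mu> fst = \<mu> \<and> distr \<pi> \<nu> snd = \<nu>}"

text \<open>
  The infimum is finite for probability measures on the sphere, where the cost is at most 4.
\<close>

definition wasserstein2 :: "'a::metric_space measure \<Rightarrow> 'a measure \<Rightarrow> real" where
  "wasserstein2 \<mu> \<nu> =
     sqrt (enn2real (INF \<pi>\<in>couplings \<mu> \<nu>. \<integral>\<^sup>+p. ennreal ((dist (fst p) (snd p))\<^sup>2) \<partial>\<pi>))"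

section \<open>Calculus on the sphere\<close>

primrec Ck_on :: "nat \<Rightarrow> 'a::euclidean_space set \<Rightarrow> ('a \<Rightarrow> real) \<Rightarrow> bool" where
  "Ck_on 0 U f \<longleftrightarrow> continuous_on U f"
| "Ck_on (Suc k) U f \<longleftrightarrow> (\<forall>x\<in>U. f differentiable (at x)) \<and>
     (\<forall>b\<in>Basis. Ck_on k U (\<lambda>x. frechet_derivative f (at x) b))"

text \<open>Smooth functions on a submanifold are those that locally extend smoothly to the ambient space.\<close>

definition smooth_on_sphere :: "('a::euclidean_space \<Rightarrow> real) \<Rightarrow> bool" where
  "smooth_on_sphere \<phi> \<longleftrightarrow>
     (\<forall>x\<in>usphere. \<exists>U F. open U \<and> x \<in> U \<and> (\<forall>k. Ck_on k U F) \<and> (\<forall>y\<in>U \<inter> usphere. F y = \<phi> y))"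

definition tangent_proj :: "'a::real_inner \<Rightarrow> 'a \<Rightarrow> 'a" where
  "tangent_proj x y = y - (x \<bullet> y) *\<^sub>R x"

text \<open>
  The derivative within the sphere only sees tangential directions, so the tangent vector
  that represents it is unique. \<open>sphere_grad_eq\<close> below identifies it with the projection
  of the Euclidean gradient of any extension.
\<close>

definition sphere_grad :: "('a::euclidean_space \<Rightarrow> real) \<Rightarrow> 'a \<Rightarrow> 'a" where
  "sphere_grad \<phi> x =
     (THE g. x \<bullet> g = 0 \<and> (\<phi> has_derivative (\<lambda>h. g \<bullet> h)) (at x within usphere))"

lemma sphere_tangent_unique:
  fixes x h :: "'a::euclidean_space"
  assumes x: "x \<in> usphere" and xh: "x \<bullet> h = 0"
    and D: "((\<lambda>_. 0) has_derivative (\<lambda>v. h \<bullet> v)) (at x within usphere)"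
  shows "h = 0"
proof (rule ccontr)
  assume "h \<noteq> 0"
  define u where "u = (1 / norm h) *\<^sub>R h"
  have u: "u \<bullet> u = 1" "x \<bullet> u = 0" "h \<bullet> u = norm h" "h \<bullet> x = 0"
    using \<open>h \<noteq> 0\<close> xh by (auto simp: u_def dot_square_norm power2_eq_square inner_commute)
  have xx: "x \<bullet> x = 1" using x by (simp add: dot_square_norm)
  define c where "c s = cos s *\<^sub>R x + sin s *\<^sub>R u" for s :: real
  have c_sphere: "c s \<in> usphere" for s
  proof -
    have "c s \<bullet> c s = (cos s)\<^sup>2 + (sin s)\<^sup>2"
      using u xx by (simp add: c_def inner_add_left inner_add_right inner_commute power2_eq_square)
    then show ?thesis by (simp add: norm_eq_1)
  qed
  have "(c has_derivative (\<lambda>t. t *\<^sub>R u)) (at 0)"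
    unfolding c_def by (auto intro!: derivative_eq_intros)
  moreover have "c 0 = x" by (simp add: c_def)
  ultimately have "((\<lambda>_. 0) \<circ> c has_derivative (\<lambda>v. h \<bullet> v) \<circ> (\<lambda>t. t *\<^sub>R u)) (at 0)"
    using D c_sphere
    by (intro diff_chain_within[of c _ 0 UNIV, simplified])
       (auto intro: has_derivative_subset)
  then have "((\<lambda>_. 0::real) has_derivative (\<lambda>t. t * norm h)) (at (0::real))"
    by (simp add: comp_def u)
  then have "(\<lambda>t. t * norm h) = (\<lambda>_. 0)"
    by (rule has_derivative_unique) (rule has_derivative_const)
  then have "1 * norm h = 0" by metis
  with \<open>h \<noteq> 0\<close> show False by simp
qed

lemma sphere_gradI:
  fixes x g :: "'a::euclidean_space"
  assumes x: "x \<in> usphere" and g: "x \<bullet> g = 0"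
    and D: "(\<phi> has_derivative (\<lambda>h. g \<bullet> h)) (at x within usphere)"
  shows "sphere_grad \<phi> x = g"
  unfolding sphere_grad_def
proof (rule the_equality)
  fix g' assume g': "x \<bullet> g' = 0 \<and> (\<phi> has_derivative (\<lambda>h. g' \<bullet> h)) (at x within usphere)"
  have "((\<lambda>y. \<phi> y - \<phi> y) has_derivative (\<lambda>h. g' \<bullet> h - g \<bullet> h)) (at x within usphere)"
    using g' D by (intro has_derivative_diff) auto
  then have "((\<lambda>_. 0) has_derivative (\<lambda>h. (g' - g) \<bullet> h)) (at x within usphere)"
    by (simp add: inner_diff_left)
  moreover have "x \<bullet> (g' - g) = 0"
    using g g' by (simp add: inner_diff_right)
  ultimately have "g' - g = 0"
    using sphere_tangent_unique[OF x] by metis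
  then show "g' = g" by simp
qed (use g D in auto)

lemma sphere_grad_eq:
  fixes x G :: "'a::euclidean_space"
  assumes x: "x \<in> usphere" and U: "open U" "x \<in> U" and eq: "\<And>y. y \<in> U \<inter> usphere \<Longrightarrow> F y = \<phi> y"
    and F: "GDERIV F x :> G"
  shows "sphere_grad \<phi> x = tangent_proj x G"
proof (rule sphere_gradI[OF x])
  have xx: "x \<bullet> x = 1" using x by (simp add: dot_square_norm)
  then show "x \<bullet> tangent_proj x G = 0"
    by (simp add: tangent_proj_def inner_diff_right)
  have n: "((\<lambda>y. y \<bullet> y) has_derivative (\<lambda>h. 2 * (x \<bullet> h))) (at x within usphere)"
    by (auto intro!: derivative_eq_intros simp: inner_commute)
  have "((\<lambda>y. F y - (x \<bullet> G / 2) * (y \<bullet> y - 1)) has_derivative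
      (\<lambda>h. h \<bullet> G - (x \<bullet> G / 2) * (2 * (x \<bullet> h) - 0))) (at x within usphere)"
    using F n unfolding gderiv_def
    by (intro has_derivative_diff has_derivative_mult_right has_derivative_const)
       (auto intro: has_derivative_at_withinI)
  then have "((\<lambda>y. F y - (x \<bullet> G / 2) * (y \<bullet> y - 1)) has_derivative
      (\<lambda>h. tangent_proj x G \<bullet> h)) (at x within usphere)"
    by (simp add: tangent_proj_def inner_diff_left inner_diff_right inner_commute mult.commute)
  moreover have "\<forall>\<^sub>F y in at x within usphere. F y - (x \<bullet> G / 2) * (y \<bullet> y - 1) = \<phi> y"
    unfolding eventually_at_topological
    using U eq by (intro exI[of _ U]) (auto simp: dot_square_norm)
  moreover have "F x - (x \<bullet> G / 2) * (x \<bullet> x - 1) = \<phi> x"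
    using eq U x xx by auto
  ultimately show "(\<phi> has_derivative (\<lambda>h. tangent_proj x G \<bullet> h)) (at x within usphere)"
    using x by (blast intro: has_derivative_transform_eventually)
qed

section \<open>Continuity equation\<close>

definition narrowly_continuous :: "real \<Rightarrow> (real \<Rightarrow> 'a::euclidean_space measure) \<Rightarrow> bool" where
  "narrowly_continuous T \<rho> \<longleftrightarrow>
     (\<forall>\<phi>. continuous_on usphere \<phi> \<longrightarrow> continuous_on {0..T} (\<lambda>t. LINT x|\<rho> t. (\<phi> x :: real)))"

text \<open>
  The velocity may depend on the current measure: \<open>v \<mu> x\<close> is the velocity at \<open>x\<close> in state \<open>\<mu>\<close>.
\<close>

definition weak_solution ::
  "real \<Rightarrow> ('a::euclidean_space measure \<Rightarrow> 'a \<Rightarrow> 'a) \<Rightarrow> (real \<Rightarrow> 'a measure) \<Rightarrow> bool" where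
  "weak_solution T v \<rho> \<longleftrightarrow>
     (\<forall>t\<in>{0..T}. \<rho> t \<in> sphere_probs) \<and> narrowly_continuous T \<rho> \<and>
     (\<forall>\<phi>. smooth_on_sphere \<phi> \<longrightarrow>
        set_integrable lborel {0..T} (\<lambda>t. LINT x|\<rho> t. sphere_grad \<phi> x \<bullet> v (\<rho> t) x) \<and>
        (\<forall>t\<in>{0..T}. (LINT x|\<rho> t. \<phi> x) - (LINT x|\<rho> 0. \<phi> x) =
           (LINT s:{0..t}|lborel. LINT x|\<rho> s. sphere_grad \<phi> x \<bullet> v (\<rho> s) x)))"

definition attention_field ::
  "real \<Rightarrow> real^'n^'n \<Rightarrow> real^'n^'n \<Rightarrow> (real^'n) measure \<Rightarrow> real^'n \<Rightarrow> real^'n" where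
  "attention_field \<beta> B V \<mu> x = tangent_proj x
     (LINT y|\<mu>. (exp (\<beta> * (x \<bullet> (B *v y))) / (LINT z|\<mu>. exp (\<beta> * (x \<bullet> (B *v z))))) *\<^sub>R (V *v y))"

definition hardmax_field :: "real^'n^'n \<Rightarrow> real^'n^'n \<Rightarrow> real^'n \<Rightarrow> real^'n" where
  "hardmax_field B V x = tangent_proj x
     ((1 / norm (transpose B *v x)) *\<^sub>R (V *v (transpose B *v x)))"

section \<open>Singular values\<close>

definition singular_values :: "real^'n^'n \<Rightarrow> real set" where
  "singular_values A = {s. 0 \<le> s \<and> (\<exists>v. v \<noteq> 0 \<and> (transpose A ** A) *v v = s\<^sup>2 *\<^sub>R v)}"

definition sigma_max :: "real^'n^'n \<Rightarrow> real" where
  "sigma_max A = Max (singular_values A)"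

definition sigma_min :: "real^'n^'n \<Rightarrow> real" where
  "sigma_min A = Min (singular_values A)"

lemma inner_gram: "u \<bullet> ((transpose A ** A) *v w) = (A *v u) \<bullet> (A *v w)"
  for A :: "real^'n^'n"
  unfolding matrix_vector_mul_assoc[symmetric] dot_lmul_matrix[symmetric] vector_transpose_matrix ..

lemma finite_singular_values: "finite (singular_values A)"
proof -
  let ?S = "singular_values A"
  define f where "f s = (SOME v. v \<noteq> 0 \<and> (transpose A ** A) *v v = s\<^sup>2 *\<^sub>R v)" for s
  have f: "f s \<noteq> 0" "(transpose A ** A) *v f s = s\<^sup>2 *\<^sub>R f s" "0 \<le> s" if "s \<in> ?S" for s
    using that someI_ex[of "\<lambda>v. v \<noteq> 0 \<and> (transpose A ** A) *v v = s\<^sup>2 *\<^sub>R v"]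
    by (auto simp: singular_values_def f_def)
  have orth: "f s \<bullet> f t = 0" if "s \<in> ?S" "t \<in> ?S" "s \<noteq> t" for s t
  proof -
    have "t\<^sup>2 * (f s \<bullet> f t) = (A *v f s) \<bullet> (A *v f t)"
      using inner_gram[of "f s" A "f t"] f(2)[OF that(2)] by simp
    moreover have "s\<^sup>2 * (f t \<bullet> f s) = (A *v f t) \<bullet> (A *v f s)"
      using inner_gram[of "f t" A "f s"] f(2)[OF that(1)] by simp
    ultimately have "(s\<^sup>2 - t\<^sup>2) * (f s \<bullet> f t) = 0"
      by (simp add: inner_commute algebra_simps)
    moreover have "s\<^sup>2 \<noteq> t\<^sup>2" using f(3) that by (simp add: power2_eq_iff_nonneg)
    ultimately show ?thesis by simp
  qed
  have "inj_on f ?S"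
    using orth f(1) by (metis inj_onI inner_eq_zero_iff)
  moreover have "finite (f ` ?S)"
    using orth by (intro pairwise_orthogonal_imp_finite) (auto simp: pairwise_def orthogonal_def)
  ultimately show ?thesis by (metis finite_imageD)
qed

lemma singular_values_nonempty:
  fixes A :: "real^'n^'n"
  shows "singular_values A \<noteq> {}"
proof -
  have "continuous_on (sphere 0 1) (\<lambda>v. norm (A *v v))"
    by (intro continuous_intros matrix_vector_mult_linear_continuous_on)
  moreover have "sphere (0::real^'n) 1 \<noteq> {}" by simp
  ultimately obtain v where v: "norm v = 1"
      and max: "\<And>w. norm w = 1 \<Longrightarrow> norm (A *v w) \<le> norm (A *v v)"
    using continuous_attains_sup[of "sphere (0::real^'n) 1" "\<lambda>v. norm (A *v v)"] by auto
  define m where "m = norm (A *v v)"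
  have bound: "norm (A *v w) \<le> m * norm w" for w
  proof (cases "w = 0")
    case False
    then have "norm (A *v ((1 / norm w) *\<^sub>R w)) \<le> m"
      unfolding m_def by (intro max) simp
    then show ?thesis using False by (simp add: matrix_vector_mult_scaleR divide_simps mult.commute)
  qed simp
  define r where "r = m\<^sup>2 *\<^sub>R v - (transpose A ** A) *v v"
  define q where "q w = m\<^sup>2 * (w \<bullet> w) - (A *v w) \<bullet> (A *v w)" for w
  have q: "0 \<le> q w" for w
    using power_mono[OF bound[of w], of 2] unfolding q_def
    by (simp add: dot_square_norm power_mult_distrib)
  have q_exp: "q (v + t *\<^sub>R r) = 2 * t * (r \<bullet> r) + t\<^sup>2 * q r" for t
  proof -
    have "q v = 0" using v by (simp add: q_def m_def dot_square_norm)
    moreover have "r \<bullet> r = m\<^sup>2 * (v \<bullet> r) - (A *v v) \<bullet> (A *v r)"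
      using inner_gram[of r A v]
      by (subst (2) r_def) (simp add: inner_diff_right inner_commute)
    moreover have "q (v + t *\<^sub>R r) = q v + 2 * t * (m\<^sup>2 * (v \<bullet> r) - (A *v v) \<bullet> (A *v r)) + t\<^sup>2 * q r"
      by (simp add: q_def matrix_vector_right_distrib matrix_vector_mult_scaleR inner_add_left
          inner_add_right inner_commute algebra_simps power2_eq_square)
    ultimately show ?thesis by simp
  qed
  have "r = 0"
  proof (rule ccontr)
    assume "r \<noteq> 0"
    then have rr: "0 < r \<bullet> r" by simp
    define t where "t = - (r \<bullet> r) / (q r + 1)"
    have p: "0 < q r + 1" using q[of r] by simp
    have "q (v + t *\<^sub>R r) = t * (2 * (r \<bullet> r) + t * q r)"
      unfolding q_exp by (simp add: algebra_simps power2_eq_square)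
    moreover have "t < 0" using rr p by (simp add: t_def divide_neg_pos)
    moreover have "t * q r \<ge> - (r \<bullet> r)"
      using rr p q[of r] by (simp add: t_def field_simps)
    ultimately have "q (v + t *\<^sub>R r) < 0"
      using rr mult_neg_pos[of t "2 * (r \<bullet> r) + t * q r"] by linarith
    with q show False by (metis not_less)
  qed
  then have "m \<in> singular_values A"
    using v by (auto simp: singular_values_def r_def m_def intro!: exI[of _ v])
  then show ?thesis by blast
qed

end

theory Submission
  imports Defs
begin

text \<open>
  Both solutions are images of \<open>\<rho>\<^sub>0\<close> under the characteristic flows of their velocity fields, say
  \<open>X\<^sup>\<beta>\<^sub>t\<close> and \<open>X\<^sub>t\<close>. The image of \<open>\<rho>\<^sub>0\<close> under \<open>x \<mapsto> (X\<^sup>\<beta>\<^sub>t x, X\<^sub>t x)\<close> is therefore a coupling, and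
  \<open>W\<^sub>2\<close> is at most \<open>\<delta>(t) = sup\<^sub>x \<parallel>X\<^sup>\<beta>\<^sub>t x - X\<^sub>t x\<parallel>\<close>. The theorem is a Gronwall estimate for \<open>\<delta>\<close>.

  At a point \<open>x\<close> the attention field averages over weights proportional to \<open>exp (- \<theta> q(y))\<close>, where
  \<open>p = B\<^sup>T x / \<parallel>B\<^sup>T x\<parallel>\<close>, \<open>\<theta> = \<beta> \<parallel>B\<^sup>T x\<parallel>\<close> and \<open>q(y) = \<parallel>y - p\<parallel>\<^sup>2 / 2\<close>, while the hardmax field puts all
  weight at \<open>p\<close>. Jensen's inequality bounds \<open>\<theta>\<close> times the average of \<open>q\<close> by \<open>- ln Z\<close> with \<open>Z\<close> the
  partition function (\<open>gibbs_average_le\<close>, \<open>attention_error_le_partition\<close>). The lower bound of \<open>Z\<close>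
  does not come from the density of the attention solution at time \<open>t\<close>, whose evolution involves the divergence of
  the attention field and hence \<open>\<beta>\<close>. It comes from the flows: the points that \<open>X\<^sub>t\<close> brings within \<open>r\<close> of \<open>p\<close> are
  brought within \<open>\<delta>(t) + r\<close> of \<open>p\<close> by \<open>X\<^sup>\<beta>\<^sub>t\<close>, and since \<open>X\<^sub>t\<close> is invertible with expansion at most
  \<open>exp (L t)\<close>, they contain a cap of radius \<open>r exp (- L t)\<close>, which has initial mass at least \<open>\<ell>\<^sub>0\<close> times a
  power of that radius. So \<open>- ln Z \<le> \<theta> (\<delta> + r)\<^sup>2 / 2 + O(1 + ln (1 / r) + t)\<close>, and with
  \<open>r = (\<beta> + 1) powr (- 1/2)\<close> the fields differ by at most \<open>sigma_max V * \<delta>(t) + K \<epsilon> e\<^sup>t\<close>, where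
  \<open>\<epsilon> = sqrt (ln (\<beta> + 1) / \<beta>)\<close> (\<open>field_error\<close>). Hence \<open>\<delta>' \<le> (L + sigma_max V) \<delta> + K \<epsilon> e\<^sup>t\<close>, and
  \<open>2 \<epsilon> (exp (C\<^sub>1 t) - exp t)\<close> is a supersolution once \<open>C\<^sub>1\<close> is large (\<open>flow_deviation\<close>). In particular
  \<open>C\<^sub>0 = 1\<close> is a possible choice.

  The representation by flows (\<open>weak_solution_transported\<close>) is a uniqueness statement for weak solutions
  that are tested with smooth functions only. It is proved by comparing the solution with the transported measure
  along Euler steps. Over one step the error of either curve, tested with a \<open>\<Lambda>\<close>-Lipschitz function, is \<open>\<Lambda> o(h)\<close>
  (\<open>weak_solution_step\<close>, \<open>flow_step\<close>), and the Euler maps multiply Lipschitz constants by \<open>1 + O(h)\<close>, so the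
  total error tends to \<open>0\<close>. The Euler maps use smooth approximations of the velocity whose Lipschitz constants are bounded
  in terms of that of the velocity, so all test functions stay smooth (\<open>smooth_lipschitz_approximation\<close>).
\<close>

section \<open>Smooth functions\<close>

lemma Ck_on_cong:
  assumes "open U" "\<And>x. x \<in> U \<Longrightarrow> f x = g x" "Ck_on k U f"
  shows "Ck_on k U g"
  using assms(2,3)
proof (induction k arbitrary: f g)
  case 0
  then show ?case by (simp cong: continuous_on_cong)
next
  case (Suc k)
  have D: "(g has_derivative frechet_derivative f (at x)) (at x)" if "x \<in> U" for x
    using Suc.prems that assms(1)
    by (auto intro!: has_derivative_transform_within_open[of f _ x UNIV U g] simp: frechet_derivative_works)
  then have eq: "frechet_derivative g (at x) = frechet_derivative f (at x)" if "x \<in> U" for x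
    using that frechet_derivative_at by metis
  show ?case
    using D Suc.IH[of "\<lambda>x. frechet_derivative f (at x) _" "\<lambda>x. frechet_derivative g (at x) _"] Suc.prems(2) eq
    by (auto simp: differentiable_def)
qed

lemma Ck_on_SucI:
  assumes "open U" "\<And>x. x \<in> U \<Longrightarrow> (f has_derivative D x) (at x)"
    "\<And>b. b \<in> Basis \<Longrightarrow> Ck_on k U (\<lambda>x. D x b)"
  shows "Ck_on (Suc k) U f"
proof -
  have "D x = frechet_derivative f (at x)" if "x \<in> U" for x
    using assms(2)[OF that] frechet_derivative_at by blast
  then have "Ck_on k U (\<lambda>x. frechet_derivative f (at x) b)" if "b \<in> Basis" for b
    by (intro Ck_on_cong[OF assms(1) _ assms(3)[OF that]]) simp
  then show ?thesis using assms(2) by (auto simp: differentiable_def)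
qed

lemma Ck_on_SucD:
  assumes "Ck_on (Suc k) U f" "x \<in> U"
  shows "(f has_derivative frechet_derivative f (at x)) (at x)"
  using assms by (simp add: frechet_derivative_works)

lemma Ck_on_decrease: "Ck_on (Suc k) U f \<Longrightarrow> Ck_on k U f"
proof (induction k arbitrary: f)
  case 0
  then show ?case
    by (auto intro!: continuous_at_imp_continuous_on differentiable_imp_continuous_within)
qed auto

lemma Ck_on_const: "Ck_on k U (\<lambda>_. c)"
proof (induction k arbitrary: c)
  case (Suc k)
  have "frechet_derivative (\<lambda>_::'a. c) (at x) = (\<lambda>_. 0)" for x
    using frechet_derivative_at[OF has_derivative_const[of c]] by metis
  then show ?case using Suc by simp
qed simp

lemma Ck_on_bounded_linear:
  assumes "open U" "bounded_linear f" shows "Ck_on k U f"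
proof (cases k)
  case 0 then show ?thesis using assms by (simp add: linear_continuous_on)
next
  case (Suc n)
  show ?thesis unfolding Suc
    by (rule Ck_on_SucI[OF assms(1) bounded_linear_imp_has_derivative[OF assms(2)]]) (rule Ck_on_const)
qed

lemma Ck_on_add:
  assumes "open U" "Ck_on k U f" "Ck_on k U g"
  shows "Ck_on k U (\<lambda>x. f x + g x)"
  using assms(2,3)
proof (induction k arbitrary: f g)
  case (Suc k)
  show ?case
    by (rule Ck_on_SucI[OF assms(1) has_derivative_add[OF Ck_on_SucD Ck_on_SucD]])
       (use Suc in auto)
qed (auto intro: continuous_intros)

lemma Ck_on_mult:
  assumes "open U" "Ck_on k U f" "Ck_on k U g"
  shows "Ck_on k U (\<lambda>x. f x * g x)"
  using assms(2,3)
proof (induction k arbitrary: f g)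
  case (Suc k)
  show ?case
    by (rule Ck_on_SucI[OF assms(1) has_derivative_mult[OF Ck_on_SucD Ck_on_SucD]])
       (use Suc Ck_on_decrease[OF Suc.prems(1)] Ck_on_decrease[OF Suc.prems(2)] in
        \<open>auto intro!: Ck_on_add[OF assms(1)]\<close>)
qed (auto intro: continuous_intros)

lemma Ck_on_sum:
  assumes "open U" "\<And>i. i \<in> I \<Longrightarrow> Ck_on k U (f i)"
  shows "Ck_on k U (\<lambda>x. \<Sum>i\<in>I. f i x)"
  using assms(2) by (induction I rule: infinite_finite_induct)
    (auto intro: Ck_on_const Ck_on_add[OF assms(1)])

text \<open>
  The partial derivatives of \<open>g \<circ> F\<close> are sums of products of partial derivatives of \<open>F\<close> with
  partial derivatives of \<open>g\<close> composed with \<open>F\<close>, so the induction on \<open>k\<close> runs over all \<open>g\<close> at once.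
\<close>

lemma Ck_on_compose:
  fixes F :: "'a::euclidean_space \<Rightarrow> 'b::euclidean_space"
  assumes U: "open U" and V: "open V" and FV: "F ` U \<subseteq> V"
    and F: "\<And>i. i \<in> Basis \<Longrightarrow> Ck_on k U (\<lambda>x. F x \<bullet> i)" and g: "Ck_on k V g"
  shows "Ck_on k U (\<lambda>x. g (F x))"
  using F g
proof (induction k arbitrary: g)
  case 0
  then show ?case
    using FV continuous_on_compose2[of V g U F] by (simp add: continuous_on_componentwise[of U F])
next
  case (Suc k)
  define D where "D x v = (\<Sum>i\<in>Basis. frechet_derivative (\<lambda>x. F x \<bullet> i) (at x) v *\<^sub>R i)" for x v
  have DF: "(F has_derivative D x) (at x)" if "x \<in> U" for x
    unfolding has_derivative_componentwise_within[of F]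
    using that Ck_on_SucD[OF Suc.prems(1)] by (simp add: D_def inner_sum_left inner_Basis if_distrib cong: if_cong)
  have lin: "linear (frechet_derivative g (at (F x)))" if "x \<in> U" for x
    using Ck_on_SucD[OF Suc.prems(2), of "F x"] that FV has_derivative_linear by blast
  show ?case
  proof (rule Ck_on_SucI[OF U])
    fix x assume x: "x \<in> U"
    have "((\<lambda>x. g (F x)) has_derivative (\<lambda>v. frechet_derivative g (at (F x)) (D x v))) (at x)"
      using diff_chain_at[OF DF[OF x] Ck_on_SucD[OF Suc.prems(2)]] x FV by (auto simp: o_def)
    also have "(\<lambda>v. frechet_derivative g (at (F x)) (D x v)) =
      (\<lambda>v. \<Sum>i\<in>Basis. frechet_derivative (\<lambda>x. F x \<bullet> i) (at x) v * frechet_derivative g (at (F x)) i)"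
      unfolding D_def by (simp add: linear_sum[OF lin[OF x]] linear_cmul[OF lin[OF x]])
    finally show "((\<lambda>x. g (F x)) has_derivative
      (\<lambda>v. \<Sum>i\<in>Basis. frechet_derivative (\<lambda>x. F x \<bullet> i) (at x) v * frechet_derivative g (at (F x)) i)) (at x)" .
  next
    fix b :: 'a assume b: "b \<in> Basis"
    have "Ck_on k U (\<lambda>x. frechet_derivative g (at (F x)) i)" if "i \<in> Basis" for i
      using Suc.IH[OF Ck_on_decrease[OF Suc.prems(1)], of "\<lambda>y. frechet_derivative g (at y) i"]
        Suc.prems(2) that by simp
    moreover have "Ck_on k U (\<lambda>x. frechet_derivative (\<lambda>x. F x \<bullet> i) (at x) b)" if "i \<in> Basis" for i
      using Suc.prems(1)[OF that] b by simp
    ultimately show "Ck_on k U (\<lambda>x. \<Sum>i\<in>Basis. frechet_derivative (\<lambda>x. F x \<bullet> i) (at x) b * frechet_derivative g (at (F x)) i)"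
      by (intro Ck_on_sum[OF U] Ck_on_mult[OF U])
  qed
qed

lemma Ck_on_compose_real:
  assumes "open U" "open V" "f ` U \<subseteq> V" "Ck_on k U f" "Ck_on k V (g :: real \<Rightarrow> real)"
  shows "Ck_on k U (\<lambda>x. g (f x))"
  by (rule Ck_on_compose[OF assms(1-3) _ assms(5)]) (use assms(4) in simp)

lemma Ck_on_exp: "Ck_on k UNIV (exp :: real \<Rightarrow> real)"
proof (induction k)
  case (Suc k)
  show ?case
    by (rule Ck_on_SucI[where D = "\<lambda>x v. v * exp x"])
       (auto intro!: derivative_eq_intros simp: Suc)
qed (auto intro: continuous_intros)

text \<open>
  The derivative of the logarithm is \<open>exp \<circ> uminus \<circ> ln\<close>, which makes the induction close.
\<close>

lemma Ck_on_ln: "Ck_on k {0<..} (ln :: real \<Rightarrow> real)"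
proof (induction k)
  case (Suc k)
  have "Ck_on k {0<..} (\<lambda>x::real. exp (- 1 * ln x))"
    by (intro Ck_on_compose_real[OF _ open_UNIV _ _ Ck_on_exp] Ck_on_mult Ck_on_const Suc) auto
  then have "Ck_on k {0<..} (\<lambda>x::real. 1 / x)"
    by (rule Ck_on_cong[rotated 2]) (auto simp: exp_minus divide_inverse)
  then show ?case
    by (intro Ck_on_SucI[where D = "\<lambda>x v. v * (1 / x)"])
       (auto intro!: derivative_eq_intros simp: divide_inverse)
qed (auto intro: continuous_intros)

definition smooth :: "('a::euclidean_space \<Rightarrow> real) \<Rightarrow> bool" where
  "smooth f \<longleftrightarrow> (\<forall>k. Ck_on k UNIV f)"

lemma smooth_const: "smooth (\<lambda>_. c)"
  unfolding smooth_def by (intro allI Ck_on_const)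

lemma smooth_bounded_linear: "bounded_linear f \<Longrightarrow> smooth f"
  unfolding smooth_def by (intro allI Ck_on_bounded_linear open_UNIV)

lemma smooth_add: "smooth f \<Longrightarrow> smooth g \<Longrightarrow> smooth (\<lambda>x. f x + g x)"
  unfolding smooth_def by (intro allI Ck_on_add open_UNIV) (erule spec)+

lemma smooth_mult: "smooth f \<Longrightarrow> smooth g \<Longrightarrow> smooth (\<lambda>x. f x * g x)"
  unfolding smooth_def by (intro allI Ck_on_mult open_UNIV) (erule spec)+

lemma smooth_sum: "(\<And>i. i \<in> I \<Longrightarrow> smooth (h i)) \<Longrightarrow> smooth (\<lambda>x. \<Sum>i\<in>I. h i x)"
  unfolding smooth_def by (intro allI Ck_on_sum open_UNIV) blast

lemma smooth_exp: "smooth f \<Longrightarrow> smooth (\<lambda>x. exp (f x))"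
  unfolding smooth_def
  by (intro allI Ck_on_compose_real[OF open_UNIV open_UNIV subset_UNIV _ Ck_on_exp]) (erule spec)

lemma smooth_ln:
  assumes "smooth f" "\<And>x. 0 < f x" shows "smooth (\<lambda>x. ln (f x))"
  unfolding smooth_def
proof
  fix k
  have f: "Ck_on k UNIV f" using assms(1) unfolding smooth_def by (rule spec)
  show "Ck_on k UNIV (\<lambda>x. ln (f x))"
    by (rule Ck_on_compose_real[OF open_UNIV open_greaterThan _ f Ck_on_ln])
       (use assms(2) in \<open>simp add: image_subset_iff\<close>)
qed

lemma smooth_sqrt:
  assumes "smooth f" "\<And>x. 0 < f x" shows "smooth (\<lambda>x. sqrt (f x))"
proof -
  have "smooth (\<lambda>x. exp (1/2 * ln (f x)))"
    by (intro smooth_exp smooth_mult smooth_const smooth_ln assms)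
  moreover have "exp (1/2 * ln (f x)) = sqrt (f x)" for x
    using assms(2)[of x] exp_ln[of "sqrt (f x)"] ln_sqrt[of "f x"] by simp
  ultimately show ?thesis by simp
qed

lemma smooth_compose:
  fixes F :: "'a::euclidean_space \<Rightarrow> 'b::euclidean_space"
  assumes "smooth g" "\<And>i. i \<in> Basis \<Longrightarrow> smooth (\<lambda>x. F x \<bullet> i)"
  shows "smooth (\<lambda>x. g (F x))"
  unfolding smooth_def
proof
  fix k
  have F: "Ck_on k UNIV (\<lambda>x. F x \<bullet> i)" if "i \<in> Basis" for i
    using assms(2)[OF that] unfolding smooth_def by (rule spec)
  have g: "Ck_on k UNIV g"
    using assms(1) unfolding smooth_def by (rule spec)
  show "Ck_on k UNIV (\<lambda>x. g (F x))"
    by (rule Ck_on_compose[OF open_UNIV open_UNIV subset_UNIV F g])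
qed

lemma smooth_on_sphere_smooth:
  assumes "smooth f" shows "smooth_on_sphere f"
  unfolding smooth_on_sphere_def
proof
  fix x :: 'a
  show "\<exists>U F. open U \<and> x \<in> U \<and> (\<forall>k. Ck_on k U F) \<and> (\<forall>y\<in>U \<inter> usphere. F y = f y)"
    by (rule exI[of _ UNIV], rule exI[of _ f]) (use assms[unfolded smooth_def] in simp)
qed

lemma smooth_has_derivative:
  "smooth f \<Longrightarrow> (f has_derivative frechet_derivative f (at x)) (at x)"
  using Ck_on_SucD[of 0 UNIV f x] by (simp only: smooth_def UNIV_I simp_thms)

lemma smooth_derivative_continuous:
  assumes "smooth f" "continuous_on A p" "continuous_on A q"
  shows "continuous_on A (\<lambda>x. frechet_derivative f (at (p x)) (q x))"
proof -
  have lin: "linear (frechet_derivative f (at x))" for x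
    by (rule has_derivative_linear[OF smooth_has_derivative[OF assms(1)]])
  have eq: "frechet_derivative f (at y) v = (\<Sum>i\<in>Basis. (v \<bullet> i) * frechet_derivative f (at y) i)" for y v
  proof -
    have "frechet_derivative f (at y) v = frechet_derivative f (at y) (\<Sum>i\<in>Basis. (v \<bullet> i) *\<^sub>R i)"
      by (simp only: euclidean_representation)
    also have "\<dots> = (\<Sum>i\<in>Basis. (v \<bullet> i) * frechet_derivative f (at y) i)"
      by (simp only: linear_sum[OF lin] linear_cmul[OF lin] real_scaleR_def)
    finally show ?thesis .
  qed
  have cont: "continuous_on UNIV (\<lambda>x. frechet_derivative f (at x) i)" if "i \<in> Basis" for i
  proof -
    have "Ck_on (Suc 0) UNIV f" using assms(1) by (simp only: smooth_def)
    then show ?thesis using that by simp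
  qed
  have "continuous_on A (\<lambda>x. \<Sum>i\<in>Basis. (q x \<bullet> i) * frechet_derivative f (at (p x)) i)"
    by (intro continuous_intros continuous_on_compose2[OF cont assms(2)] assms(3)) auto
  then show ?thesis by (simp only: eq[symmetric])
qed

text \<open>
  A soft minimum of finitely many functions \<open>f y + \<Lambda> \<parallel>x - y\<parallel>\<close>, with \<open>y\<close> in a fine net of \<open>S\<close> and
  the norm smoothed at the origin, is smooth and inherits the Lipschitz constant of each of them. It is
  close to \<open>f\<close> because on \<open>S\<close> each of these functions lies above \<open>f\<close> and one of them, with
  \<open>y\<close> near \<open>x\<close>, is hardly larger than \<open>f x\<close>. This does the work of a mollification and extends \<open>f\<close> to the whole
  space at the same time.
\<close>

lemma smooth_lipschitz_approximation:
  fixes f :: "'a::euclidean_space \<Rightarrow> real"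
  assumes S: "compact S" "S \<noteq> {}" and f: "\<Lambda>-lipschitz_on S f" and e: "0 < e"
  obtains g where "smooth g" "\<Lambda>-lipschitz_on UNIV g" "\<And>x. x \<in> S \<Longrightarrow> \<bar>g x - f x\<bar> \<le> e"
proof -
  have L: "0 \<le> \<Lambda>" using f lipschitz_on_nonneg by blast
  define r where "r = e / (3 * (\<Lambda> + 1))"
  have r: "0 < r" "3 * \<Lambda> * r \<le> e" using L e by (auto simp: r_def field_simps)
  have "S \<subseteq> (\<Union>y\<in>S. ball y r)" using r(1) by auto
  then obtain N where N: "N \<subseteq> S" "finite N" "S \<subseteq> (\<Union>y\<in>N. ball y r)"
    by (rule compactE_image[OF S(1) open_ball])
  then have Nne: "N \<noteq> {}" using S(2) by auto
  \<comment> \<open>the soft minimum undershoots the minimum by at most \<open>\<kappa>\<close> times the logarithm of the number of terms\<close>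
  define \<kappa> where "\<kappa> = e / (ln (real (card N)) + 1)"
  have c1: "1 \<le> real (card N)" using N Nne by (simp add: Suc_le_eq card_gt_0_iff)
  then have ln0: "0 \<le> ln (real (card N))" by simp
  then have k: "0 < \<kappa>" "\<kappa> * ln (real (card N)) \<le> e" using e by (auto simp: \<kappa>_def field_simps)
  define h where "h y x = f y + \<Lambda> * sqrt ((norm (x - y))\<^sup>2 + r\<^sup>2)" for x y
  define Z where "Z x = (\<Sum>y\<in>N. exp (- h y x / \<kappa>))" for x
  define g where "g x = - \<kappa> * ln (Z x)" for x
  have Z: "0 < Z x" for x unfolding Z_def by (intro sum_pos N Nne) auto
  have h_lip: "h y x \<le> h y x' + \<Lambda> * dist x x'" for x x' y
  proof -
    have "sqrt ((norm (x - y))\<^sup>2 + r\<^sup>2) \<le> sqrt ((norm (x' - y) + dist x x')\<^sup>2 + r\<^sup>2)"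
      using norm_triangle_ineq[of "x' - y" "x - x'"] by (intro real_sqrt_le_mono add_right_mono power_mono) (auto simp: dist_norm)
    also have "\<dots> \<le> sqrt ((norm (x' - y))\<^sup>2 + r\<^sup>2) + dist x x'"
      using real_sqrt_sum_squares_triangle_ineq[of "norm (x' - y)" "dist x x'" r 0] by simp
    finally show ?thesis using L mult_left_mono unfolding h_def by (fastforce simp: algebra_simps)
  qed
  have g_mono: "g x \<le> g x' + c" if "\<And>y. y \<in> N \<Longrightarrow> h y x \<le> h y x' + c" for x x' c
  proof -
    have "- h y x' / \<kappa> + - c / \<kappa> \<le> - h y x / \<kappa>" if "y \<in> N" for y
    proof -
      have "h y x / \<kappa> \<le> (h y x' + c) / \<kappa>"
        using \<open>\<And>y. y \<in> N \<Longrightarrow> h y x \<le> h y x' + c\<close>[OF that] k by (intro divide_right_mono) auto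
      then show ?thesis by (simp add: add_divide_distrib)
    qed
    then have "Z x' * exp (- c / \<kappa>) \<le> Z x"
      unfolding Z_def sum_distrib_right exp_add[symmetric] by (intro sum_mono) simp
    then have "ln (Z x' * exp (- c / \<kappa>)) \<le> ln (Z x)" using Z by (subst ln_le_cancel_iff) auto
    then have "ln (Z x') - c / \<kappa> \<le> ln (Z x)" using Z[of x'] by (simp add: ln_mult)
    then show ?thesis using k(1) by (simp add: g_def field_simps)
  qed
  have "smooth g"
  proof -
    have "smooth (h y)" for y
    proof -
      have "smooth (\<lambda>x. (\<Sum>b\<in>Basis. (x \<bullet> b + - (y \<bullet> b)) * (x \<bullet> b + - (y \<bullet> b))) + r\<^sup>2)"
        by (intro smooth_add smooth_sum smooth_mult smooth_const smooth_bounded_linear bounded_linear_inner_left)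
      also have "(\<lambda>x. (\<Sum>b\<in>Basis. (x \<bullet> b + - (y \<bullet> b)) * (x \<bullet> b + - (y \<bullet> b))) + r\<^sup>2) = (\<lambda>x. (norm (x - y))\<^sup>2 + r\<^sup>2)"
        unfolding power2_norm_eq_inner by (subst euclidean_inner) (simp add: inner_diff_left)
      finally show ?thesis unfolding h_def
        by (rule smooth_add[OF smooth_const smooth_mult[OF smooth_const smooth_sqrt]])
           (use r in \<open>auto intro: add_nonneg_pos\<close>)
    qed
    then have "smooth (\<lambda>x. exp (h y x * (- 1 / \<kappa>)))" for y
      by (rule smooth_exp[OF smooth_mult[OF _ smooth_const]])
    then have "smooth Z" unfolding Z_def by (intro smooth_sum) simp
    then show ?thesis unfolding g_def by (intro smooth_mult smooth_const smooth_ln Z)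
  qed
  moreover have "\<Lambda>-lipschitz_on UNIV g"
  proof (rule lipschitz_onI[OF _ L])
    fix x y :: 'a
    show "dist (g x) (g y) \<le> \<Lambda> * dist x y"
      using g_mono[of x y "\<Lambda> * dist x y"] g_mono[of y x "\<Lambda> * dist x y"] h_lip[of _ x y] h_lip[of _ y x]
      by (auto simp: dist_real_def dist_commute)
  qed
  moreover have "\<bar>g x - f x\<bar> \<le> e" if x: "x \<in> S" for x
  proof -
    obtain y where y: "y \<in> N" "dist x y < r" using N(3) x by (auto simp: dist_commute)
    have "exp (- h y x / \<kappa>) \<le> Z x" unfolding Z_def using y N by (intro member_le_sum) auto
    then have "- h y x / \<kappa> \<le> ln (Z x)" using Z by (simp add: ln_ge_iff)
    then have "g x \<le> h y x" using k by (simp add: g_def field_simps)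
    also have "h y x \<le> f y + \<Lambda> * (dist x y + r)"
      unfolding h_def using L r sqrt_sum_squares_le_sum[of "norm (x - y)" r]
      by (auto intro!: mult_left_mono simp: dist_norm)
    also have "f y \<le> f x + \<Lambda> * dist x y"
      using lipschitz_onD[OF f, of y x] x y N by (auto simp: dist_real_def dist_commute)
    also have "f x + \<Lambda> * dist x y + \<Lambda> * (dist x y + r) \<le> f x + e"
    proof -
      have "\<Lambda> * dist x y \<le> \<Lambda> * r" using y L by (intro mult_left_mono) auto
      then show ?thesis using r by (simp add: algebra_simps)
    qed
    finally have 1: "g x \<le> f x + e" by simp
    have "f x \<le> h y x" if "y \<in> N" for y
    proof -
      have "f x \<le> f y + \<Lambda> * dist x y"
        using lipschitz_onD[OF f, of x y] x that N by (auto simp: dist_real_def)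
      also have "\<dots> \<le> h y x"
        unfolding h_def using L by (auto intro!: mult_left_mono real_le_rsqrt simp: dist_norm)
      finally show ?thesis .
    qed
    then have "Z x \<le> (\<Sum>y\<in>N. exp (- f x / \<kappa>))"
      unfolding Z_def using k by (intro sum_mono) (auto simp: divide_simps)
    then have "ln (Z x) \<le> ln (real (card N) * exp (- f x / \<kappa>))"
      using Z by (subst ln_le_cancel_iff) (use c1 in auto)
    then have "ln (Z x) \<le> ln (real (card N)) - f x / \<kappa>" using c1 by (simp add: ln_mult)
    then have "f x - \<kappa> * ln (real (card N)) \<le> g x" using k by (simp add: g_def field_simps)
    with k 1 show ?thesis by simp
  qed
  ultimately show ?thesis using that by blast
qed

section \<open>Gronwall comparison and the Cauchy problem\<close>

lemma continuous_on_uncurried: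
  assumes f: "continuous_on (A \<times> B) (\<lambda>(t,x). f t x)" and "continuous_on S p" "continuous_on S q"
    and "p ` S \<subseteq> A" "q ` S \<subseteq> B"
  shows "continuous_on S (\<lambda>z. f (p z) (q z))"
proof -
  have "continuous_on S (\<lambda>z. (p z, q z))" by (intro continuous_on_Pair assms)
  moreover have "(\<lambda>z. (p z, q z)) ` S \<subseteq> A \<times> B" using assms(4,5) by blast
  ultimately show ?thesis using continuous_on_compose2[OF f] by fastforce
qed

text \<open>
  Velocities occur as curried functions of time and position.
\<close>

lemma uniformly_continuous_uncurried:
  assumes f: "continuous_on (A \<times> B) (\<lambda>(t,x). f t x)" and AB: "compact A" "compact B" and e: "0 < e"
  obtains d where "0 < d" "\<And>t t' x x'. t \<in> A \<Longrightarrow> t' \<in> A \<Longrightarrow> x \<in> B \<Longrightarrow> x' \<in> B \<Longrightarrow>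
    dist t t' < d \<Longrightarrow> dist x x' < d \<Longrightarrow> dist (f t x) (f t' x') < e"
proof -
  have "uniformly_continuous_on (A \<times> B) (\<lambda>(t,x). f t x)"
    by (intro compact_uniformly_continuous[OF f] compact_Times AB)
  then obtain d where d: "0 < d" "\<And>p q. p \<in> A \<times> B \<Longrightarrow> q \<in> A \<times> B \<Longrightarrow> dist q p < d \<Longrightarrow>
      dist (case q of (t,x) \<Rightarrow> f t x) (case p of (t,x) \<Rightarrow> f t x) < e"
    using e unfolding uniformly_continuous_on_def by meson
  show ?thesis
  proof (rule that[of "d / 2"])
    fix t t' x x' assume tx: "t \<in> A" "t' \<in> A" "x \<in> B" "x' \<in> B" and dd: "dist t t' < d / 2" "dist x x' < d / 2"
    have "dist (t, x) (t', x') \<le> dist t t' + dist x x'"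
      unfolding dist_Pair_Pair by (rule sqrt_sum_squares_le_sum) auto
    then show "dist (f t x) (f t' x') < e" using d(2)[of "(t', x')" "(t, x)"] tx dd by simp
  qed (use d in simp)
qed

lemma continuous_on_Times_lipschitz:
  fixes f :: "'a::metric_space \<Rightarrow> 'b::metric_space \<Rightarrow> 'c::metric_space"
  assumes "\<And>t. t \<in> T \<Longrightarrow> L-lipschitz_on X (f t)" "\<And>x. x \<in> X \<Longrightarrow> continuous_on T (\<lambda>t. f t x)"
  shows "continuous_on (T \<times> X) (\<lambda>(t,x). f t x)"
proof (rule continuous_on_TimesI[OF _ assms(2)])
  show "local_lipschitz T X f"
  proof (rule local_lipschitzI)
    fix t x
    have "\<forall>t\<in>cball t 1 \<inter> T. L-lipschitz_on (cball x 1 \<inter> X) (f t)"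
      using assms(1) by (blast intro: lipschitz_on_subset)
    then show "\<exists>u>0. \<exists>L. \<forall>t\<in>cball t u \<inter> T. L-lipschitz_on (cball x u \<inter> X) (f t)"
      using zero_less_one by blast
  qed
qed

text \<open>
  The assumption says that \<open>exp (- A * t) * integral {0..t} z\<close> is nonincreasing.
\<close>

lemma linear_gronwall:
  fixes z :: "real \<Rightarrow> real"
  assumes A: "0 \<le> A" and z: "continuous_on {0..T} z"
    and le: "\<And>t. t \<in> {0..T} \<Longrightarrow> z t \<le> A * integral {0..t} z" and t: "t \<in> {0..T}"
  shows "z t \<le> 0"
proof -
  define I where "I t = integral {0..t} z" for t
  have I: "(I has_real_derivative z t) (at t within {0..T})" if "t \<in> {0..T}" for t
    unfolding I_def using integral_has_real_derivative[OF z that] .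
  have D: "((\<lambda>t. exp (- A * t) * I t) has_real_derivative (exp (- A * s) * (z s - A * I s))) (at s within {0..t})"
    if "0 \<le> s" "s \<le> t" for s
    by (rule derivative_eq_intros DERIV_subset[OF I] refl | use that t in \<open>auto simp: algebra_simps\<close>)+
  have "\<exists>s\<in>{0..t}. exp (- A * t) * I t - exp (- A * 0) * I 0 = (t - 0) * (exp (- A * s) * (z s - A * I s))"
    using mvt_very_simple[of 0 t, OF _ D[unfolded has_field_derivative_def]] t
    by (auto simp: mult.commute)
  then obtain s where s: "s \<in> {0..t}" "exp (- A * t) * I t = t * (exp (- A * s) * (z s - A * I s))"
    by (auto simp: I_def)
  have "z s - A * I s \<le> 0" using le[of s] s t by (auto simp: I_def)
  then have "exp (- A * t) * I t \<le> 0"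
    unfolding s(2) using t by (intro mult_nonneg_nonpos) auto
  then have "I t \<le> 0" by (simp add: mult_le_0_iff)
  then show ?thesis using le[OF t] A mult_nonneg_nonpos[of A "I t"] by (simp add: I_def)
qed

text \<open>
  Subtracting the integral form of the supersolution \<open>U\<close> reduces the comparison to the homogeneous inequality.
\<close>

lemma gronwall_compare:
  fixes u :: "real \<Rightarrow> real"
  assumes A: "0 \<le> A" and u: "continuous_on {0..T} u" and k: "continuous_on {0..T} k"
    and U: "\<And>t. t \<in> {0..T} \<Longrightarrow> (U has_real_derivative U' t) (at t within {0..T})"
    and super: "\<And>t. t \<in> {0..T} \<Longrightarrow> A * U t + k t \<le> U' t"
    and le: "\<And>t. t \<in> {0..T} \<Longrightarrow> u t \<le> U 0 + integral {0..t} (\<lambda>s. A * u s + k s)"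
    and t: "t \<in> {0..T}"
  shows "u t \<le> U t"
proof -
  have Uc: "continuous_on {0..T} U"
    by (rule DERIV_continuous_on[OF U])
  have "u t - U t \<le> 0"
  proof (rule linear_gronwall[OF A _ _ t, where z = "\<lambda>t. u t - U t"])
    show "continuous_on {0..T} (\<lambda>t. u t - U t)" by (intro continuous_intros u Uc)
    fix t assume t: "t \<in> {0..T}"
    have sub: "{0..t} \<subseteq> {0..T}" using t by auto
    have "(U has_real_derivative U' s) (at s within {0..t})" if "s \<in> {0..t}" for s
      by (rule DERIV_subset[OF U]) (use that t in auto)
    then have U': "(U' has_integral (U t - U 0)) {0..t}"
      using t by (intro fundamental_theorem_of_calculus)
        (auto simp: has_real_derivative_iff_has_vector_derivative[symmetric])
    have i1: "(\<lambda>s. A * U s + k s) integrable_on {0..t}" "(\<lambda>s. A * u s + k s) integrable_on {0..t}"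
      by (rule integrable_continuous_interval, rule continuous_on_subset[OF _ sub],
          intro continuous_intros Uc u k)+
    have "integral {0..t} (\<lambda>s. A * U s + k s) \<le> U t - U 0"
      unfolding integral_unique[OF U', symmetric]
      by (rule integral_le[OF i1(1)]) (use U' super t in auto)
    then have "u t - U t \<le> integral {0..t} (\<lambda>s. A * u s + k s) - integral {0..t} (\<lambda>s. A * U s + k s)"
      using le[OF t] by simp
    also have "\<dots> = integral {0..t} (\<lambda>s. A * (u s - U s))"
      using i1 by (subst integral_diff[symmetric]) (auto simp: algebra_simps)
    finally show "u t - U t \<le> A * integral {0..t} (\<lambda>s. u s - U s)" by simp
  qed
  then show ?thesis by simp
qed

lemma norm_increment_le:
  fixes u :: "real \<Rightarrow> 'a::euclidean_space"
  assumes "a \<le> b" and u: "\<And>t. t \<in> {a..b} \<Longrightarrow> (u has_vector_derivative u' t) (at t within {a..b})"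
    and k: "k integrable_on {a..b}" "\<And>t. t \<in> {a..b} \<Longrightarrow> norm (u' t) \<le> k t"
  shows "norm (u b - u a) \<le> integral {a..b} k"
proof -
  have i: "(u' has_integral (u b - u a)) {a..b}"
    using assms by (intro fundamental_theorem_of_calculus) auto
  then have "norm (integral {a..b} u') \<le> integral {a..b} k"
    using k by (intro integral_norm_bound_integral) auto
  then show ?thesis using i by (simp add: integral_unique)
qed

lemma norm_increment_le_const:
  fixes u :: "real \<Rightarrow> 'a::euclidean_space"
  assumes "a \<le> b" and "\<And>t. t \<in> {a..b} \<Longrightarrow> (u has_vector_derivative u' t) (at t within {a..b})"
    and "\<And>t. t \<in> {a..b} \<Longrightarrow> norm (u' t - c) \<le> C"
  shows "norm (u b - u a - (b - a) *\<^sub>R c) \<le> C * (b - a)"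
proof -
  have "norm ((u b - b *\<^sub>R c) - (u a - a *\<^sub>R c)) \<le> integral {a..b} (\<lambda>_. C)"
    using assms by (intro norm_increment_le[where u' = "\<lambda>t. u' t - c"])
      (auto intro!: derivative_eq_intros)
  then show ?thesis using assms(1) by (simp add: algebra_simps)
qed

lemma gronwall_curve:
  fixes d :: "real \<Rightarrow> 'a::euclidean_space"
  assumes L: "0 \<le> L" and d: "\<And>t. t \<in> {0..T} \<Longrightarrow> (d has_vector_derivative d' t) (at t within {0..T})"
    and d': "\<And>t. t \<in> {0..T} \<Longrightarrow> norm (d' t) \<le> L * norm (d t)" and t: "t \<in> {0..T}"
  shows "norm (d t) \<le> norm (d 0) * exp (L * t)"
proof (rule gronwall_compare[OF L, where k = "\<lambda>_. 0" and T = T and u = "\<lambda>t. norm (d t)"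
      and U = "\<lambda>t. norm (d 0) * exp (L * t)" and U' = "\<lambda>t. L * (norm (d 0) * exp (L * t))"])
  have dc: "continuous_on {0..T} d"
    by (rule continuous_on_vector_derivative[OF d])
  then show nc: "continuous_on {0..T} (\<lambda>t. norm (d t))" by (intro continuous_intros)
  fix t assume t: "t \<in> {0..T}"
  have "norm (d t - d 0) \<le> integral {0..t} (\<lambda>s. L * norm (d s) + 0)"
  proof (rule norm_increment_le[where u' = d'])
    have "continuous_on {0..T} (\<lambda>s. L * norm (d s) + 0)" by (intro continuous_intros dc)
    then show "(\<lambda>s. L * norm (d s) + 0) integrable_on {0..t}"
      using t by (intro integrable_continuous_interval) (auto elim: continuous_on_subset)
    fix s assume s: "s \<in> {0..t}"
    show "(d has_vector_derivative d' s) (at s within {0..t})"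
      by (rule has_vector_derivative_within_subset[OF d]) (use s t in auto)
    show "norm (d' s) \<le> L * norm (d s) + 0" using d'[of s] s t by auto
  qed (use t in auto)
  then show "norm (d t) \<le> norm (d 0) * exp (L * 0) + integral {0..t} (\<lambda>s. L * norm (d s) + 0)"
    using norm_triangle_ineq2[of "d t" "d 0"] by simp
qed (use t in \<open>auto intro!: derivative_eq_intros\<close>)

text \<open>
  Successive Picard iterates differ by at most \<open>M T (K t)\<^sup>n / n!\<close>, so they converge uniformly on
  the whole of \<open>{0..T}\<close> at once.
\<close>

lemma picard_existence:
  fixes f :: "real \<Rightarrow> 'a::euclidean_space \<Rightarrow> 'a"
  assumes T: "0 \<le> T" and f: "continuous_on ({0..T} \<times> UNIV) (\<lambda>(t,x). f t x)"
    and K: "\<And>t x y. t \<in> {0..T} \<Longrightarrow> norm (f t x - f t y) \<le> K * norm (x - y)"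
  obtains u where "u 0 = x0"
    "\<And>t. t \<in> {0..T} \<Longrightarrow> (u has_vector_derivative f t (u t)) (at t within {0..T})"
proof -
  have K0: "0 \<le> K"
  proof -
    obtain b :: 'a where b: "b \<in> Basis" using nonempty_Basis by blast
    have "0 \<le> norm (f 0 b - f 0 0)" by simp
    also have "\<dots> \<le> K * norm (b - 0)" using T by (intro K) auto
    finally show ?thesis using b by simp
  qed
  have fc: "continuous_on {0..T} (\<lambda>t. f t (u t))" if "continuous_on {0..T} u" for u
    by (rule continuous_on_uncurried[OF f continuous_on_id that]) auto
  define P where "P u t = x0 + integral {0..t} (\<lambda>s. f s (u s))" for u t
  define v where "v n = (P ^^ n) (\<lambda>_. x0)" for n
  have v_Suc: "v (Suc n) = P (v n)" for n by (simp add: v_def)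
  have vc: "continuous_on {0..T} (v n)" for n
  proof (induction n)
    case (Suc n)
    show ?case unfolding v_Suc P_def
      by (intro continuous_intros indefinite_integral_continuous_1 integrable_continuous_interval fc Suc)
  qed (simp add: v_def)
  obtain M where M: "\<And>t. t \<in> {0..T} \<Longrightarrow> norm (f t x0) \<le> M"
  proof -
    have "compact ((\<lambda>t. f t x0) ` {0..T})"
      by (intro compact_continuous_image fc continuous_on_const) simp
    then show ?thesis using that compact_imp_bounded bounded_iff by (metis imageI)
  qed
  have step: "norm (v (Suc n) t - v n t) \<le> M * T * ((K * t) ^ n / fact n)" if "t \<in> {0..T}" for n t
    using that
  proof (induction n arbitrary: t)
    case 0
    have "norm (integral {0..t} (\<lambda>s. f s x0)) \<le> integral {0..t} (\<lambda>_. M)"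
      using 0 M by (intro integral_norm_bound_integral integrable_continuous_interval
          continuous_on_subset[OF fc[of "\<lambda>_. x0"]]) (auto intro: continuous_on_const)
    also have "\<dots> = t * M" using 0 by simp
    also have "\<dots> \<le> T * M" using 0 order_trans[OF norm_ge_zero M[of 0]] by (intro mult_right_mono) auto
    finally show ?case by (simp add: v_def P_def mult.commute)
  next
    case (Suc n)
    have sub: "{0..t} \<subseteq> {0..T}" using Suc.prems by auto
    have c: "(\<lambda>s. f s (v m s)) integrable_on {0..t}" for m
      by (intro integrable_continuous_interval continuous_on_subset[OF fc[OF vc] sub])
    have d: "((\<lambda>s. M * T * ((K * s) ^ Suc n / fact (Suc n))) has_vector_derivative
       K * (M * T * ((K * s) ^ n / fact n))) (at s within {0..t})" for s
      unfolding has_real_derivative_iff_has_vector_derivative[symmetric]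
      by (rule derivative_eq_intros refl | simp add: field_simps del: of_nat_Suc)+
    have I: "((\<lambda>s. K * (M * T * ((K * s) ^ n / fact n))) has_integral
        M * T * ((K * t) ^ Suc n / fact (Suc n))) {0..t}"
      using fundamental_theorem_of_calculus[OF _ d] Suc.prems by auto
    have "v (Suc (Suc n)) t - v (Suc n) t = P (v (Suc n)) t - P (v n) t" by (simp only: v_Suc)
    also have "\<dots> = integral {0..t} (\<lambda>s. f s (v (Suc n) s) - f s (v n s))"
      unfolding P_def by (simp only: add_diff_cancel_left integral_diff[OF c c])
    also have "norm \<dots> \<le> integral {0..t} (\<lambda>s. K * (M * T * ((K * s) ^ n / fact n)))"
    proof (intro integral_norm_bound_integral integrable_diff c)
      show "(\<lambda>s. K * (M * T * ((K * s) ^ n / fact n))) integrable_on {0..t}" using I by blast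
      fix s assume s: "s \<in> {0..t}"
      then have "norm (f s (v (Suc n) s) - f s (v n s)) \<le> K * norm (v (Suc n) s - v n s)"
        using sub by (intro K) auto
      also have "\<dots> \<le> K * (M * T * ((K * s) ^ n / fact n))"
        using s sub K0 by (intro mult_left_mono Suc.IH) auto
      finally show "norm (f s (v (Suc n) s) - f s (v n s)) \<le> K * (M * T * ((K * s) ^ n / fact n))" .
    qed
    also have "\<dots> = M * T * ((K * t) ^ Suc n / fact (Suc n))" using I by (rule integral_unique)
    finally show ?case .
  qed
  have M0: "0 \<le> M" using order_trans[OF norm_ge_zero M[of 0]] T by auto
  have "uniform_limit {0..T} (\<lambda>n t. \<Sum>i<n. v (Suc i) t - v i t) (\<lambda>t. \<Sum>i. v (Suc i) t - v i t) sequentially"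
  proof (rule Weierstrass_m_test)
    fix n t assume t: "t \<in> {0..T}"
    have "(K * t) ^ n \<le> (K * T) ^ n" using t K0 by (intro power_mono mult_left_mono) auto
    then have "M * T * ((K * t) ^ n / fact n) \<le> M * T * ((K * T) ^ n / fact n)"
      using M0 T by (intro mult_left_mono divide_right_mono) auto
    then show "norm (v (Suc n) t - v n t) \<le> M * T * ((K * T) ^ n / fact n)"
      using step[OF t, of n] by linarith
  next
    show "summable (\<lambda>n. M * T * ((K * T) ^ n / fact n))"
      using summable_exp[of "K * T"] by (intro summable_mult) (simp add: divide_inverse mult.commute)
  qed
  moreover have "(\<Sum>i<n. v (Suc i) t - v i t) = v n t - x0" for n t
    using sum_lessThan_telescope[of "\<lambda>i. v i t" n] by (simp add: v_def)
  ultimately have "uniform_limit {0..T} (\<lambda>n t. v n t - x0) (\<lambda>t. \<Sum>i. v (Suc i) t - v i t) sequentially"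
    by (simp only:)
  then have "uniform_limit {0..T} (\<lambda>n t. (v n t - x0) + x0) (\<lambda>t. (\<Sum>i. v (Suc i) t - v i t) + x0) sequentially"
    by (intro uniform_limit_intros)
  moreover define u where "u = (\<lambda>t. (\<Sum>i. v (Suc i) t - v i t) + x0)"
  ultimately have lim: "uniform_limit {0..T} v u sequentially"
    by simp
  then have uc: "continuous_on {0..T} u"
    by (rule uniform_limit_theorem[rotated]) (use vc in auto)
  have fix_u: "u t = P u t" if t: "t \<in> {0..T}" for t
  proof -
    have sub: "{0..t} \<subseteq> {0..T}" using t by auto
    have "(\<lambda>n. v (Suc n) t) \<longlonglongrightarrow> u t"
      using tendsto_uniform_limitI[OF lim t] by (rule LIMSEQ_Suc)
    moreover have "(\<lambda>n. P (v n) t) \<longlonglongrightarrow> P u t"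
      unfolding P_def
    proof (intro tendsto_add tendsto_const, rule LIMSEQ_I)
      fix e :: real assume e: "0 < e"
      define e' where "e' = e / (K * T + 1)"
      have e': "0 < e'" "K * e' * T < e" using e K0 T by (auto simp: e'_def divide_simps add_pos_nonneg add_nonneg_pos)
      obtain N where N: "\<And>n s. n \<ge> N \<Longrightarrow> s \<in> {0..T} \<Longrightarrow> dist (v n s) (u s) < e'"
        using uniform_limitD[OF lim e'(1)] unfolding eventually_sequentially by blast
      have "norm (integral {0..t} (\<lambda>s. f s (v n s)) - integral {0..t} (\<lambda>s. f s (u s))) < e" if n: "n \<ge> N" for n
      proof -
        have i: "(\<lambda>s. f s (v n s)) integrable_on {0..t}" "(\<lambda>s. f s (u s)) integrable_on {0..t}"
          by (intro integrable_continuous_interval continuous_on_subset[OF fc sub] vc uc)+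
        have "norm (integral {0..t} (\<lambda>s. f s (v n s) - f s (u s))) \<le> integral {0..t} (\<lambda>_. K * e')"
        proof (intro integral_norm_bound_integral integrable_diff i integrable_const_ivl)
          fix s assume s: "s \<in> {0..t}"
          have "norm (f s (v n s) - f s (u s)) \<le> K * norm (v n s - u s)" using s sub by (intro K) auto
          also have "\<dots> \<le> K * e'" using N[OF n, of s] s sub K0 by (intro mult_left_mono) (auto simp: dist_norm)
          finally show "norm (f s (v n s) - f s (u s)) \<le> K * e'" .
        qed
        also have "\<dots> = K * e' * t" using t by simp
        also have "\<dots> \<le> K * e' * T" using t K0 e' by (intro mult_left_mono) auto
        finally show ?thesis using e' i by (simp add: integral_diff)
      qed
      then show "\<exists>no. \<forall>n\<ge>no. norm (integral {0..t} (\<lambda>s. f s (v n s)) - integral {0..t} (\<lambda>s. f s (u s))) < e" by blast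
    qed
    ultimately show ?thesis unfolding v_Suc by (rule LIMSEQ_unique)
  qed
  show ?thesis
  proof (rule that)
    show "u 0 = x0" using fix_u[of 0] T by (simp add: P_def)
    fix t assume t: "t \<in> {0..T}"
    have "(P u has_vector_derivative f t (u t)) (at t within {0..T})"
      unfolding P_def using integral_has_vector_derivative[OF fc[OF uc] t]
      by (auto intro!: derivative_eq_intros)
    then show "(u has_vector_derivative f t (u t)) (at t within {0..T})"
      by (rule has_vector_derivative_transform[OF t, rotated]) (use fix_u in auto)
  qed
qed

section \<open>The continuity equation over one Euler step\<close>

lemma sphere_probs_space: "\<mu> \<in> sphere_probs \<Longrightarrow> space \<mu> = usphere"
  unfolding sphere_probs_def using sets_eq_imp_space_eq[of \<mu>] by (auto simp: space_restrict_space)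

lemma sphere_probs_measurable:
  assumes "\<mu> \<in> sphere_probs" "continuous_on usphere f"
  shows "f \<in> borel_measurable \<mu>"
  using borel_measurable_continuous_on_restrict[OF assms(2)] assms(1)
  by (simp add: sphere_probs_def cong: measurable_cong_sets)

lemma sphere_probs_integrable:
  fixes f :: "'a::euclidean_space \<Rightarrow> 'b::euclidean_space"
  assumes \<mu>: "\<mu> \<in> sphere_probs" and f: "continuous_on usphere f"
  shows "integrable \<mu> f"
proof -
  interpret prob_space \<mu> using \<mu> by (simp add: sphere_probs_def)
  have "compact (f ` usphere)" by (intro compact_continuous_image f) simp
  then obtain B where "\<And>x. x \<in> usphere \<Longrightarrow> norm (f x) \<le> B"
    using compact_imp_bounded bounded_iff by (metis imageI)
  then show ?thesis
    by (intro integrable_const_bound[of _ B] sphere_probs_measurable[OF \<mu> f] AE_I2)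
       (simp add: sphere_probs_space[OF \<mu>])
qed

lemma sphere_probs_integral_bound:
  fixes f :: "'a::euclidean_space \<Rightarrow> 'b::euclidean_space"
  assumes \<mu>: "\<mu> \<in> sphere_probs" and f: "continuous_on usphere f"
    and B: "\<And>x. x \<in> usphere \<Longrightarrow> norm (f x) \<le> B"
  shows "norm (LINT x|\<mu>. f x) \<le> B"
proof -
  interpret prob_space \<mu> using \<mu> by (simp add: sphere_probs_def)
  have "norm (LINT x|\<mu>. f x) \<le> (LINT x|\<mu>. norm (f x))" by (rule integral_norm_bound)
  also have "\<dots> \<le> B"
    using B by (intro integral_le_const integrable_norm sphere_probs_integrable[OF \<mu> f] AE_I2)
      (simp add: sphere_probs_space[OF \<mu>])
  finally show ?thesis .
qed

lemma sphere_map_measurable: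
  assumes \<rho>: "\<rho> \<in> sphere_probs" and \<mu>: "\<mu> \<in> sphere_probs"
    and \<Phi>: "continuous_on usphere \<Phi>" "\<Phi> ` usphere \<subseteq> usphere"
  shows "\<Phi> \<in> measurable \<rho> \<mu>"
proof -
  have "\<Phi> \<in> measurable \<rho> (restrict_space borel usphere)"
    using sphere_probs_measurable[OF \<rho> \<Phi>(1)] \<Phi>(2) sphere_probs_space[OF \<rho>]
    by (auto intro!: measurable_restrict_space2)
  then show ?thesis using \<mu> by (simp add: sphere_probs_def cong: measurable_cong_sets)
qed

text \<open>
  Narrow continuity concerns a fixed test function; uniform continuity on a compact parameter set
  extends it to integrands that vary with a parameter.
\<close>

lemma narrow_joint_continuous:
  fixes c :: "'b::metric_space \<Rightarrow> 'a::euclidean_space \<Rightarrow> real"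
  assumes \<rho>: "\<And>t. t \<in> {0..T} \<Longrightarrow> \<rho> t \<in> sphere_probs" and nc: "narrowly_continuous T \<rho>"
    and A: "compact A" and c: "continuous_on (A \<times> usphere) (\<lambda>(u,x). c u x)"
  shows "continuous_on (A \<times> {0..T}) (\<lambda>(u,r). LINT x|\<rho> r. c u x)"
proof -
  have cu: "continuous_on usphere (c u)" if "u \<in> A" for u
    by (rule continuous_on_uncurried[OF c continuous_on_const continuous_on_id]) (use that in auto)
  show ?thesis
    unfolding continuous_on_iff
  proof (clarify)
    fix u0 r0 and e :: real assume u0: "u0 \<in> A" and r0: "r0 \<in> {0..T}" and e: "0 < e"
    from e have e2: "0 < e / 2" by simp
    obtain d1 where d1: "0 < d1" "\<And>t t' x x'. t \<in> A \<Longrightarrow> t' \<in> A \<Longrightarrow> x \<in> usphere \<Longrightarrow> x' \<in> usphere \<Longrightarrow>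
        dist t t' < d1 \<Longrightarrow> dist x x' < d1 \<Longrightarrow> dist (c t x) (c t' x') < e / 2"
      by (rule uniformly_continuous_uncurried[OF c A compact_sphere e2]) (rule that)
    have "continuous_on {0..T} (\<lambda>t. LINT x|\<rho> t. c u0 x)"
      using nc cu[OF u0] unfolding narrowly_continuous_def by blast
    then obtain d2 where d2: "0 < d2" "\<And>r. r \<in> {0..T} \<Longrightarrow> dist r r0 < d2 \<Longrightarrow>
        dist (LINT x|\<rho> r. c u0 x) (LINT x|\<rho> r0. c u0 x) < e / 2"
      using r0 e unfolding continuous_on_iff by (meson half_gt_zero)
    have "dist (LINT x|\<rho> r. c u x) (LINT x|\<rho> r0. c u0 x) < e"
      if u: "u \<in> A" and r: "r \<in> {0..T}" and d: "dist (u, r) (u0, r0) < min d1 d2" for u r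
    proof -
      have du: "dist u u0 < d1" "dist r r0 < d2"
        using d dist_fst_le[of "(u,r)" "(u0,r0)"] dist_snd_le[of "(u,r)" "(u0,r0)"] by auto
      have "(LINT x|\<rho> r. c u x) - (LINT x|\<rho> r. c u0 x) = (LINT x|\<rho> r. c u x - c u0 x)"
        by (intro Bochner_Integration.integral_diff[symmetric] sphere_probs_integrable \<rho> r cu u u0)
      also have "norm \<dots> \<le> e / 2"
      proof (rule sphere_probs_integral_bound[OF \<rho>[OF r]])
        show "continuous_on usphere (\<lambda>x. c u x - c u0 x)" by (intro continuous_intros cu u u0)
        fix x :: 'a assume x: "x \<in> usphere"
        show "norm (c u x - c u0 x) \<le> e / 2"
          using d1(2)[OF u u0 x x du(1)] d1(1) by (simp add: dist_norm)
      qed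
      finally show ?thesis using d2(2)[OF r du(2)] unfolding dist_real_def real_norm_def by linarith
    qed
    then show "\<exists>d>0. \<forall>p\<in>A \<times> {0..T}. dist p (u0, r0) < d \<longrightarrow>
        dist (case p of (u, r) \<Rightarrow> LINT x|\<rho> r. c u x) (LINT x|\<rho> r0. c u0 x) < e"
      using d1(1) d2(1) by (intro exI[of _ "min d1 d2"]) auto
  qed
qed

text \<open>
  In tangential directions the projection that turns the Euclidean gradient into the spherical one
  is invisible.
\<close>

lemma sphere_grad_smooth:
  assumes g: "smooth g" and x: "x \<in> usphere" and v: "x \<bullet> v = 0"
  shows "sphere_grad g x \<bullet> v = frechet_derivative g (at x) v"
proof -
  define G where "G = (\<Sum>b\<in>Basis. frechet_derivative g (at x) b *\<^sub>R b)"
  have lin: "linear (frechet_derivative g (at x))"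
    by (rule has_derivative_linear[OF smooth_has_derivative[OF g]])
  have eq: "frechet_derivative g (at x) h = h \<bullet> G" for h
  proof -
    have "frechet_derivative g (at x) h = frechet_derivative g (at x) (\<Sum>b\<in>Basis. (h \<bullet> b) *\<^sub>R b)"
      by (simp only: euclidean_representation)
    also have "\<dots> = h \<bullet> G"
      by (simp only: linear_sum[OF lin] linear_cmul[OF lin] real_scaleR_def G_def inner_sum_right inner_scaleR_right)
        (simp add: mult.commute)
    finally show ?thesis .
  qed
  have "GDERIV g x :> G"
    unfolding gderiv_def eq[symmetric] by (rule smooth_has_derivative[OF g])
  then have "sphere_grad g x = tangent_proj x G"
    by (intro sphere_grad_eq[OF x open_UNIV UNIV_I]) auto
  then show ?thesis using v
    by (simp add: tangent_proj_def inner_diff_left eq inner_commute[of G v])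
qed

lemma lipschitz_derivative_bound:
  fixes f :: "'a::real_normed_vector \<Rightarrow> 'b::real_normed_vector"
  assumes f: "(f has_derivative f') (at x)" and L: "L-lipschitz_on UNIV f"
  shows "norm (f' v) \<le> L * norm v"
proof -
  have le: "norm (f' v) \<le> (L + e) * norm v" if "0 < e" for e
  proof (cases "v = 0")
    case True
    then show ?thesis using linear_0[OF has_derivative_linear[OF f]] by simp
  next
    case False
    obtain d where d: "0 < d" "\<And>y. norm (y - x) < d \<Longrightarrow> norm (f y - f x - f' (y - x)) \<le> e * norm (y - x)"
      using f \<open>0 < e\<close> unfolding has_derivative_at_alt by blast
    define t where "t = d / (2 * norm v)"
    have t: "0 < t" "t * norm v < d" using d(1) False by (auto simp: t_def)
    have "norm (f' (t *\<^sub>R v)) \<le> norm (f (x + t *\<^sub>R v) - f x) + norm (f (x + t *\<^sub>R v) - f x - f' (t *\<^sub>R v))"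
      by (metis norm_minus_commute norm_triangle_sub add.commute)
    also have "\<dots> \<le> L * norm (t *\<^sub>R v) + e * norm (t *\<^sub>R v)"
      using d(2)[of "x + t *\<^sub>R v"] t lipschitz_onD[OF L, of "x + t *\<^sub>R v" x]
      by (intro add_mono) (auto simp: dist_norm)
    finally have "t * norm (f' v) \<le> t * ((L + e) * norm v)"
      using t linear_cmul[OF has_derivative_linear[OF f]] by (simp add: algebra_simps)
    then show ?thesis using t by simp
  qed
  show ?thesis
  proof (rule field_le_epsilon)
    fix e :: real assume e: "0 < e"
    have "norm (f' v) \<le> (L + e / (norm v + 1)) * norm v" by (rule le) (use e in \<open>simp add: add_nonneg_pos\<close>)
    also have "\<dots> \<le> L * norm v + e"
    proof -
      have "norm v / (norm v + 1) \<le> 1" using norm_ge_zero[of v] by (subst divide_le_eq_1) linarith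
      then have "e * (norm v / (norm v + 1)) \<le> e * 1" using e by (intro mult_left_mono) auto
      then show ?thesis by (simp add: algebra_simps)
    qed
    finally show "norm (f' v) \<le> L * norm v + e" .
  qed
qed

text \<open>
  Subdivide \<open>[s, t]\<close> into steps shorter than \<open>d\<close> and add up.
\<close>

lemma bound_from_local_increments:
  fixes a :: "real \<Rightarrow> real"
  assumes st: "s \<le> t" and d: "0 < d"
    and a: "\<And>x y. s \<le> x \<Longrightarrow> x \<le> y \<Longrightarrow> y \<le> t \<Longrightarrow> y - x < d \<Longrightarrow> \<bar>a y - a x\<bar> \<le> C * (y - x)"
  shows "\<bar>a t - a s\<bar> \<le> C * (t - s)"
proof -
  obtain n :: nat where n: "0 < n" "(t - s) / n < d"
  proof -
    obtain n :: nat where "(t - s) / d < real n" using reals_Archimedean2 by blast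
    then have "(t - s) / Suc n < d" using d by (simp add: field_simps)
    then show ?thesis using that[of "Suc n"] by auto
  qed
  define p where "p i = s + real i * ((t - s) / n)" for i
  have p0: "p i \<le> p (Suc i)" for i using st n unfolding p_def
    by (intro add_left_mono mult_right_mono) auto
  have pn: "p n = t" using n by (simp add: p_def)
  have ps: "s \<le> p i" for i using st by (simp add: p_def)
  have pt: "p i \<le> t" if "i \<le> n" for i
    using lift_Suc_mono_le[of p, OF p0 that] pn by simp
  have "i \<le> n \<Longrightarrow> \<bar>a (p i) - a s\<bar> \<le> C * (p i - s)" for i
  proof (induction i)
    case 0 then show ?case by (simp add: p_def)
  next
    case (Suc i)
    have "\<bar>a (p (Suc i)) - a (p i)\<bar> \<le> C * (p (Suc i) - p i)"
    proof (rule a[OF ps p0 pt[OF Suc.prems]])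
      have "p (Suc i) - p i = (t - s) / n" by (simp add: p_def algebra_simps add_divide_distrib diff_divide_distrib)
      then show "p (Suc i) - p i < d" using n by simp
    qed
    with Suc show ?case by (simp add: algebra_simps)
  qed
  from this[of n] show ?thesis by (simp add: pn)
qed

lemma weak_solution_increment:
  assumes sol: "weak_solution T v \<rho>" and g: "smooth g"
    and w: "continuous_on ({0..T} \<times> usphere) (\<lambda>(t,x). v (\<rho> t) x)"
    and tang: "\<And>t x. t \<in> {0..T} \<Longrightarrow> x \<in> usphere \<Longrightarrow> x \<bullet> v (\<rho> t) x = 0"
    and ab: "0 \<le> a" "a \<le> b" "b \<le> T"
  shows "((\<lambda>r. LINT x|\<rho> r. frechet_derivative g (at x) (v (\<rho> r) x)) has_integral
    (LINT x|\<rho> b. g x) - (LINT x|\<rho> a. g x)) {a..b}"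
proof -
  define q where "q r = (LINT x|\<rho> r. frechet_derivative g (at x) (v (\<rho> r) x))" for r
  have \<rho>: "\<rho> t \<in> sphere_probs" if "t \<in> {0..T}" for t using sol that by (simp add: weak_solution_def)
  have "continuous_on ({0..T} \<times> usphere) (\<lambda>p. frechet_derivative g (at (snd p)) ((\<lambda>(t,x). v (\<rho> t) x) p))"
    by (rule smooth_derivative_continuous[OF g]) (intro continuous_intros, rule w)
  then have "continuous_on ({0..T} \<times> {0..T}) (\<lambda>(u,r). LINT x|\<rho> r. frechet_derivative g (at x) (v (\<rho> u) x))"
    using sol by (intro narrow_joint_continuous \<rho>) (auto simp: weak_solution_def case_prod_beta)
  then have q: "continuous_on {0..T} q"
    unfolding q_def by (rule continuous_on_uncurried[OF _ continuous_on_id continuous_on_id]) auto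
  have incr: "(LINT x|\<rho> t. g x) - (LINT x|\<rho> 0. g x) = integral {0..t} q" if t: "t \<in> {0..T}" for t
  proof -
    have qt: "continuous_on {0..t} q" by (rule continuous_on_subset[OF q]) (use t in auto)
    have "(LINT x|\<rho> t. g x) - (LINT x|\<rho> 0. g x) =
        (LINT s:{0..t}|lborel. LINT x|\<rho> s. sphere_grad g x \<bullet> v (\<rho> s) x)"
      using sol t smooth_on_sphere_smooth[OF g] by (simp add: weak_solution_def)
    also have "\<dots> = (LINT s:{0..t}|lborel. q s)"
    proof (rule set_lebesgue_integral_cong)
      show "\<forall>s. s \<in> {0..t} \<longrightarrow> (LINT x|\<rho> s. sphere_grad g x \<bullet> v (\<rho> s) x) = q s"
      proof (intro allI impI)
        fix s assume "s \<in> {0..t}"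
        then have s: "s \<in> {0..T}" using t by auto
        show "(LINT x|\<rho> s. sphere_grad g x \<bullet> v (\<rho> s) x) = q s"
          unfolding q_def
          by (rule Bochner_Integration.integral_cong[OF refl])
             (use sphere_grad_smooth[OF g _ tang[OF s]] sphere_probs_space[OF \<rho>[OF s]] in auto)
      qed
    qed simp
    also have "\<dots> = integral {0..t} q"
      by (rule set_borel_integral_eq_integral(2)[OF borel_integrable_atLeastAtMost'[OF qt]])
    finally show ?thesis .
  qed
  have "(q has_integral integral {a..b} q) {a..b}"
    using ab by (intro integrable_integral integrable_continuous_interval continuous_on_subset[OF q]) auto
  moreover have "integral {0..a} q + integral {a..b} q = integral {0..b} q"
    using ab by (intro Henstock_Kurzweil_Integration.integral_combine integrable_continuous_interval continuous_on_subset[OF q]) auto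
  moreover have "(LINT x|\<rho> b. g x) - (LINT x|\<rho> a. g x) = integral {0..b} q - integral {0..a} q"
    using incr[of a] incr[of b] ab by simp
  ultimately show ?thesis unfolding q_def[symmetric] by (metis add_diff_cancel_left')
qed

text \<open>
  The test functions \<open>\<psi>\<^sub>u(x) = g(x + (s + h - u) W x)\<close>, written \<open>g (y u x)\<close> in the proof,
  interpolate between the Euler step composed with \<open>g\<close> at \<open>u = s\<close> and \<open>g\<close> itself at \<open>u = s + h\<close>. Along
  the solution the derivative of \<open>\<integral> \<psi>\<^sub>u d\<rho>\<^sub>u\<close> is the integral of
  \<open>Dg((v - W) + (s + h - u) DW v)\<close>, since the transport term and the time derivative of \<open>\<psi>\<^sub>u\<close> cancel up to
  the error of replacing \<open>v\<close> by \<open>W\<close> and the drift of \<open>W\<close> during the step. The bound contains only the Lipschitz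
  constants of \<open>g\<close> and \<open>W\<close> and no second derivative; therefore it can be iterated over many short steps.
\<close>

lemma weak_solution_step:
  fixes W :: "'a::euclidean_space \<Rightarrow> 'a"
  assumes sol: "weak_solution T v \<rho>" and g: "smooth g" "\<Lambda>-lipschitz_on UNIV g"
    and w: "continuous_on ({0..T} \<times> usphere) (\<lambda>(t,x). v (\<rho> t) x)"
    and tang: "\<And>t x. t \<in> {0..T} \<Longrightarrow> x \<in> usphere \<Longrightarrow> x \<bullet> v (\<rho> t) x = 0"
    and W: "\<And>i. i \<in> Basis \<Longrightarrow> smooth (\<lambda>x. W x \<bullet> i)" "K-lipschitz_on UNIV W"
    and s: "0 \<le> s" "0 \<le> h" "s + h \<le> T"
    and close: "\<And>r x. r \<in> {s..s+h} \<Longrightarrow> x \<in> usphere \<Longrightarrow> norm (v (\<rho> r) x - W x) \<le> \<eta>"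
    and M: "\<And>r x. r \<in> {s..s+h} \<Longrightarrow> x \<in> usphere \<Longrightarrow> norm (v (\<rho> r) x) \<le> M"
  shows "\<bar>(LINT x|\<rho> (s + h). g x) - (LINT x|\<rho> s. g (x + h *\<^sub>R W x))\<bar> \<le> \<Lambda> * (\<eta> + h * K * M) * h"
proof -
  define J where "J = {s..s+h}"
  have JT: "J \<subseteq> {0..T}" using s by (auto simp: J_def)
  have \<rho>: "\<rho> t \<in> sphere_probs" if "t \<in> J" for t using sol that JT by (auto simp: weak_solution_def)
  have L0: "0 \<le> \<Lambda>" "0 \<le> K" using g W lipschitz_on_nonneg by blast+
  define y where "y u x = x + (s + h - u) *\<^sub>R W x" for u x
  define DW where "DW x z = (\<Sum>i\<in>Basis. frechet_derivative (\<lambda>x. W x \<bullet> i) (at x) z *\<^sub>R i)" for x z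
  have DW: "(W has_derivative DW x) (at x)" for x
    unfolding has_derivative_componentwise_within[of W]
    using smooth_has_derivative[OF W(1)] by (simp add: DW_def inner_sum_left inner_Basis if_distrib cong: if_cong)
  have DW_bound: "norm (DW x z) \<le> K * norm z" for x z
    by (rule lipschitz_derivative_bound[OF DW W(2)])
  have Dg_bound: "norm (frechet_derivative g (at x) z) \<le> \<Lambda> * norm z" for x z
    by (rule lipschitz_derivative_bound[OF smooth_has_derivative[OF g(1)] g(2)])
  have Dg_lin: "linear (frechet_derivative g (at x))" for x
    by (rule has_derivative_linear[OF smooth_has_derivative[OF g(1)]])
  have Wc: "continuous_on UNIV W" by (rule lipschitz_on_continuous_on[OF W(2)])
  have yc: "continuous_on UNIV (\<lambda>(u,x). y u x)"
    unfolding y_def case_prod_beta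
    by (intro continuous_intros continuous_on_compose2[OF Wc]) auto
  have smooth_y: "smooth (\<lambda>x. g (y u x))" for u
    unfolding y_def
  proof (rule smooth_compose[OF g(1)])
    fix i :: 'a assume i: "i \<in> Basis"
    show "smooth (\<lambda>x. (x + (s + h - u) *\<^sub>R W x) \<bullet> i)"
      unfolding inner_add_left inner_scaleR_left
      by (rule smooth_add[OF smooth_bounded_linear[OF bounded_linear_inner_left] smooth_mult[OF smooth_const W(1)[OF i]]])
  qed
  have Dy: "frechet_derivative (\<lambda>x. g (y u x)) (at x) =
      (\<lambda>z. frechet_derivative g (at (y u x)) (z + (s + h - u) *\<^sub>R DW x z))" for u x
  proof (rule frechet_derivative_at[symmetric])
    have "(y u has_derivative (\<lambda>z. z + (s + h - u) *\<^sub>R DW x z)) (at x)"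
      unfolding y_def by (intro has_derivative_add has_derivative_ident has_derivative_scaleR_right DW)
    from diff_chain_at[OF this smooth_has_derivative[OF g(1)]]
    show "((\<lambda>x. g (y u x)) has_derivative (\<lambda>z. frechet_derivative g (at (y u x)) (z + (s + h - u) *\<^sub>R DW x z))) (at x)"
      by (simp add: o_def)
  qed
  \<comment> \<open>minus the derivative of \<open>g (y u x)\<close> with respect to \<open>u\<close>\<close>
  define p where "p u x = frechet_derivative g (at (y u x)) (W x)" for u x
  have pc: "continuous_on UNIV (\<lambda>(u,x). p u x)"
  proof -
    have "continuous_on UNIV (\<lambda>q :: real \<times> 'a. W (snd q))"
      by (rule continuous_on_compose2[OF Wc continuous_on_snd[OF continuous_on_id]]) simp
    from smooth_derivative_continuous[OF g(1) yc this] show ?thesis by (simp add: p_def case_prod_beta)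
  qed
  \<comment> \<open>the transport term with test function at time \<open>u\<close> and velocity at time \<open>r\<close>\<close>
  define c where "c u r x = frechet_derivative (\<lambda>x. g (y u x)) (at x) (v (\<rho> r) x)" for u r x
  define q where "q u r = (LINT x|\<rho> r. c u r x)" for u r
  have DWc: "continuous_on A (\<lambda>z. DW (f z) (k z))" if "continuous_on A f" "continuous_on A k"
    for A and f k :: "(real \<times> real) \<times> 'a \<Rightarrow> 'a"
    unfolding DW_def by (intro continuous_intros smooth_derivative_continuous that W(1))
  have cc: "continuous_on ((J \<times> J) \<times> usphere) (\<lambda>(ur,x). c (fst ur) (snd ur) x)"
  proof -
    let ?A = "(J \<times> J) \<times> (usphere :: 'a set)"
    have 1: "continuous_on ?A (\<lambda>z. v (\<rho> (snd (fst z))) (snd z))"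
      by (rule continuous_on_uncurried[OF w]) (use JT in \<open>auto intro!: continuous_intros\<close>)
    have 2: "continuous_on ?A (\<lambda>z. y (fst (fst z)) (snd z))"
      by (rule continuous_on_uncurried[OF yc[folded UNIV_Times_UNIV]]) (auto intro!: continuous_intros)
    have "continuous_on ?A (\<lambda>z. frechet_derivative g (at (y (fst (fst z)) (snd z)))
        (v (\<rho> (snd (fst z))) (snd z) + (s + h - fst (fst z)) *\<^sub>R DW (snd z) (v (\<rho> (snd (fst z))) (snd z))))"
      by (intro smooth_derivative_continuous[OF g(1) 2] continuous_on_add 1 continuous_on_scaleR DWc)
         (intro continuous_intros)+
    then show ?thesis by (simp add: c_def Dy case_prod_beta)
  qed
  have qc: "continuous_on (J \<times> J) (\<lambda>(u,r). q u r)"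
  proof -
    have "continuous_on ((J \<times> J) \<times> {0..T}) (\<lambda>(ur,r'). LINT x|\<rho> r'. c (fst ur) (snd ur) x)"
      using sol by (intro narrow_joint_continuous compact_Times cc) (auto simp: weak_solution_def J_def)
    then have "continuous_on (J \<times> J) (\<lambda>ur. LINT x|\<rho> (snd ur). c (fst ur) (snd ur) x)"
      by (rule continuous_on_uncurried) (use JT in \<open>auto intro!: continuous_intros\<close>)
    then show ?thesis by (simp add: q_def case_prod_beta)
  qed
  define a where "a u = (LINT x|\<rho> u. g (y u x))" for u
  define C where "C = \<Lambda> * (\<eta> + h * K * M)"
  have c_p: "\<bar>c u u x - p u x\<bar> \<le> C" if u: "u \<in> J" and x: "x \<in> usphere" for u x
  proof -
    have \<tau>: "0 \<le> s + h - u" "s + h - u \<le> h" using u by (auto simp: J_def)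
    have "c u u x - p u x = frechet_derivative g (at (y u x))
       ((v (\<rho> u) x - W x) + (s + h - u) *\<^sub>R DW x (v (\<rho> u) x))"
      unfolding c_def p_def Dy by (simp add: linear_diff[OF Dg_lin, symmetric] algebra_simps)
    also have "\<bar>\<dots>\<bar> \<le> \<Lambda> * norm ((v (\<rho> u) x - W x) + (s + h - u) *\<^sub>R DW x (v (\<rho> u) x))"
      using Dg_bound by (simp only: real_norm_def)
    also have "\<dots> \<le> \<Lambda> * (\<eta> + h * (K * M))"
    proof (rule mult_left_mono[OF _ L0(1)], rule norm_triangle_le, rule add_mono)
      show "norm (v (\<rho> u) x - W x) \<le> \<eta>" using close u x by (auto simp: J_def)
      have "norm (DW x (v (\<rho> u) x)) \<le> K * M"
        by (rule order_trans[OF DW_bound mult_left_mono[OF M L0(2)]]) (use u x in \<open>auto simp: J_def\<close>)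
      then show "norm ((s + h - u) *\<^sub>R DW x (v (\<rho> u) x)) \<le> h * (K * M)"
        using \<tau> by (auto intro!: mult_mono)
    qed
    finally show ?thesis by (simp add: C_def mult.assoc)
  qed
  have cont_u: "continuous_on usphere (\<lambda>x. g (y u x))" "continuous_on usphere (p u)" for u
  proof -
    show "continuous_on usphere (p u)"
      by (rule continuous_on_uncurried[OF pc[folded UNIV_Times_UNIV] continuous_on_const continuous_on_id]) auto
    have "continuous_on usphere (y u)"
      by (rule continuous_on_uncurried[OF yc[folded UNIV_Times_UNIV] continuous_on_const continuous_on_id]) auto
    then show "continuous_on usphere (\<lambda>x. g (y u x))"
      by (rule continuous_on_compose2[OF lipschitz_on_continuous_on[OF g(2)]]) simp
  qed
  have cont_c: "continuous_on usphere (c u u)" if "u \<in> J" for u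
    using continuous_on_uncurried[OF cc continuous_on_const[of _ "(u, u)"] continuous_on_id] that by auto
  have local: "\<exists>d>0. \<forall>x y. s \<le> x \<longrightarrow> x \<le> y \<longrightarrow> y \<le> s + h \<longrightarrow> y - x < d \<longrightarrow> \<bar>a y - a x\<bar> \<le> (C + 2 * e) * (y - x)"
    if e: "0 < e" for e
  proof -
    have J: "compact J" by (simp add: J_def)
    obtain d1 where d1: "0 < d1" "\<And>u u' r r'. u \<in> J \<Longrightarrow> u' \<in> J \<Longrightarrow> r \<in> J \<Longrightarrow> r' \<in> J \<Longrightarrow>
        dist u u' < d1 \<Longrightarrow> dist r r' < d1 \<Longrightarrow> dist (q u r) (q u' r') < e"
      by (rule uniformly_continuous_uncurried[OF qc J J e]) (rule that)
    have "continuous_on (J \<times> usphere) (\<lambda>(u,x). p u x)" by (rule continuous_on_subset[OF pc]) simp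
    then obtain d2 where d2: "0 < d2" "\<And>u u' x x'. u \<in> J \<Longrightarrow> u' \<in> J \<Longrightarrow> x \<in> usphere \<Longrightarrow> x' \<in> usphere \<Longrightarrow>
        dist u u' < d2 \<Longrightarrow> dist x x' < d2 \<Longrightarrow> dist (p u x) (p u' x') < e"
      by (rule uniformly_continuous_uncurried[OF _ J compact_sphere e]) (rule that)
    have "\<bar>a b2 - a b1\<bar> \<le> (C + 2 * e) * (b2 - b1)"
      if b: "s \<le> b1" "b1 \<le> b2" "b2 \<le> s + h" and d: "b2 - b1 < min d1 d2" for b1 b2
    proof -
      have J: "b1 \<in> J" "b2 \<in> J" using b by (auto simp: J_def)
      define \<delta> where "\<delta> = b2 - b1"
      have \<delta>: "0 \<le> \<delta>" using b by (simp add: \<delta>_def)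
      \<comment> \<open>\<open>A1\<close> moves the measure at a frozen test function, \<open>A2\<close> the test function at a frozen measure\<close>
      define A1 where "A1 = (LINT x|\<rho> b2. g (y b2 x)) - (LINT x|\<rho> b1. g (y b2 x))"
      define A2 where "A2 = (LINT x|\<rho> b1. g (y b2 x) - g (y b1 x))"
      define P where "P = (LINT x|\<rho> b1. p b1 x)"
      have "((\<lambda>r. q b2 r) has_integral A1) {b1..b2}"
        unfolding A1_def q_def c_def
        using b s by (intro weak_solution_increment[OF sol smooth_y w tang]) auto
      then have i: "((\<lambda>r. q b2 r - q b1 b1) has_integral A1 - \<delta> * q b1 b1) {b1..b2}"
        using has_integral_diff[OF _ has_integral_const_real[of "q b1 b1" b1 b2]] b by (fastforce simp: \<delta>_def)
      have 1: "\<bar>A1 - \<delta> * q b1 b1\<bar> \<le> e * \<delta>"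
      proof -
        have "norm (q b2 r - q b1 b1) \<le> e" if r: "r \<in> {b1..b2}" for r
        proof -
          have "r \<in> J" "dist b2 b1 < d1" "dist r b1 < d1" using r d b by (auto simp: dist_real_def J_def)
          then show ?thesis using d1(2)[OF J(2,1) _ J(1)] by (simp add: dist_norm less_imp_le)
        qed
        then have "norm (integral {b1..b2} (\<lambda>r. q b2 r - q b1 b1)) \<le> integral {b1..b2} (\<lambda>_. e)"
          using i by (intro integral_norm_bound_integral) auto
        then show ?thesis using b by (simp add: integral_unique[OF i] \<delta>_def mult.commute)
      qed
      have inc: "norm (g (y b2 z) - g (y b1 z) - (b2 - b1) *\<^sub>R (- p b1 z)) \<le> e * (b2 - b1)" if z: "z \<in> usphere" for z
      proof (rule norm_increment_le_const[OF b(2), where u = "\<lambda>u. g (y u z)" and u' = "\<lambda>u. - p u z"])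
        fix u assume u: "u \<in> {b1..b2}"
        have "((\<lambda>u. y u z) has_derivative (\<lambda>t. - t *\<^sub>R W z)) (at u within {b1..b2})"
          unfolding y_def by (auto intro!: derivative_eq_intros)
        from has_derivative_compose[OF this smooth_has_derivative[OF g(1)]]
        show "((\<lambda>u. g (y u z)) has_vector_derivative - p u z) (at u within {b1..b2})"
          unfolding has_vector_derivative_def p_def
          by (simp add: linear_cmul[OF Dg_lin] linear_neg[OF Dg_lin] algebra_simps)
        have "u \<in> J" "dist u b1 < d2" using u d b by (auto simp: dist_real_def J_def)
        then show "norm (- p u z - - p b1 z) \<le> e"
          using d2(2)[OF _ J(1) z z, of u] d2(1) by (simp add: dist_real_def)
      qed
      have \<rho>1: "\<rho> b1 \<in> sphere_probs" by (rule \<rho>[OF J(1)])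
      have i1: "integrable (\<rho> b1) (p b1)" "integrable (\<rho> b1) (\<lambda>x. g (y b x))" "integrable (\<rho> b1) (c b1 b1)" for b
        by (intro sphere_probs_integrable[OF \<rho>1] cont_u cont_c J)+
      have 2: "\<bar>A2 + \<delta> * P\<bar> \<le> e * \<delta>"
      proof -
        have "A2 + \<delta> * P = (LINT x|\<rho> b1. (g (y b2 x) - g (y b1 x)) + \<delta> * p b1 x)"
          unfolding A2_def P_def using i1 by simp
        also have "norm \<dots> \<le> e * \<delta>"
        proof (rule sphere_probs_integral_bound[OF \<rho>1])
          show "continuous_on usphere (\<lambda>x. (g (y b2 x) - g (y b1 x)) + \<delta> * p b1 x)"
            by (intro continuous_on_add continuous_on_diff continuous_on_mult continuous_on_const cont_u)
          fix x :: 'a assume "x \<in> usphere"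
          from inc[OF this] show "norm ((g (y b2 x) - g (y b1 x)) + \<delta> * p b1 x) \<le> e * \<delta>" by (simp add: \<delta>_def)
        qed
        finally show ?thesis by simp
      qed
      have 3: "\<bar>q b1 b1 - P\<bar> \<le> C"
      proof -
        have "q b1 b1 - P = (LINT x|\<rho> b1. c b1 b1 x - p b1 x)"
          unfolding q_def P_def using i1 by simp
        also have "norm \<dots> \<le> C"
          using c_p[OF J(1)] by (intro sphere_probs_integral_bound[OF \<rho>1] continuous_on_diff cont_u cont_c J) auto
        finally show ?thesis by simp
      qed
      have "a b2 - a b1 = A1 + A2"
        unfolding a_def A1_def A2_def using i1 by simp
      also have "\<dots> = (A1 - \<delta> * q b1 b1) + (A2 + \<delta> * P) + \<delta> * (q b1 b1 - P)" by (simp add: algebra_simps)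
      also have "\<bar>\<dots>\<bar> \<le> e * \<delta> + e * \<delta> + \<delta> * C"
      proof -
        have "\<bar>\<delta> * (q b1 b1 - P)\<bar> \<le> \<delta> * C" using mult_left_mono[OF 3 \<delta>] \<delta> by (simp add: abs_mult)
        with 1 2 show ?thesis by linarith
      qed
      finally show ?thesis by (simp add: \<delta>_def algebra_simps)
    qed
    then show ?thesis using d1(1) d2(1) by (intro exI[of _ "min d1 d2"]) auto
  qed
  have "\<bar>a (s + h) - a s\<bar> \<le> C * h"
  proof (rule field_le_epsilon)
    fix e :: real assume e: "0 < e"
    define e' where "e' = e / (2 * h + 1)"
    have e': "0 < e'" "2 * e' * h \<le> e" using e s by (auto simp: e'_def field_simps)
    obtain d where d: "0 < d" "\<forall>x y. s \<le> x \<longrightarrow> x \<le> y \<longrightarrow> y \<le> s + h \<longrightarrow> y - x < d \<longrightarrow> \<bar>a y - a x\<bar> \<le> (C + 2 * e') * (y - x)"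
      using local[OF e'(1)] by (elim exE conjE)
    have "\<bar>a (s + h) - a s\<bar> \<le> (C + 2 * e') * (s + h - s)"
      by (rule bound_from_local_increments[OF _ d(1)]) (use s d(2) in auto)
    with e' show "\<bar>a (s + h) - a s\<bar> \<le> C * h + e" by (simp add: algebra_simps)
  qed
  then show ?thesis by (simp add: a_def y_def C_def)
qed

section \<open>Flows on the sphere\<close>

definition sphere_field :: "real \<Rightarrow> real \<Rightarrow> (real \<Rightarrow> 'a::euclidean_space \<Rightarrow> 'a) \<Rightarrow> bool" where
  "sphere_field T L w \<longleftrightarrow>
     continuous_on ({0..T} \<times> usphere) (\<lambda>(t,x). w t x) \<and>
     (\<forall>t\<in>{0..T}. L-lipschitz_on usphere (w t)) \<and> (\<forall>t\<in>{0..T}. \<forall>x\<in>usphere. x \<bullet> w t x = 0)"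

definition sphere_flow :: "real \<Rightarrow> (real \<Rightarrow> 'a::euclidean_space \<Rightarrow> 'a) \<Rightarrow> (real \<Rightarrow> 'a \<Rightarrow> 'a) \<Rightarrow> bool" where
  "sphere_flow T w X \<longleftrightarrow>
     (\<forall>x\<in>usphere. X 0 x = x \<and> (\<forall>t\<in>{0..T}. X t x \<in> usphere \<and>
        ((\<lambda>t. X t x) has_vector_derivative w t (X t x)) (at t within {0..T})))"

lemma sphere_field_bounded:
  assumes "sphere_field T L w"
  obtains M where "0 \<le> M" "\<And>t x. t \<in> {0..T} \<Longrightarrow> x \<in> usphere \<Longrightarrow> norm (w t x) \<le> M"
proof -
  have "compact ((\<lambda>(t,x). w t x) ` ({0..T} \<times> usphere))"
    using assms by (intro compact_continuous_image compact_Times) (auto simp: sphere_field_def)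
  then obtain M where M: "\<And>p. p \<in> {0..T} \<times> usphere \<Longrightarrow> norm ((\<lambda>(t,x). w t x) p) \<le> M"
    using compact_imp_bounded bounded_iff by (metis imageI)
  show ?thesis
  proof (rule that[of "max M 0"])
    fix t and x :: 'a assume "t \<in> {0..T}" "x \<in> usphere"
    then have "(t, x) \<in> {0..T} \<times> usphere" by (intro SigmaI)
    from M[OF this] show "norm (w t x) \<le> max M 0" by simp
  qed simp
qed

text \<open>
  Solving the Cauchy problem in the ambient space needs a field on the whole space. The positively
  homogeneous extension \<open>\<parallel>x\<parallel> w(x / \<parallel>x\<parallel>)\<close> is globally Lipschitz, and it is tangential to every sphere
  around the origin, so its trajectories conserve the norm.
\<close>

lemma homogeneous_extension_lipschitz:
  fixes f :: "'a::euclidean_space \<Rightarrow> 'a"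
  assumes f: "L-lipschitz_on usphere f" and M: "\<And>x. x \<in> usphere \<Longrightarrow> norm (f x) \<le> M"
  shows "norm (norm x *\<^sub>R f (x /\<^sub>R norm x) - norm y *\<^sub>R f (y /\<^sub>R norm y)) \<le> (M + 2 * L) * norm (x - y)"
proof -
  have L: "0 \<le> L" using f lipschitz_on_nonneg by blast
  obtain b :: 'a where "b \<in> Basis" using nonempty_Basis by blast
  then have M0: "0 \<le> M" using order_trans[OF norm_ge_zero M[of b]] by simp
  have zero: "norm (norm z *\<^sub>R f (z /\<^sub>R norm z)) \<le> (M + 2 * L) * norm z" for z
  proof (cases "z = 0")
    case False
    then have "norm z * norm (f (z /\<^sub>R norm z)) \<le> norm z * M" by (intro mult_left_mono M) auto
    also have "\<dots> \<le> (M + 2 * L) * norm z" using L by (simp add: algebra_simps)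
    finally show ?thesis by simp
  qed simp
  consider "x = 0" | "y = 0" | "x \<noteq> 0" "y \<noteq> 0" by blast
  then show ?thesis
  proof cases
    case 1 then show ?thesis using zero[of y] by simp
  next
    case 2 then show ?thesis using zero[of x] by simp
  next
    case 3
    define u v where "u = x /\<^sub>R norm x" and "v = y /\<^sub>R norm y"
    have uv: "u \<in> usphere" "v \<in> usphere" "x = norm x *\<^sub>R u" "y = norm y *\<^sub>R v" using 3 by (auto simp: u_def v_def)
    have d: "\<bar>norm x - norm y\<bar> \<le> norm (x - y)" by (rule norm_triangle_ineq3)
    have "norm y *\<^sub>R (u - v) = (x - y) - (norm x - norm y) *\<^sub>R u"
      using uv(3,4) by (simp add: algebra_simps)
    then have "norm y * norm (u - v) = norm ((x - y) - (norm x - norm y) *\<^sub>R u)"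
      by (metis norm_scaleR abs_norm_cancel)
    also have "\<dots> \<le> norm (x - y) + \<bar>norm x - norm y\<bar>"
      using norm_triangle_ineq4[of "x - y" "(norm x - norm y) *\<^sub>R u"] uv by simp
    finally have yuv: "norm y * norm (u - v) \<le> 2 * norm (x - y)" using d by linarith
    have "norm x *\<^sub>R f u - norm y *\<^sub>R f v = (norm x - norm y) *\<^sub>R f u + norm y *\<^sub>R (f u - f v)"
      by (simp add: algebra_simps)
    also have "norm \<dots> \<le> \<bar>norm x - norm y\<bar> * M + norm y * (L * norm (u - v))"
      using M[OF uv(1)] lipschitz_onD[OF f uv(1,2)]
      by (intro norm_triangle_le add_mono) (auto intro!: mult_left_mono simp: dist_norm)
    also have "\<dots> \<le> norm (x - y) * M + L * (2 * norm (x - y))"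
      using mult_right_mono[OF d M0] mult_left_mono[OF yuv L] by (simp add: algebra_simps)
    finally show ?thesis by (simp add: u_def v_def algebra_simps)
  qed
qed

lemma sphere_flow_exists:
  fixes w :: "real \<Rightarrow> 'a::euclidean_space \<Rightarrow> 'a"
  assumes T: "0 \<le> T" and w: "sphere_field T L w"
  obtains X where "sphere_flow T w X"
proof -
  obtain M where M: "0 \<le> M" "\<And>t x. t \<in> {0..T} \<Longrightarrow> x \<in> usphere \<Longrightarrow> norm (w t x) \<le> M"
    by (rule sphere_field_bounded[OF w]) (rule that)
  define f where "f t x = norm x *\<^sub>R w t (x /\<^sub>R norm x)" for t x
  have K: "norm (f t x - f t y) \<le> (M + 2 * L) * norm (x - y)" if "t \<in> {0..T}" for t x y
    unfolding f_def by (rule homogeneous_extension_lipschitz) (use w M that in \<open>auto simp: sphere_field_def\<close>)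
  have K0: "0 \<le> M + 2 * L"
    using M(1) w T lipschitz_on_nonneg unfolding sphere_field_def by (metis add_nonneg_nonneg atLeastAtMost_iff order_refl mult_nonneg_nonneg zero_le_numeral)
  have wt: "continuous_on {0..T} (\<lambda>t. w t x)" if "x \<in> usphere" for x
    by (rule continuous_on_uncurried[OF _ continuous_on_id continuous_on_const])
       (use w that in \<open>auto simp: sphere_field_def\<close>)
  have ft: "continuous_on {0..T} (\<lambda>t. f t x)" for x
  proof (cases "x = 0")
    case False
    then show ?thesis unfolding f_def by (intro continuous_on_scaleR continuous_on_const wt) simp
  qed (simp add: f_def)
  have fc: "continuous_on ({0..T} \<times> UNIV) (\<lambda>(t,x). f t x)"
    by (rule continuous_on_Times_lipschitz[OF lipschitz_onI ft]) (use K K0 in \<open>auto simp: dist_norm\<close>)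
  have "\<exists>u. u 0 = x \<and> (\<forall>t\<in>{0..T}. (u has_vector_derivative f t (u t)) (at t within {0..T}))" for x
    using picard_existence[OF T fc K, of x] by metis
  then obtain Y where Y: "\<And>x. Y x 0 = x"
    "\<And>x t. t \<in> {0..T} \<Longrightarrow> (Y x has_vector_derivative f t (Y x t)) (at t within {0..T})"
    by metis
  have f_orth: "x \<bullet> f t x = 0" if "t \<in> {0..T}" for t x
  proof (cases "x = 0")
    case False
    then have "x /\<^sub>R norm x \<in> usphere" by simp
    then have "(x /\<^sub>R norm x) \<bullet> w t (x /\<^sub>R norm x) = 0" using w that unfolding sphere_field_def by blast
    then show ?thesis using False by (simp add: f_def)
  qed simp
  have "sphere_flow T w (\<lambda>t x. Y x t)"
    unfolding sphere_flow_def
  proof (intro ballI conjI)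
    fix x :: 'a and t assume x: "x \<in> usphere" and t: "t \<in> {0..T}"
    have "((\<lambda>t. Y x t \<bullet> Y x t) has_derivative (\<lambda>h. 0)) (at s within {0..T})" if s: "s \<in> {0..T}" for s
    proof -
      have "((\<lambda>t. Y x t \<bullet> Y x t) has_derivative (\<lambda>h. Y x s \<bullet> (h *\<^sub>R f s (Y x s)) + (h *\<^sub>R f s (Y x s)) \<bullet> Y x s)) (at s within {0..T})"
        using Y(2)[OF s] unfolding has_vector_derivative_def by (intro has_derivative_inner)
      then show ?thesis using f_orth[OF s] by (simp add: inner_commute)
    qed
    then have "Y x t \<bullet> Y x t = Y x 0 \<bullet> Y x 0"
      using has_derivative_zero_unique[of "{0..T}" "\<lambda>t. Y x t \<bullet> Y x t" 0 t] t T by auto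
    then show S: "Y x t \<in> usphere" using x Y(1) by (simp add: norm_eq_1 dot_square_norm)
    have "f t (Y x t) = w t (Y x t)" using S by (simp add: f_def)
    then show "((\<lambda>t. Y x t) has_vector_derivative w t (Y x t)) (at t within {0..T})"
      using Y(2)[OF t, of x] by simp
  qed (rule Y)
  then show ?thesis by (rule that)
qed

lemma flow_curves_diverge_exponentially:
  fixes w :: "real \<Rightarrow> 'a::euclidean_space \<Rightarrow> 'a"
  assumes w: "sphere_field T L w" and t: "t \<in> {0..T}"
    and u: "\<And>t. t \<in> {0..T} \<Longrightarrow> u t \<in> usphere \<and> (u has_vector_derivative w t (u t)) (at t within {0..T})"
    and v: "\<And>t. t \<in> {0..T} \<Longrightarrow> v t \<in> usphere \<and> (v has_vector_derivative w t (v t)) (at t within {0..T})"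
  shows "norm (u t - v t) \<le> norm (u 0 - v 0) * exp (L * t)"
proof (rule gronwall_curve[OF _ _ _ t, where d' = "\<lambda>t. w t (u t) - w t (v t)"])
  have wL: "L-lipschitz_on usphere (w s)" if "s \<in> {0..T}" for s using w that by (simp add: sphere_field_def)
  show "0 \<le> L" using lipschitz_on_nonneg[OF wL[OF t]] .
  fix s assume s: "s \<in> {0..T}"
  show "((\<lambda>t. u t - v t) has_vector_derivative w s (u s) - w s (v s)) (at s within {0..T})"
    using u[OF s] v[OF s] by (intro has_vector_derivative_diff) auto
  show "norm (w s (u s) - w s (v s)) \<le> L * norm (u s - v s)"
    using lipschitz_onD[OF wL[OF s], of "u s" "v s"] u[OF s] v[OF s] by (simp add: dist_norm)
qed

lemma sphere_flow_lipschitz: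
  assumes w: "sphere_field T L w" and X: "sphere_flow T w X" and t: "t \<in> {0..T}"
    and x: "x \<in> usphere" and y: "y \<in> usphere"
  shows "norm (X t x - X t y) \<le> exp (L * t) * norm (x - y)"
  using flow_curves_diverge_exponentially[OF w t, of "\<lambda>t. X t x" "\<lambda>t. X t y"] X x y
  by (simp add: sphere_flow_def mult.commute)

lemma sphere_flow_continuous:
  assumes w: "sphere_field T L w" and X: "sphere_flow T w X" and t: "t \<in> {0..T}"
  shows "continuous_on usphere (X t)"
proof (rule lipschitz_on_continuous_on)
  show "(exp (L * t))-lipschitz_on usphere (X t)"
    by (rule lipschitz_onI) (use sphere_flow_lipschitz[OF w X t] in \<open>auto simp: dist_norm\<close>)
qed

text \<open>
  A single trajectory satisfies the estimate that holds for weak solutions, with the same constant.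
\<close>

lemma flow_step:
  fixes W :: "'a::euclidean_space \<Rightarrow> 'a"
  assumes X: "sphere_flow T w X" and x: "x \<in> usphere" and g: "\<Lambda>-lipschitz_on UNIV g"
    and W: "K-lipschitz_on UNIV W" and s: "0 \<le> s" "0 \<le> h" "s + h \<le> T"
    and close: "\<And>r x. r \<in> {s..s+h} \<Longrightarrow> x \<in> usphere \<Longrightarrow> norm (w r x - W x) \<le> \<eta>"
    and M: "\<And>r x. r \<in> {s..s+h} \<Longrightarrow> x \<in> usphere \<Longrightarrow> norm (w r x) \<le> M"
  shows "\<bar>g (X (s + h) x) - g (X s x + h *\<^sub>R W (X s x))\<bar> \<le> \<Lambda> * (\<eta> + h * K * M) * h"
proof -
  have L0: "0 \<le> \<Lambda>" "0 \<le> K" using g W lipschitz_on_nonneg by blast+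
  have D: "((\<lambda>t. X t x) has_vector_derivative w r (X r x)) (at r within {a..b})" "X r x \<in> usphere"
    if "r \<in> {a..b}" "s \<le> a" "b \<le> s + h" for r a b
  proof -
    have r: "r \<in> {0..T}" using that s by auto
    have "((\<lambda>t. X t x) has_vector_derivative w r (X r x)) (at r within {0..T})" using X x r by (simp add: sphere_flow_def)
    then show "((\<lambda>t. X t x) has_vector_derivative w r (X r x)) (at r within {a..b})"
      by (rule has_vector_derivative_within_subset) (use that s in auto)
    show "X r x \<in> usphere" using X x r by (simp add: sphere_flow_def)
  qed
  have M0: "0 \<le> M" using M[of s x] s x order_trans[OF norm_ge_zero] by auto
  have "norm (X (s + h) x - X s x - (s + h - s) *\<^sub>R W (X s x)) \<le> (\<eta> + h * K * M) * (s + h - s)"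
  proof (rule norm_increment_le_const[where u' = "\<lambda>r. w r (X r x)"])
    fix r assume r: "r \<in> {s..s+h}"
    have rS: "X r x \<in> usphere" using D(2)[OF r] by simp
    have "norm (X r x - X s x - (r - s) *\<^sub>R 0) \<le> M * (r - s)"
      using r by (intro norm_increment_le_const[where u' = "\<lambda>r. w r (X r x)"] D) (auto intro!: M D(2)[of _ s r])
    also have "\<dots> \<le> M * h" using r M0 by (intro mult_left_mono) auto
    finally have "norm (X r x - X s x) \<le> M * h" by simp
    then have "norm (W (X r x) - W (X s x)) \<le> K * (M * h)"
      using lipschitz_onD[OF W, of "X r x" "X s x"] L0(2) by (auto simp: dist_norm intro: order_trans mult_left_mono)
    moreover have "norm (w r (X r x) - W (X r x)) \<le> \<eta>" by (rule close[OF r rS])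
    ultimately show "norm (w r (X r x) - W (X s x)) \<le> \<eta> + h * K * M"
      using norm_triangle_ineq[of "w r (X r x) - W (X r x)" "W (X r x) - W (X s x)"] by (simp add: algebra_simps)
  qed (use s D in auto)
  then have "\<Lambda> * norm (X (s + h) x - (X s x + h *\<^sub>R W (X s x))) \<le> \<Lambda> * ((\<eta> + h * K * M) * h)"
    using L0 by (intro mult_left_mono) (auto simp: algebra_simps)
  moreover have "\<bar>g (X (s + h) x) - g (X s x + h *\<^sub>R W (X s x))\<bar> \<le> \<Lambda> * norm (X (s + h) x - (X s x + h *\<^sub>R W (X s x)))"
    using lipschitz_onD[OF g, of "X (s + h) x" "X s x + h *\<^sub>R W (X s x)"] by (simp add: dist_norm)
  ultimately show ?thesis by (simp add: mult.assoc)
qed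

section \<open>Weak solutions are transported by the flow\<close>

lemma smooth_lipschitz_approximation_vector:
  fixes f :: "'a::euclidean_space \<Rightarrow> 'b::euclidean_space"
  assumes S: "compact S" "S \<noteq> {}" and f: "L-lipschitz_on S f" and e: "0 < e"
  obtains W where "\<And>i. i \<in> Basis \<Longrightarrow> smooth (\<lambda>x. W x \<bullet> i)"
    "(real DIM('b) * L)-lipschitz_on UNIV W" "\<And>x. x \<in> S \<Longrightarrow> norm (W x - f x) \<le> e"
proof -
  have L: "0 \<le> L" using f lipschitz_on_nonneg by blast
  have fi: "L-lipschitz_on S (\<lambda>x. f x \<bullet> i)" if "i \<in> Basis" for i
  proof (rule lipschitz_onI[OF _ L])
    fix x y assume "x \<in> S" "y \<in> S"
    then have "norm (f x - f y) \<le> L * dist x y" using lipschitz_onD[OF f] by (simp add: dist_norm)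
    then show "dist (f x \<bullet> i) (f y \<bullet> i) \<le> L * dist x y"
      using Basis_le_norm[OF that, of "f x - f y"] by (simp add: dist_real_def inner_diff_left)
  qed
  have "\<exists>g. smooth g \<and> L-lipschitz_on UNIV g \<and> (\<forall>x\<in>S. \<bar>g x - f x \<bullet> i\<bar> \<le> e / real DIM('b))" if i: "i \<in> Basis" for i :: 'b
  proof -
    have "0 < e / real DIM('b)" using e by simp
    from smooth_lipschitz_approximation[OF S fi[OF i] this] show ?thesis by metis
  qed
  then obtain G where G: "\<And>i. i \<in> Basis \<Longrightarrow> smooth (G i)" "\<And>i. i \<in> Basis \<Longrightarrow> L-lipschitz_on UNIV (G i)"
    "\<And>i x. i \<in> Basis \<Longrightarrow> x \<in> S \<Longrightarrow> \<bar>G i x - f x \<bullet> i\<bar> \<le> e / real DIM('b)"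
    by metis
  define W where "W x = (\<Sum>i\<in>Basis. G i x *\<^sub>R i)" for x
  have Wi: "W x \<bullet> i = G i x" if "i \<in> Basis" for x i
    using that by (simp add: W_def)
  show ?thesis
  proof (rule that)
    fix i :: 'b assume "i \<in> Basis" then show "smooth (\<lambda>x. W x \<bullet> i)" using G(1) by (simp add: Wi)
  next
    show "(real DIM('b) * L)-lipschitz_on UNIV W"
    proof (rule lipschitz_onI)
      fix x y
      have "norm (W x - W y) \<le> (\<Sum>i\<in>Basis. \<bar>(W x - W y) \<bullet> i\<bar>)" by (rule norm_le_l1)
      also have "\<dots> \<le> (\<Sum>i\<in>(Basis::'b set). L * dist x y)"
        using lipschitz_onD[OF G(2), of _ x y] by (intro sum_mono) (auto simp: inner_diff_left Wi dist_real_def)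
      finally show "dist (W x) (W y) \<le> real DIM('b) * L * dist x y" by (simp add: dist_norm)
    qed (use L in simp)
  next
    fix x assume x: "x \<in> S"
    have "norm (W x - f x) \<le> (\<Sum>i\<in>Basis. \<bar>(W x - f x) \<bullet> i\<bar>)" by (rule norm_le_l1)
    also have "\<dots> \<le> (\<Sum>i\<in>(Basis::'b set). e / real DIM('b))"
      using G(3)[OF _ x] by (intro sum_mono) (simp add: inner_diff_left Wi)
    finally show "norm (W x - f x) \<le> e" by simp
  qed
qed

text \<open>
  Both \<open>\<rho>\<^sub>t\<close> and the image of \<open>\<rho>\<^sub>0\<close> under the flow obey the same estimate over one Euler step
  of length \<open>h\<close>. Pulling \<open>g\<close> back by such a step multiplies its Lipschitz constant by \<open>1 + h K\<close> and costs
  the one-step error once for each of the two curves.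
\<close>

lemma transport_error:
  fixes \<rho> :: "real \<Rightarrow> 'a::euclidean_space measure"
  assumes sol: "weak_solution T v \<rho>" and w: "sphere_field T L (\<lambda>t. v (\<rho> t))"
    and X: "sphere_flow T (\<lambda>t. v (\<rho> t)) X"
    and h: "0 \<le> h" and e: "0 < \<eta>"
    and M: "0 \<le> M" "\<And>r x. r \<in> {0..T} \<Longrightarrow> x \<in> usphere \<Longrightarrow> norm (v (\<rho> r) x) \<le> M"
    and osc: "\<And>r s x. r \<in> {0..T} \<Longrightarrow> s \<in> {0..T} \<Longrightarrow> \<bar>r - s\<bar> \<le> h \<Longrightarrow> x \<in> usphere \<Longrightarrow> norm (v (\<rho> r) x - v (\<rho> s) x) \<le> \<eta>"
    and K: "K = real DIM('a) * L"
  shows "real n * h \<le> T \<Longrightarrow> smooth g \<Longrightarrow> \<Lambda>-lipschitz_on UNIV g \<Longrightarrow>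
    \<bar>(LINT x|\<rho> (real n * h). g x) - (LINT x|\<rho> 0. g (X (real n * h) x))\<bar>
      \<le> real n * h * (2 * (2 * \<eta> + h * K * M)) * (\<Lambda> * (1 + h * K) ^ n)"
proof (induction n arbitrary: g \<Lambda>)
  case 0
  have "0 \<in> {0..T}" using 0 by simp
  then have sp: "\<rho> 0 \<in> sphere_probs" using sol by (simp add: weak_solution_def)
  have "(LINT x|\<rho> 0. g (X 0 x)) = (LINT x|\<rho> 0. g x)"
    by (rule Bochner_Integration.integral_cong[OF refl])
       (use X sphere_probs_space[OF sp] in \<open>auto simp: sphere_flow_def\<close>)
  then show ?case by simp
next
  case (Suc n)
  define s where "s = real n * h"
  have s: "0 \<le> s" "s + h \<le> T" using Suc.prems h by (auto simp: s_def algebra_simps)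
  have sT: "s \<in> {0..T}" and T0: "0 \<in> {0..T}" and shT: "s + h \<in> {0..T}" using s h by auto
  have Suc_s: "real (Suc n) * h = s + h" by (simp add: s_def algebra_simps)
  have sp0: "\<rho> 0 \<in> sphere_probs" using sol T0 by (simp add: weak_solution_def)
  have wL: "L-lipschitz_on usphere (v (\<rho> s))" using w sT by (simp add: sphere_field_def)
  have ne: "usphere \<noteq> ({} :: 'a set)" by simp
  obtain W where W: "\<And>i. i \<in> Basis \<Longrightarrow> smooth (\<lambda>x. W x \<bullet> i)" "K-lipschitz_on UNIV W"
    "\<And>x. x \<in> usphere \<Longrightarrow> norm (W x - v (\<rho> s) x) \<le> \<eta>"
    by (rule smooth_lipschitz_approximation_vector[OF compact_sphere ne wL e, folded K]) (rule that)
  have K0: "0 \<le> K" and L0: "0 \<le> \<Lambda>" using W(2) Suc.prems(3) lipschitz_on_nonneg by blast+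
  have close: "norm (v (\<rho> r) x - W x) \<le> 2 * \<eta>" if "r \<in> {s..s+h}" "x \<in> usphere" for r x
  proof -
    have "norm (v (\<rho> r) x - v (\<rho> s) x) \<le> \<eta>" using that s h by (intro osc) auto
    moreover have "norm (v (\<rho> s) x - W x) \<le> \<eta>" using W(3)[OF that(2)] by (simp add: norm_minus_commute)
    ultimately show ?thesis using norm_triangle_ineq[of "v (\<rho> r) x - v (\<rho> s) x" "v (\<rho> s) x - W x"] by simp
  qed
  have Ms: "norm (v (\<rho> r) x) \<le> M" if "r \<in> {s..s+h}" "x \<in> usphere" for r x
    using that s h by (intro M) auto
  define E where "E = (2 * \<eta> + h * K * M) * h"
  have E0: "0 \<le> E" using e h K0 M by (simp add: E_def)
  define g' where "g' x = g (x + h *\<^sub>R W x)" for x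
  have g': "smooth g'" unfolding g'_def
  proof (rule smooth_compose[OF Suc.prems(2)])
    fix i :: 'a assume i: "i \<in> Basis"
    show "smooth (\<lambda>x. (x + h *\<^sub>R W x) \<bullet> i)"
      unfolding inner_add_left inner_scaleR_left
      by (rule smooth_add[OF smooth_bounded_linear[OF bounded_linear_inner_left] smooth_mult[OF smooth_const W(1)[OF i]]])
  qed
  have g'_lip: "(\<Lambda> * (1 + h * K))-lipschitz_on UNIV g'"
  proof (rule lipschitz_onI)
    fix x y
    have "norm ((x + h *\<^sub>R W x) - (y + h *\<^sub>R W y)) \<le> norm (x - y) + norm (h *\<^sub>R (W x - W y))"
      by (rule order_trans[OF _ norm_triangle_ineq]) (simp add: algebra_simps)
    also have "\<dots> \<le> norm (x - y) + h * (K * norm (x - y))"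
      using lipschitz_onD[OF W(2), of x y] h by (auto simp: dist_norm intro!: mult_left_mono)
    finally have "dist (x + h *\<^sub>R W x) (y + h *\<^sub>R W y) \<le> (1 + h * K) * dist x y"
      by (simp add: dist_norm algebra_simps)
    then have "\<Lambda> * dist (x + h *\<^sub>R W x) (y + h *\<^sub>R W y) \<le> \<Lambda> * ((1 + h * K) * dist x y)"
      by (rule mult_left_mono[OF _ L0])
    then show "dist (g' x) (g' y) \<le> \<Lambda> * (1 + h * K) * dist x y"
      using lipschitz_onD[OF Suc.prems(3), of "x + h *\<^sub>R W x" "y + h *\<^sub>R W y"] by (simp add: g'_def mult.assoc)
  qed (use h K0 L0 in simp)
  have 1: "\<bar>(LINT x|\<rho> (s + h). g x) - (LINT x|\<rho> s. g' x)\<bar> \<le> \<Lambda> * E"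
    using weak_solution_step[OF sol Suc.prems(2,3) _ _ W(1,2) s(1) h s(2) close Ms] w
    by (simp add: sphere_field_def g'_def E_def mult.assoc)
  have 2: "\<bar>(LINT x|\<rho> s. g' x) - (LINT x|\<rho> 0. g' (X s x))\<bar>
      \<le> real n * h * (2 * (2 * \<eta> + h * K * M)) * (\<Lambda> * (1 + h * K) * (1 + h * K) ^ n)"
    using Suc.IH[OF _ g' g'_lip] s h by (simp add: s_def)
  have cg: "continuous_on usphere (\<lambda>x. g (X (s + h) x))" "continuous_on usphere (\<lambda>x. g' (X s x))"
    by (rule continuous_on_compose2[OF lipschitz_on_continuous_on[OF Suc.prems(3)] sphere_flow_continuous[OF w X shT]], simp)
       (rule continuous_on_compose2[OF lipschitz_on_continuous_on[OF g'_lip] sphere_flow_continuous[OF w X sT]], simp)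
  have 3: "\<bar>(LINT x|\<rho> 0. g' (X s x)) - (LINT x|\<rho> 0. g (X (s + h) x))\<bar> \<le> \<Lambda> * E"
  proof -
    have "(LINT x|\<rho> 0. g' (X s x)) - (LINT x|\<rho> 0. g (X (s + h) x)) = (LINT x|\<rho> 0. g' (X s x) - g (X (s + h) x))"
      by (intro Bochner_Integration.integral_diff[symmetric] sphere_probs_integrable[OF sp0] cg)
    also have "norm \<dots> \<le> \<Lambda> * E"
    proof (rule sphere_probs_integral_bound[OF sp0 continuous_on_diff[OF cg(2,1)]])
      fix x :: 'a assume x: "x \<in> usphere"
      show "norm (g' (X s x) - g (X (s + h) x)) \<le> \<Lambda> * E"
        using flow_step[OF X x Suc.prems(3) W(2) s(1) h s(2) close Ms]
        by (simp add: g'_def E_def mult.assoc abs_minus_commute)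
    qed
    finally show ?thesis by simp
  qed
  have p1: "1 \<le> (1 + h * K) ^ Suc n" using h K0 by (intro one_le_power) simp
  have "\<Lambda> * E * 1 \<le> \<Lambda> * E * (1 + h * K) ^ Suc n" using L0 E0 by (intro mult_left_mono p1) simp
  then have "\<bar>(LINT x|\<rho> (s + h). g x) - (LINT x|\<rho> 0. g (X (s + h) x))\<bar>
      \<le> 2 * (\<Lambda> * E * (1 + h * K) ^ Suc n) + real n * (2 * E) * (\<Lambda> * (1 + h * K) ^ Suc n)"
    using 1 2 3 by (simp add: E_def mult_ac)
  also have "\<dots> = real (Suc n) * h * (2 * (2 * \<eta> + h * K * M)) * (\<Lambda> * (1 + h * K) ^ Suc n)"
    by (simp add: E_def algebra_simps)
  finally show ?case unfolding Suc_s .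
qed

lemma weak_solution_transported_smooth:
  fixes \<rho> :: "real \<Rightarrow> 'a::euclidean_space measure"
  assumes sol: "weak_solution T v \<rho>" and w: "sphere_field T L (\<lambda>t. v (\<rho> t))"
    and X: "sphere_flow T (\<lambda>t. v (\<rho> t)) X" and t: "t \<in> {0..T}"
    and g: "smooth g" "\<Lambda>-lipschitz_on UNIV g"
  shows "(LINT x|\<rho> t. g x) = (LINT x|\<rho> 0. g (X t x))"
proof -
  obtain M where M: "0 \<le> M" "\<And>r x. r \<in> {0..T} \<Longrightarrow> x \<in> usphere \<Longrightarrow> norm (v (\<rho> r) x) \<le> M"
    by (rule sphere_field_bounded[OF w]) (rule that)
  define K where "K = real DIM('a) * L"
  have L0: "0 \<le> L" using w t lipschitz_on_nonneg unfolding sphere_field_def by blast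
  then have K0: "0 \<le> K" by (simp add: K_def)
  have Lam0: "0 \<le> \<Lambda>" using g lipschitz_on_nonneg by blast
  define D where "D = \<bar>(LINT x|\<rho> t. g x) - (LINT x|\<rho> 0. g (X t x))\<bar>"
  have "D \<le> \<eta> * (6 * t * \<Lambda> * exp (K * t))" if e: "0 < \<eta>" for \<eta>
  proof -
    have "continuous_on ({0..T} \<times> usphere) (\<lambda>(t,x). v (\<rho> t) x)" using w by (simp add: sphere_field_def)
    then obtain d where d: "0 < d" "\<And>t t' x x'. t \<in> {0..T} \<Longrightarrow> t' \<in> {0..T} \<Longrightarrow> x \<in> usphere \<Longrightarrow> x' \<in> usphere \<Longrightarrow>
        dist t t' < d \<Longrightarrow> dist x x' < d \<Longrightarrow> dist (v (\<rho> t) x) (v (\<rho> t') x') < \<eta>"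
      by (rule uniformly_continuous_uncurried[OF _ compact_Icc compact_sphere e]) (rule that)
    \<comment> \<open>a step short enough for the oscillation of the velocity and for \<open>h K M\<close> to be at most \<open>\<eta>\<close>\<close>
    define d' where "d' = min d (\<eta> / (K * M + 1))"
    have KM: "0 < K * M + 1" using K0 M by (simp add: add_nonneg_pos)
    have d': "0 < d'" using d e KM by (simp add: d'_def)
    obtain n where n: "t / d' < real n" using reals_Archimedean2 by blast
    then have n0: "0 < real n" using t d' by (metis atLeastAtMost_iff divide_nonneg_pos le_less_trans)
    define h where "h = t / real n"
    have h: "0 \<le> h" "h < d'" using n n0 t d' by (auto simp: h_def field_simps)
    have nh: "real n * h = t" using n0 by (simp add: h_def)
    have hK: "h * K * M \<le> \<eta>"
    proof -
      have "h * (K * M) \<le> \<eta> / (K * M + 1) * (K * M)" using h K0 M by (intro mult_right_mono) (auto simp: d'_def)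
      also have "\<dots> \<le> \<eta>" using KM e by (simp add: field_simps)
      finally show ?thesis by (simp add: mult.assoc)
    qed
    have "D \<le> real n * h * (2 * (2 * \<eta> + h * K * M)) * (\<Lambda> * (1 + h * K) ^ n)"
      unfolding D_def nh[symmetric]
    proof (rule transport_error[OF sol w X h(1) e M _ K_def _ g])
      fix r s and x :: 'a assume "r \<in> {0..T}" "s \<in> {0..T}" "\<bar>r - s\<bar> \<le> h" "x \<in> usphere"
      then show "norm (v (\<rho> r) x - v (\<rho> s) x) \<le> \<eta>"
        using d(2)[of r s x x] d(1) h by (simp add: dist_norm d'_def)
    qed (use nh t in auto)
    also have "\<dots> \<le> t * (2 * (2 * \<eta> + \<eta>)) * (\<Lambda> * exp (K * t))"
    proof -
      have "(1 + h * K) ^ n \<le> exp (h * K) ^ n" using h K0 exp_ge_add_one_self[of "h * K"] by (intro power_mono) auto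
      also have "\<dots> = exp (K * t)" unfolding nh[symmetric] exp_of_nat_mult[symmetric] by (simp add: mult_ac)
      finally show ?thesis unfolding nh using t hK e K0 M h Lam0 by (intro mult_mono mult_left_mono add_left_mono) auto
    qed
    finally show ?thesis by (simp add: mult_ac)
  qed
  note small = this
  have "D \<le> 0"
  proof (rule field_le_epsilon)
    fix e :: real assume e: "0 < e"
    define c where "c = 6 * t * \<Lambda> * exp (K * t)"
    have c: "0 \<le> c" using t Lam0 by (simp add: c_def)
    have "0 < e / (c + 1)" using e c by simp
    from small[OF this] have "D \<le> e / (c + 1) * c" unfolding c_def .
    also have "\<dots> \<le> e" using c e by (simp add: field_simps)
    finally show "D \<le> 0 + e" by simp
  qed
  then show ?thesis by (simp add: D_def)
qed

text \<open>
  Indicators of closed sets are limits of the Lipschitz functions \<open>max 0 (1 - n infdist x C)\<close>, and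
  closed sets form an intersection stable generator of the Borel sets.
\<close>

lemma sphere_measure_eqI:
  fixes \<mu> \<nu> :: "'a::euclidean_space measure"
  assumes \<mu>: "\<mu> \<in> sphere_probs" and \<nu>: "\<nu> \<in> sphere_probs"
    and eq: "\<And>(\<phi> :: 'a \<Rightarrow> real) \<Lambda>. \<Lambda>-lipschitz_on usphere \<phi> \<Longrightarrow> (LINT x|\<mu>. \<phi> x) = (LINT x|\<nu>. \<phi> x)"
  shows "\<mu> = \<nu>"
proof -
  have sp: "space \<mu> = usphere" "space \<nu> = usphere" using sphere_probs_space \<mu> \<nu> by blast+
  have sets: "sets \<mu> = sets (restrict_space borel usphere)" "sets \<nu> = sets (restrict_space borel usphere)"
    using \<mu> \<nu> by (auto simp: sphere_probs_def)
  have set_iff: "A \<in> sets (restrict_space borel (usphere :: 'a set)) \<longleftrightarrow> A \<in> sets borel \<and> A \<subseteq> usphere" for A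
    by (subst sets_restrict_space_iff) auto
  have meas: "emeasure \<kappa> (C \<inter> usphere) = ennreal (lim (\<lambda>n. LINT x|\<kappa>. max 0 (1 - real n * infdist x C)))"
    if \<kappa>: "\<kappa> \<in> sphere_probs" and C: "closed C" "C \<noteq> {}" for \<kappa> :: "'a measure" and C
  proof -
    interpret prob_space \<kappa> using \<kappa> by (simp add: sphere_probs_def)
    have sk: "space \<kappa> = usphere" by (rule sphere_probs_space[OF \<kappa>])
    have Cm: "C \<inter> usphere \<in> sets \<kappa>"
      using \<kappa> C by (simp add: sphere_probs_def set_iff)
    have "(\<lambda>n. LINT x|\<kappa>. max 0 (1 - real n * infdist x C)) \<longlonglongrightarrow> (LINT x|\<kappa>. indicator (C \<inter> usphere) x)"
    proof (rule integral_dominated_convergence[where w = "\<lambda>_. 1"])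
      show "(\<lambda>x. max 0 (1 - real n * infdist x C)) \<in> borel_measurable \<kappa>" for n
        by (rule sphere_probs_measurable[OF \<kappa>]) (intro continuous_intros)
      show "AE x in \<kappa>. (\<lambda>n. max 0 (1 - real n * infdist x C)) \<longlonglongrightarrow> indicator (C \<inter> usphere) x"
      proof (rule AE_I2)
        fix x assume x: "x \<in> space \<kappa>"
        show "(\<lambda>n. max 0 (1 - real n * infdist x C)) \<longlonglongrightarrow> indicator (C \<inter> usphere) x"
        proof (cases "x \<in> C")
          case True
          then show ?thesis using x sk by simp
        next
          case False
          then have d: "0 < infdist x C"
            using C infdist_nonneg[of x C] in_closed_iff_infdist_zero[of C x] by linarith
          obtain N where N: "1 / infdist x C < real N" using reals_Archimedean2 by blast
          have "max 0 (1 - real n * infdist x C) = 0" if "n \<ge> N" for n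
          proof -
            have "1 < real N * infdist x C" using N d by (simp add: field_simps)
            also have "\<dots> \<le> real n * infdist x C" using that d by (intro mult_right_mono) auto
            finally show ?thesis by simp
          qed
          then have "\<forall>\<^sub>F n in sequentially. max 0 (1 - real n * infdist x C) = 0"
            unfolding eventually_sequentially by blast
          then show ?thesis using False by (simp add: tendsto_eventually)
        qed
      qed
    qed (use Cm in \<open>auto simp: infdist_nonneg\<close>)
    then have "lim (\<lambda>n. LINT x|\<kappa>. max 0 (1 - real n * infdist x C)) = measure \<kappa> (C \<inter> usphere)"
      using Cm by (simp add: limI)
    then show ?thesis by (simp add: emeasure_eq_measure)
  qed
  have lip: "(real n)-lipschitz_on usphere (\<lambda>x. max 0 (1 - real n * infdist x C))" for n :: nat and C :: "'a set"
  proof (rule lipschitz_onI)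
    fix x y :: 'a
    have "\<bar>infdist x C - infdist y C\<bar> \<le> dist x y"
      using infdist_triangle[of x C y] infdist_triangle[of y C x] by (simp add: dist_commute)
    then have "real n * \<bar>infdist x C - infdist y C\<bar> \<le> real n * dist x y" by (intro mult_left_mono) auto
    moreover have "real n * \<bar>infdist x C - infdist y C\<bar> = \<bar>real n * infdist x C - real n * infdist y C\<bar>"
      by (simp add: right_diff_distrib[symmetric] abs_mult)
    ultimately show "dist (max 0 (1 - real n * infdist x C)) (max 0 (1 - real n * infdist y C)) \<le> real n * dist x y"
      unfolding dist_real_def by linarith
  qed simp
  have closed_eq: "emeasure \<mu> (C \<inter> usphere) = emeasure \<nu> (C \<inter> usphere)" if "closed C" for C
  proof (cases "C = {}")
    case False
    then show ?thesis using meas[OF \<mu> that] meas[OF \<nu> that] eq[OF lip] by simp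
  qed simp
  have fin: "emeasure \<mu> usphere \<noteq> \<infinity>"
    using \<mu> sp(1) prob_space.emeasure_space_1[of \<mu>] by (simp add: sphere_probs_def)
  have "distr \<mu> borel (\<lambda>x. x) = distr \<nu> borel (\<lambda>x. x)"
  proof (rule measure_eqI_generator_eq[where E = "Collect closed" and \<Omega> = UNIV and A = "\<lambda>_. UNIV"])
    have m: "(\<lambda>x. x) \<in> borel_measurable \<mu>" "(\<lambda>x. x) \<in> borel_measurable \<nu>"
      by (rule sphere_probs_measurable[OF \<mu> continuous_on_id] sphere_probs_measurable[OF \<nu> continuous_on_id])+
    show "emeasure (distr \<mu> borel (\<lambda>x. x)) C = emeasure (distr \<nu> borel (\<lambda>x. x)) C" if "C \<in> Collect closed" for C
      using closed_eq[of C] that m by (simp add: emeasure_distr sp)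
    show "emeasure (distr \<mu> borel (\<lambda>x. x)) UNIV \<noteq> \<infinity>"
      using fin m by (simp add: emeasure_distr sp)
  qed (auto simp: Int_stable_def borel_eq_closed)
  then have *: "emeasure (distr \<mu> borel (\<lambda>x. x)) A = emeasure (distr \<nu> borel (\<lambda>x. x)) A" for A by simp
  show ?thesis
  proof (rule measure_eqI)
    show "sets \<mu> = sets \<nu>" by (simp add: sets)
    fix A assume "A \<in> sets \<mu>"
    then have A: "A \<in> sets borel" "A \<subseteq> usphere" by (simp_all add: sets set_iff)
    have m: "(\<lambda>x. x) \<in> borel_measurable \<mu>" "(\<lambda>x. x) \<in> borel_measurable \<nu>"
      by (rule sphere_probs_measurable[OF \<mu> continuous_on_id] sphere_probs_measurable[OF \<nu> continuous_on_id])+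
    have "A \<inter> usphere = A" using A by blast
    then show "emeasure \<mu> A = emeasure \<nu> A" using *[of A] m A by (simp add: emeasure_distr sp)
  qed
qed

text \<open>
  Uniqueness for the continuity equation with a Lipschitz velocity: the error of the Euler comparison
  vanishes with the step length, for every smooth test function and hence for every Lipschitz one.
\<close>

theorem weak_solution_transported:
  fixes \<rho> :: "real \<Rightarrow> 'a::euclidean_space measure"
  assumes sol: "weak_solution T v \<rho>" and w: "sphere_field T L (\<lambda>t. v (\<rho> t))"
    and X: "sphere_flow T (\<lambda>t. v (\<rho> t)) X" and t: "t \<in> {0..T}"
  shows "\<rho> t = distr (\<rho> 0) (\<rho> t) (X t)"
proof -
  have sp: "\<rho> 0 \<in> sphere_probs" "\<rho> t \<in> sphere_probs" using sol t by (auto simp: weak_solution_def)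
  have Xs: "X t x \<in> usphere" if "x \<in> usphere" for x using X t that by (simp add: sphere_flow_def)
  have Xc: "continuous_on usphere (X t)" by (rule sphere_flow_continuous[OF w X t])
  have lip: "(LINT x|\<rho> t. \<phi> x) = (LINT x|\<rho> 0. \<phi> (X t x))" if \<phi>: "\<Lambda>-lipschitz_on usphere \<phi>" for \<phi> :: "'a \<Rightarrow> real" and \<Lambda>
  proof -
    define D where "D = \<bar>(LINT x|\<rho> t. \<phi> x) - (LINT x|\<rho> 0. \<phi> (X t x))\<bar>"
    have "D \<le> 0"
    proof (rule field_le_epsilon)
      fix e :: real assume e: "0 < e"
      then have e2: "0 < e / 2" by simp
      obtain g where g: "smooth g" "\<Lambda>-lipschitz_on UNIV g" "\<And>x. x \<in> usphere \<Longrightarrow> \<bar>g x - \<phi> x\<bar> \<le> e / 2"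
        by (rule smooth_lipschitz_approximation[OF compact_sphere _ \<phi> e2]) (simp, rule that)
      have c: "continuous_on usphere g" "continuous_on usphere \<phi>"
        using lipschitz_on_continuous_on[OF g(2)] lipschitz_on_continuous_on[OF \<phi>] continuous_on_subset by blast+
      have cX: "continuous_on usphere (\<lambda>x. g (X t x))" "continuous_on usphere (\<lambda>x. \<phi> (X t x))"
        using Xs by (auto intro!: continuous_on_compose2[OF c(1) Xc] continuous_on_compose2[OF c(2) Xc])
      have "norm (LINT x|\<rho> t. \<phi> x - g x) \<le> e / 2"
        using g(3) by (intro sphere_probs_integral_bound sp continuous_on_diff c) (simp add: abs_minus_commute)
      moreover have "(LINT x|\<rho> t. \<phi> x - g x) = (LINT x|\<rho> t. \<phi> x) - (LINT x|\<rho> t. g x)"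
        by (intro Bochner_Integration.integral_diff sphere_probs_integrable sp c)
      moreover have "norm (LINT x|\<rho> 0. g (X t x) - \<phi> (X t x)) \<le> e / 2"
        using g(3)[OF Xs] by (intro sphere_probs_integral_bound sp continuous_on_diff cX) simp
      moreover have "(LINT x|\<rho> 0. g (X t x) - \<phi> (X t x)) = (LINT x|\<rho> 0. g (X t x)) - (LINT x|\<rho> 0. \<phi> (X t x))"
        by (intro Bochner_Integration.integral_diff sphere_probs_integrable sp cX)
      moreover have "(LINT x|\<rho> t. g x) = (LINT x|\<rho> 0. g (X t x))"
        by (rule weak_solution_transported_smooth[OF sol w X t g(1,2)])
      ultimately show "D \<le> 0 + e" unfolding D_def real_norm_def by linarith
    qed
    then show ?thesis by (simp add: D_def)
  qed
  show ?thesis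
  proof (rule sphere_measure_eqI)
    show "\<rho> t \<in> sphere_probs" by (rule sp)
    have Xm: "X t \<in> measurable (\<rho> 0) (\<rho> t)" using Xs by (intro sphere_map_measurable sp Xc) auto
    show "distr (\<rho> 0) (\<rho> t) (X t) \<in> sphere_probs"
      using prob_space.prob_space_distr[OF _ Xm] sp by (simp add: sphere_probs_def)
    fix \<phi> :: "'a \<Rightarrow> real" and \<Lambda> assume \<phi>: "\<Lambda>-lipschitz_on usphere \<phi>"
    have "\<phi> \<in> borel_measurable (\<rho> t)"
      by (rule sphere_probs_measurable[OF sp(2) lipschitz_on_continuous_on[OF \<phi>]])
    then show "(LINT x|\<rho> t. \<phi> x) = (LINT x|distr (\<rho> 0) (\<rho> t) (X t). \<phi> x)"
      using lip[OF \<phi>] Xm by (simp add: integral_distr)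
  qed
qed

section \<open>Surface measure of spherical caps\<close>

definition cone_over :: "'a::real_vector set \<Rightarrow> 'a set" where
  "cone_over F = (\<lambda>(t, y). t *\<^sub>R y) ` ({0..1} \<times> F)"

text \<open>
  Cutting the radial direction into steps of length \<open>D\<close> covers the cone by at most \<open>3 / D\<close> balls
  of radius \<open>2 D\<close>.
\<close>

lemma emeasure_cone_over_le:
  fixes F :: "'a::euclidean_space set"
  assumes F: "F \<subseteq> usphere" "compact F" and D: "0 < D" "D \<le> 1"
    and diam: "\<And>x y. x \<in> F \<Longrightarrow> y \<in> F \<Longrightarrow> dist x y \<le> D"
  shows "emeasure lborel (cone_over F) \<le> ennreal (3 * 2 ^ DIM('a) * unit_ball_vol (real DIM('a)) * D ^ (DIM('a) - 1))"
proof (cases "F = {}")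
  case True
  then show ?thesis by (simp add: cone_over_def)
next
  case False
  then obtain y0 where y0: "y0 \<in> F" by blast
  define N where "N = nat \<lfloor>1 / D\<rfloor>"
  define U where "U j = cball ((real j * D) *\<^sub>R y0) (2 * D)" for j
  have N: "real N \<le> 1 / D" using D by (simp add: N_def)
  have "cone_over F \<subseteq> (\<Union>j\<in>{..N}. U j)"
  proof
    fix p assume "p \<in> cone_over F"
    then obtain t y where p: "p = t *\<^sub>R y" "0 \<le> t" "t \<le> 1" "y \<in> F" by (auto simp: cone_over_def)
    define j where "j = nat \<lfloor>t / D\<rfloor>"
    have j: "real j \<le> t / D" "t / D < real j + 1"
      using p D by (auto simp: j_def)
    have jN: "j \<le> N" unfolding j_def N_def using p D by (intro nat_mono floor_mono divide_right_mono) auto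
    have tj: "0 \<le> t - real j * D" "t - real j * D \<le> D" using j D by (auto simp: field_simps)
    have "norm (p - (real j * D) *\<^sub>R y0) = norm ((t - real j * D) *\<^sub>R y + (real j * D) *\<^sub>R (y - y0))"
      by (simp add: p algebra_simps)
    also have "\<dots> \<le> D * 1 + 1 * D"
    proof (intro norm_triangle_le add_mono)
      have "norm y = 1" using p F by auto
      then show "norm ((t - real j * D) *\<^sub>R y) \<le> D * 1" using tj by simp
      have "norm (y - y0) \<le> D" using diam[OF p(4) y0] by (simp add: dist_norm)
      then show "norm ((real j * D) *\<^sub>R (y - y0)) \<le> 1 * D"
        unfolding norm_scaleR using tj p D by (intro mult_mono) auto
    qed
    finally have "p \<in> U j" by (simp add: U_def dist_norm norm_minus_commute)
    with jN show "p \<in> (\<Union>j\<in>{..N}. U j)" by blast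
  qed
  then have "emeasure lborel (cone_over F) \<le> emeasure lborel (\<Union>j\<in>{..N}. U j)"
    by (intro emeasure_mono) (auto simp: U_def)
  also have "\<dots> \<le> (\<Sum>j\<in>{..N}. emeasure lborel (U j))"
    by (intro emeasure_subadditive_finite) (auto simp: U_def)
  also have "\<dots> = ennreal (real (Suc N) * (unit_ball_vol (real DIM('a)) * (2 * D) ^ DIM('a)))"
    using D by (simp add: U_def emeasure_cball ennreal_mult ennreal_of_nat_eq_real_of_nat del: of_nat_Suc)
  also have "\<dots> \<le> ennreal (3 / D * (unit_ball_vol (real DIM('a)) * (2 * D) ^ DIM('a)))"
  proof (intro ennreal_leI mult_right_mono mult_nonneg_nonneg)
    have "1 \<le> 1 / D" using D by simp
    then show "real (Suc N) \<le> 3 / D" using N by simp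
  qed (use D in auto)
  also have "3 / D * (unit_ball_vol (real DIM('a)) * (2 * D) ^ DIM('a)) =
      3 * 2 ^ DIM('a) * unit_ball_vol (real DIM('a)) * D ^ (DIM('a) - 1)"
  proof -
    have "D ^ DIM('a) = D * D ^ (DIM('a) - 1)" by (simp add: power_eq_if)
    then show ?thesis using D by (simp add: power_mult_distrib)
  qed
  finally show ?thesis .
qed

text \<open>
  Passing to the limit from larger values of \<open>D\<close> includes sets of diameter \<open>0\<close>, for which the
  radial direction cannot be cut.
\<close>

lemma emeasure_cone_over_le_diameter:
  fixes F :: "'a::euclidean_space set"
  assumes F: "F \<subseteq> usphere" "compact F" and D: "0 \<le> D" "D \<le> 1/2"
    and diam: "\<And>x y. x \<in> F \<Longrightarrow> y \<in> F \<Longrightarrow> dist x y \<le> D"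
  shows "emeasure lborel (cone_over F) \<le> ennreal (3 * 2 ^ DIM('a) * unit_ball_vol (real DIM('a)) * D ^ (DIM('a) - 1))"
proof (rule LIMSEQ_le_const)
  have "(\<lambda>n. D + 1 / real (Suc n)) \<longlonglongrightarrow> D + 0"
    by (intro tendsto_intros LIMSEQ_Suc[OF lim_1_over_n])
  then show "(\<lambda>n. ennreal (3 * 2 ^ DIM('a) * unit_ball_vol (real DIM('a)) * (D + 1 / real (Suc n)) ^ (DIM('a) - 1))) \<longlonglongrightarrow>
     ennreal (3 * 2 ^ DIM('a) * unit_ball_vol (real DIM('a)) * D ^ (DIM('a) - 1))"
    by (intro tendsto_ennrealI tendsto_intros) simp
  have "emeasure lborel (cone_over F) \<le> ennreal (3 * 2 ^ DIM('a) * unit_ball_vol (real DIM('a)) * (D + 1 / real (Suc n)) ^ (DIM('a) - 1))"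
    if "n \<ge> 1" for n
  proof (rule emeasure_cone_over_le[OF F])
    have "1 / real (Suc n) \<le> 1/2" using that by (simp add: field_simps)
    then show "D + 1 / real (Suc n) \<le> 1" using D by linarith
    show "0 < D + 1 / real (Suc n)" using D by (simp add: add_nonneg_pos)
    show "dist x y \<le> D + 1 / real (Suc n)" if "x \<in> F" "y \<in> F" for x y
      using diam[OF that] by (simp add: add_increasing2)
  qed
  then show "\<exists>N. \<forall>n\<ge>N. emeasure lborel (cone_over F) \<le>
      ennreal (3 * 2 ^ DIM('a) * unit_ball_vol (real DIM('a)) * (D + 1 / real (Suc n)) ^ (DIM('a) - 1))" by blast
qed

lemma ball_subset_cone_over_cap:
  fixes z :: "'a::euclidean_space"
  assumes z: "z \<in> usphere" and s: "0 < s" "s \<le> 1"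
  shows "ball ((1/2) *\<^sub>R z) (s/8) \<subseteq> cone_over (usphere \<inter> cball z s)"
proof
  fix p assume "p \<in> ball ((1/2) *\<^sub>R z) (s/8)"
  then have p: "norm (p - (1/2) *\<^sub>R z) < s/8" by (simp add: dist_norm norm_minus_commute)
  have np: "\<bar>norm p - 1/2\<bar> < s/8"
    using norm_triangle_ineq3[of p "(1/2) *\<^sub>R z"] p z by simp
  then have p0: "0 < norm p" "norm p \<le> 1" using s by linarith+
  define y where "y = p /\<^sub>R norm p"
  have y: "norm y = 1" "p = norm p *\<^sub>R y" using p0 by (auto simp: y_def)
  have "y - z = (1 - 2 * norm p) *\<^sub>R y + 2 *\<^sub>R (p - (1/2) *\<^sub>R z)"
  proof -
    have "(2 * norm p) *\<^sub>R y = 2 *\<^sub>R p" using p0 by (simp add: y_def)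
    then show ?thesis unfolding scaleR_diff_left scaleR_diff_right by simp
  qed
  also have "norm \<dots> \<le> \<bar>1 - 2 * norm p\<bar> * 1 + 2 * norm (p - (1/2) *\<^sub>R z)"
    using y(1) by (intro norm_triangle_le add_mono) auto
  also have "\<dots> \<le> s"
  proof -
    have "\<bar>1 - 2 * norm p\<bar> = 2 * \<bar>norm p - 1/2\<bar>" by (simp add: abs_if)
    then show ?thesis using np p s by simp
  qed
  finally have "y \<in> usphere \<inter> cball z s" using y by (simp add: dist_norm norm_minus_commute)
  then have "(norm p, y) \<in> {0..1} \<times> (usphere \<inter> cball z s)" using p0 by simp
  then show "p \<in> cone_over (usphere \<inter> cball z s)"
    unfolding cone_over_def by (rule rev_image_eqI) (use y(2) in simp)
qed

text \<open>
  A covering of a cap of radius \<open>s\<close> induces one of the solid cone over it, and this cone contains a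
  ball of radius \<open>s / 8\<close>. The exponent \<open>DIM('a)\<close> instead of \<open>DIM('a) - 1\<close> loses a factor \<open>s\<close>, which is
  harmless because only the logarithm of the bound will matter.
\<close>

lemma surface_measure_cap_lower_bound:
  obtains c where "0 < c"
    "\<And>(z::'a::euclidean_space) s. z \<in> usphere \<Longrightarrow> 0 < s \<Longrightarrow> s \<le> 1 \<Longrightarrow>
       ennreal (c * s ^ DIM('a)) \<le> emeasure surface_measure (usphere \<inter> cball z s)"
proof -
  define d where "d = DIM('a)"
  define k where "k = d - 1"
  define \<omega> where "\<omega> = unit_ball_vol (real d)"
  define \<kappa> where "\<kappa> = unit_ball_vol (real k)"
  define C where "C = 3 * 2 ^ d * \<omega> * 2 ^ k / \<kappa>"
  have pos: "0 < \<omega>" "0 < \<kappa>" by (auto simp: \<omega>_def \<kappa>_def)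
  then have C: "0 < C" by (simp add: C_def)
  have gauge: "ennreal (3 * 2 ^ d * \<omega> * D ^ k) = ennreal C * ennreal (\<kappa> * (D / 2) ^ k)" if "0 \<le> D" for D
    using pos C that by (simp add: ennreal_mult[symmetric] C_def power_divide)
  have key: "ennreal (\<omega> * (s / 8) ^ d) \<le> ennreal C * hausdorff_outer k (usphere \<inter> cball z s)"
    if z: "z \<in> usphere" and s: "0 < s" "s \<le> 1" for z :: 'a and s
  proof -
    define A where "A = usphere \<inter> cball z s"
    have "ennreal (\<omega> * (s / 8) ^ d) \<le> ennreal C * (\<Sum>i. hausdorff_gauge k (E i))"
      if E: "E \<in> hausdorff_covers (1/2) A" for E
    proof -
      define F where "F i = closure (E i \<inter> usphere)" for i
      have bE: "bounded (E i)" "diameter (E i) \<le> 1/2" for i using E by (auto simp: hausdorff_covers_def)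
      have bF: "bounded (E i \<inter> usphere)" for i using bE by (blast intro: bounded_subset)
      have F: "F i \<subseteq> usphere" "compact (F i)" for i
        unfolding F_def using bF by (simp_all add: compact_closure closure_minimal[OF Int_lower2 closed_sphere])
      have Fd: "dist x y \<le> diameter (E i)" if "x \<in> F i" "y \<in> F i" for x y i
      proof -
        have "dist x y \<le> diameter (F i)" using that F(2)[of i] by (intro diameter_bounded_bound compact_imp_bounded)
        also have "\<dots> = diameter (E i \<inter> usphere)" unfolding F_def by (rule diameter_closure[OF bF])
        also have "\<dots> \<le> diameter (E i)" by (rule diameter_subset[OF _ bE(1)]) simp
        finally show ?thesis .
      qed
      have cone: "compact (cone_over (F i))" for i
        unfolding cone_over_def case_prod_beta
        by (intro compact_continuous_image compact_Times F compact_Icc continuous_intros)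
      have "emeasure lborel (cone_over (F i)) \<le> ennreal C * hausdorff_gauge k (E i)" for i
      proof (cases "E i = {}")
        case True
        then show ?thesis by (simp add: F_def cone_over_def)
      next
        case False
        have D0: "0 \<le> diameter (E i)" by (rule diameter_ge_0[OF bE(1)])
        have "emeasure lborel (cone_over (F i)) \<le> ennreal (3 * 2 ^ d * \<omega> * diameter (E i) ^ k)"
          unfolding d_def \<omega>_def k_def by (rule emeasure_cone_over_le_diameter[OF F D0 bE(2) Fd])
        then show ?thesis using False gauge[OF D0] by (simp add: hausdorff_gauge_def \<kappa>_def)
      qed
      then have "(\<Sum>i. emeasure lborel (cone_over (F i))) \<le> (\<Sum>i. ennreal C * hausdorff_gauge k (E i))"
        by (intro suminf_le) auto
      moreover have "emeasure lborel (\<Union>i. cone_over (F i)) \<le> (\<Sum>i. emeasure lborel (cone_over (F i)))"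
        using cone by (intro emeasure_subadditive_countably) (auto intro: borel_compact)
      moreover have "emeasure lborel (ball ((1/2) *\<^sub>R z) (s/8)) \<le> emeasure lborel (\<Union>i. cone_over (F i))"
      proof (rule emeasure_mono)
        have "A \<subseteq> (\<Union>i. E i)" using E by (simp add: hausdorff_covers_def)
        moreover have "E i \<inter> A \<subseteq> F i" for i
          using closure_subset[of "E i \<inter> usphere"] unfolding F_def A_def by blast
        ultimately have "A \<subseteq> (\<Union>i. F i)" by blast
        then have "cone_over A \<subseteq> (\<Union>i. cone_over (F i))" unfolding cone_over_def by blast
        then show "ball ((1/2) *\<^sub>R z) (s/8) \<subseteq> (\<Union>i. cone_over (F i))"
          using ball_subset_cone_over_cap[OF z s] unfolding A_def by blast
        show "(\<Union>i. cone_over (F i)) \<in> sets lborel"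
          using cone by (intro sets.countable_UN) (auto intro: borel_compact)
      qed
      moreover have "emeasure lborel (ball ((1/2) *\<^sub>R z) (s/8)) = ennreal (\<omega> * (s / 8) ^ d)"
        using s by (simp add: emeasure_ball \<omega>_def d_def)
      ultimately show ?thesis by (simp only: ennreal_suminf_cmult)
    qed
    then have "ennreal (\<omega> * (s / 8) ^ d) / ennreal C \<le> (\<Sum>i. hausdorff_gauge k (E i))"
      if "E \<in> hausdorff_covers (1/2) A" for E
      using that C by (simp add: divide_le_posI_ennreal)
    then have "ennreal (\<omega> * (s / 8) ^ d) / ennreal C \<le> hausdorff_content k (1/2) A"
      unfolding hausdorff_content_def by (intro INF_greatest)
    also have "\<dots> \<le> hausdorff_outer k A"
      unfolding hausdorff_outer_def by (intro SUP_upper) simp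
    finally have "ennreal C * (ennreal (\<omega> * (s / 8) ^ d) / ennreal C) \<le> ennreal C * hausdorff_outer k A"
      by (rule mult_left_mono) simp
    moreover have "ennreal C * (ennreal (\<omega> * (s / 8) ^ d) / ennreal C) = ennreal (\<omega> * (s / 8) ^ d)"
      using C pos s by (simp add: divide_ennreal ennreal_mult[symmetric])
    ultimately show ?thesis by (simp add: A_def)
  qed
  show ?thesis
  proof (rule that[of "\<omega> / (8 ^ d * C)"])
    show "0 < \<omega> / (8 ^ d * C)" using pos C by simp
    fix z :: 'a and s :: real assume z: "z \<in> usphere" and s: "0 < s" "s \<le> 1"
    have "emeasure surface_measure (usphere \<inter> cball z s) = hausdorff_outer k (usphere \<inter> cball z s)"
      unfolding surface_measure_def
      by (subst emeasure_restrict_space) (auto simp: emeasure_hausdorff_measure k_def d_def)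
    moreover have "ennreal (\<omega> / (8 ^ d * C) * s ^ d) \<le> hausdorff_outer k (usphere \<inter> cball z s)"
    proof -
      have "ennreal (1 / C) * ennreal (\<omega> * (s / 8) ^ d) \<le> ennreal (1 / C) * (ennreal C * hausdorff_outer k (usphere \<inter> cball z s))"
        by (rule mult_left_mono[OF key[OF z s]]) simp
      moreover have "ennreal (1 / C) * (ennreal C * H) = H" for H
        using C by (simp add: mult.assoc[symmetric] ennreal_mult[symmetric])
      moreover have "ennreal (1 / C) * ennreal (\<omega> * (s / 8) ^ d) = ennreal (\<omega> / (8 ^ d * C) * s ^ d)"
        using C pos s by (simp add: ennreal_mult[symmetric] power_divide)
      ultimately show ?thesis by simp
    qed
    ultimately show "ennreal (\<omega> / (8 ^ d * C) * s ^ DIM('a)) \<le> emeasure surface_measure (usphere \<inter> cball z s)"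
      by (simp add: d_def)
  qed
qed

section \<open>Singular values as extrema\<close>

text \<open>
  If \<open>\<parallel>A v\<parallel>\<^sup>2\<close> is extremal on the unit sphere, the first variation of the quadratic form
  \<open>m\<^sup>2 \<parallel>w\<parallel>\<^sup>2 - \<parallel>A w\<parallel>\<^sup>2\<close> vanishes at \<open>v\<close>, which is the eigenvalue equation. The sign of \<open>c\<close>
  distinguishes maxima from minima.
\<close>

lemma extremal_norm_is_singular_value:
  fixes A :: "real^'n^'n"
  assumes v: "norm v = 1" and m: "m = norm (A *v v)"
    and ext: "\<And>w. 0 \<le> c * (m\<^sup>2 * (w \<bullet> w) - (A *v w) \<bullet> (A *v w))" and c: "c \<noteq> 0"
  shows "m \<in> singular_values A"
proof -
  define r where "r = m\<^sup>2 *\<^sub>R v - (transpose A ** A) *v v"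
  define q where "q w = c * (m\<^sup>2 * (w \<bullet> w) - (A *v w) \<bullet> (A *v w))" for w
  define b where "b = c * (r \<bullet> r)"
  have q: "0 \<le> q w" for w using ext by (simp add: q_def)
  have q_exp: "q (v + t *\<^sub>R r) = 2 * t * b + t\<^sup>2 * q r" for t
  proof -
    have "q v = 0" using v by (simp add: q_def m dot_square_norm)
    moreover have "r \<bullet> r = m\<^sup>2 * (v \<bullet> r) - (A *v v) \<bullet> (A *v r)"
      using inner_gram[of r A v]
      by (subst (2) r_def) (simp add: inner_diff_right inner_commute)
    moreover have "q (v + t *\<^sub>R r) = q v + 2 * t * (c * (m\<^sup>2 * (v \<bullet> r) - (A *v v) \<bullet> (A *v r))) + t\<^sup>2 * q r"
      by (simp add: q_def matrix_vector_right_distrib matrix_vector_mult_scaleR inner_add_left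
          inner_add_right inner_commute algebra_simps power2_eq_square)
    ultimately show ?thesis by (simp add: b_def)
  qed
  have "b = 0"
  proof (rule ccontr)
    assume b: "b \<noteq> 0"
    define t where "t = - b / (q r + 1)"
    have p: "0 < q r + 1" using q[of r] by simp
    have tp: "t * (q r + 1) = - b" using p by (simp add: t_def)
    have "t\<^sup>2 * (q r + 1) = - t * b" using tp by (simp add: power2_eq_square mult.assoc)
    then have "2 * t * b + t\<^sup>2 * q r = t * b - t\<^sup>2" by (simp add: algebra_simps)
    moreover have "t * b = - (b\<^sup>2 / (q r + 1))" by (simp add: t_def power2_eq_square)
    moreover have "0 < b\<^sup>2 / (q r + 1)" using b p by simp
    ultimately have "q (v + t *\<^sub>R r) < 0" unfolding q_exp by (smt (verit) zero_le_power2)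
    with q show False by (metis not_less)
  qed
  then have "r = 0" using c by (simp add: b_def)
  then show ?thesis
    using v by (auto simp: singular_values_def r_def m intro!: exI[of _ v])
qed

lemma continuous_norm_matrix_vector: "continuous_on S (\<lambda>v. norm ((A :: real^'n^'n) *v v))"
  by (intro continuous_intros matrix_vector_mult_linear_continuous_on)

lemma norm_matrix_le_sigma_max:
  fixes A :: "real^'n^'n"
  shows "norm (A *v x) \<le> sigma_max A * norm x"
proof -
  obtain v where v: "v \<in> usphere" and max: "\<And>w. w \<in> usphere \<Longrightarrow> norm (A *v w) \<le> norm (A *v v)"
    using continuous_attains_sup[OF compact_sphere _ continuous_norm_matrix_vector, of 0 1 A] by auto
  have bound: "norm (A *v w) \<le> norm (A *v v) * norm w" for w
  proof (cases "w = 0")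
    case False
    then have "norm (A *v ((1 / norm w) *\<^sub>R w)) \<le> norm (A *v v)" by (intro max) simp
    then show ?thesis using False by (simp add: matrix_vector_mult_scaleR divide_simps mult.commute)
  qed simp
  have "norm (A *v v) \<in> singular_values A"
  proof (rule extremal_norm_is_singular_value[of v _ _ 1])
    fix w
    show "0 \<le> 1 * ((norm (A *v v))\<^sup>2 * (w \<bullet> w) - (A *v w) \<bullet> (A *v w))"
      using power_mono[OF bound[of w], of 2] by (simp add: dot_square_norm power_mult_distrib)
  qed (use v in auto)
  then have "norm (A *v v) \<le> sigma_max A"
    unfolding sigma_max_def by (intro Max_ge finite_singular_values)
  then have "norm (A *v v) * norm x \<le> sigma_max A * norm x" by (intro mult_right_mono) auto
  with bound[of x] show ?thesis by linarith
qed

lemma sigma_min_le_norm_matrix: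
  fixes A :: "real^'n^'n"
  shows "sigma_min A * norm x \<le> norm (A *v x)"
proof -
  obtain v where v: "v \<in> usphere" and min: "\<And>w. w \<in> usphere \<Longrightarrow> norm (A *v v) \<le> norm (A *v w)"
    using continuous_attains_inf[OF compact_sphere _ continuous_norm_matrix_vector, of 0 1 A] by auto
  have bound: "norm (A *v v) * norm w \<le> norm (A *v w)" for w
  proof (cases "w = 0")
    case False
    then have "norm (A *v v) \<le> norm (A *v ((1 / norm w) *\<^sub>R w))" by (intro min) simp
    then show ?thesis using False by (simp add: matrix_vector_mult_scaleR divide_simps mult.commute)
  qed simp
  have "norm (A *v v) \<in> singular_values A"
  proof (rule extremal_norm_is_singular_value[of v _ _ "-1"])
    fix w
    show "0 \<le> - 1 * ((norm (A *v v))\<^sup>2 * (w \<bullet> w) - (A *v w) \<bullet> (A *v w))"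
      using power_mono[OF bound[of w], of 2] by (simp add: dot_square_norm power_mult_distrib)
  qed (use v in auto)
  then have "sigma_min A \<le> norm (A *v v)"
    unfolding sigma_min_def by (intro Min_le finite_singular_values)
  then have "sigma_min A * norm x \<le> norm (A *v v) * norm x" by (intro mult_right_mono) auto
  with bound[of x] show ?thesis by linarith
qed

lemma sigma_max_nonneg: "0 \<le> sigma_max (A :: real^'n^'n)"
  using Max_in[OF finite_singular_values singular_values_nonempty, of A]
  by (simp add: sigma_max_def singular_values_def)

lemma sigma_min_pos:
  fixes A :: "real^'n^'n"
  assumes "invertible A"
  shows "0 < sigma_min A"
proof -
  have "sigma_min A \<in> singular_values A"
    unfolding sigma_min_def by (rule Min_in[OF finite_singular_values singular_values_nonempty])
  then obtain v where s: "0 \<le> sigma_min A" "v \<noteq> 0" "(transpose A ** A) *v v = (sigma_min A)\<^sup>2 *\<^sub>R v"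
    by (auto simp: singular_values_def)
  have "sigma_min A \<noteq> 0"
  proof
    assume "sigma_min A = 0"
    then have "v \<bullet> ((transpose A ** A) *v v) = 0" using s(3) by simp
    then have "A *v v = 0" unfolding inner_gram by simp
    moreover obtain A' where "A' ** A = mat 1" using assms by (auto simp: invertible_def)
    then have "A' *v (A *v v) = v" by (simp only: matrix_vector_mul_assoc matrix_vector_mul_lid)
    ultimately show False using s(2) by simp
  qed
  with s(1) show ?thesis by simp
qed

lemma inner_transpose_matrix:
  fixes B :: "real^'n^'n"
  shows "x \<bullet> (B *v y) = (transpose B *v x) \<bullet> y"
  by (metis dot_lmul_matrix vector_transpose_matrix transpose_transpose transpose_matrix_vector)

lemma norm_transpose_le_sigma_max:
  fixes B :: "real^'n^'n"
  shows "norm (transpose B *v x) \<le> sigma_max B * norm x"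
proof (cases "transpose B *v x = 0")
  case False
  define n where "n = norm (transpose B *v x)"
  have "n * n = x \<bullet> (B *v (transpose B *v x))"
    by (simp only: inner_transpose_matrix n_def dot_square_norm power2_eq_square)
  also have "\<dots> \<le> norm x * norm (B *v (transpose B *v x))" by (rule norm_cauchy_schwarz)
  also have "\<dots> \<le> norm x * (sigma_max B * n)"
    unfolding n_def by (intro mult_left_mono norm_matrix_le_sigma_max) simp
  finally show ?thesis using False by (simp add: n_def mult_ac)
qed (simp add: sigma_max_nonneg)

text \<open>
  With \<open>x = B y\<close> one has \<open>\<parallel>x\<parallel>\<^sup>2 = (B\<^sup>T x) \<bullet> y\<close>, and \<open>\<parallel>y\<parallel>\<close> is at most \<open>\<parallel>x\<parallel> / sigma_min B\<close>.
\<close>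

lemma sigma_min_le_norm_transpose:
  fixes B :: "real^'n^'n"
  assumes "invertible B"
  shows "sigma_min B * norm x \<le> norm (transpose B *v x)"
proof (cases "x = 0")
  case False
  obtain B' where "B ** B' = mat 1" using assms by (auto simp: invertible_def)
  then have "B *v (B' *v x) = x" by (simp only: matrix_vector_mul_assoc matrix_vector_mul_lid)
  then obtain y where By: "B *v y = x" by blast
  have "norm x * norm x = (transpose B *v x) \<bullet> y"
    unfolding inner_transpose_matrix[symmetric] By by (simp add: dot_square_norm power2_eq_square)
  also have "\<dots> \<le> norm (transpose B *v x) * norm y" by (rule norm_cauchy_schwarz)
  finally have 1: "sigma_min B * (norm x * norm x) \<le> sigma_min B * (norm (transpose B *v x) * norm y)"
    using sigma_min_pos[OF assms] by (intro mult_left_mono) auto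
  have "norm (transpose B *v x) * (sigma_min B * norm y) \<le> norm (transpose B *v x) * norm x"
    using sigma_min_le_norm_matrix[of B y] By by (intro mult_left_mono) auto
  with 1 have "(sigma_min B * norm x) * norm x \<le> norm (transpose B *v x) * norm x" by (simp add: mult_ac)
  then show ?thesis using False by simp
qed simp

section \<open>Regularity of the two velocity fields\<close>

lemma inner_tangent_proj: "x \<in> usphere \<Longrightarrow> x \<bullet> tangent_proj x a = 0"
  by (simp add: tangent_proj_def inner_diff_right dot_square_norm)

lemma tangent_proj_diff: "tangent_proj x (a - b) = tangent_proj x a - tangent_proj x b"
  by (simp add: tangent_proj_def algebra_simps inner_diff_right)

lemma norm_tangent_proj_le:
  assumes "x \<in> usphere" shows "norm (tangent_proj x a) \<le> norm a"
proof -
  have "(norm (tangent_proj x a))\<^sup>2 = tangent_proj x a \<bullet> a"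
    using inner_tangent_proj[OF assms, of a]
    unfolding power2_norm_eq_inner by (subst (2) tangent_proj_def) (simp add: inner_diff_right inner_commute)
  also have "\<dots> = (norm a)\<^sup>2 - (x \<bullet> a)\<^sup>2"
    by (simp add: tangent_proj_def inner_diff_left dot_square_norm power2_eq_square[of "x \<bullet> a"])
  also have "\<dots> \<le> (norm a)\<^sup>2" by simp
  finally show ?thesis by (rule power2_le_imp_le) simp
qed

lemma tangent_proj_lipschitz:
  assumes x: "x \<in> usphere" and y: "y \<in> usphere" and M: "norm b \<le> M"
  shows "norm (tangent_proj x a - tangent_proj y b) \<le> norm (a - b) + 2 * M * norm (x - y)"
proof -
  have "tangent_proj x b - tangent_proj y b = (y \<bullet> b) *\<^sub>R (y - x) + ((y - x) \<bullet> b) *\<^sub>R x"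
    by (simp add: tangent_proj_def algebra_simps inner_diff_left)
  also have "norm \<dots> \<le> M * norm (x - y) + norm (x - y) * M"
  proof (intro norm_triangle_le add_mono)
    have "\<bar>y \<bullet> b\<bar> \<le> norm y * norm b" by (rule Cauchy_Schwarz_ineq2)
    then have "\<bar>y \<bullet> b\<bar> \<le> M" using y M by simp
    then show "norm ((y \<bullet> b) *\<^sub>R (y - x)) \<le> M * norm (x - y)"
      unfolding norm_scaleR by (simp add: norm_minus_commute mult_right_mono)
    have "\<bar>(y - x) \<bullet> b\<bar> \<le> norm (y - x) * norm b" by (rule Cauchy_Schwarz_ineq2)
    also have "\<dots> \<le> norm (y - x) * M" by (intro mult_left_mono M) simp
    finally show "norm (((y - x) \<bullet> b) *\<^sub>R x) \<le> norm (x - y) * M" using x by (simp add: norm_minus_commute)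
  qed
  finally have "norm (tangent_proj x b - tangent_proj y b) \<le> 2 * M * norm (x - y)" by simp
  moreover have "norm (tangent_proj x a - tangent_proj x b) \<le> norm (a - b)"
    unfolding tangent_proj_diff[symmetric] by (rule norm_tangent_proj_le[OF x])
  ultimately show ?thesis
    using norm_triangle_ineq[of "tangent_proj x a - tangent_proj x b" "tangent_proj x b - tangent_proj y b"] by simp
qed

lemma normalize_lipschitz:
  fixes u v :: "'a::real_normed_vector"
  assumes "0 < m" "m \<le> norm u" "v \<noteq> 0"
  shows "norm ((1 / norm u) *\<^sub>R u - (1 / norm v) *\<^sub>R v) \<le> 2 / m * norm (u - v)"
proof -
  have u: "0 < norm u" using assms(1,2) by linarith
  have "norm u *\<^sub>R ((1 / norm u) *\<^sub>R u - (1 / norm v) *\<^sub>R v) = (u - v) + ((norm v - norm u) / norm v) *\<^sub>R v"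
    using u assms(3) by (simp add: algebra_simps diff_divide_distrib)
  then have "norm u * norm ((1 / norm u) *\<^sub>R u - (1 / norm v) *\<^sub>R v) = norm ((u - v) + ((norm v - norm u) / norm v) *\<^sub>R v)"
    by (metis abs_norm_cancel norm_scaleR)
  also have "\<dots> \<le> norm (u - v) + \<bar>norm v - norm u\<bar>"
    using assms(3) by (intro norm_triangle_le add_mono) auto
  also have "\<dots> \<le> 2 * norm (u - v)"
    using norm_triangle_ineq3[of v u] by (simp add: norm_minus_commute)
  finally have "norm u * norm ((1 / norm u) *\<^sub>R u - (1 / norm v) *\<^sub>R v) \<le> 2 * norm (u - v)" .
  moreover have "m * norm ((1 / norm u) *\<^sub>R u - (1 / norm v) *\<^sub>R v) \<le> norm u * norm ((1 / norm u) *\<^sub>R u - (1 / norm v) *\<^sub>R v)"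
    using assms by (intro mult_right_mono) auto
  ultimately have "m * norm ((1 / norm u) *\<^sub>R u - (1 / norm v) *\<^sub>R v) \<le> 2 * norm (u - v)" by linarith
  then show ?thesis using assms(1) by (simp add: field_simps)
qed

lemma hardmax_sphere_field:
  fixes B V :: "real^'n^'n"
  assumes B: "invertible B"
  shows "sphere_field T (2 * sigma_max V * (sigma_max B / sigma_min B + 1)) (\<lambda>_. hardmax_field B V)"
proof -
  define L where "L = 2 * sigma_max V * (sigma_max B / sigma_min B + 1)"
  have pos: "0 \<le> sigma_max V" "0 \<le> sigma_max B" "0 < sigma_min B"
    using sigma_max_nonneg sigma_min_pos[OF B] by auto
  have lower: "sigma_min B \<le> norm (transpose B *v x)" if "x \<in> usphere" for x
    using sigma_min_le_norm_transpose[OF B, of x] that by simp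
  define n where "n x = (1 / norm (transpose B *v x)) *\<^sub>R (transpose B *v x)" for x
  have hm: "hardmax_field B V x = tangent_proj x (V *v n x)" for x
    by (simp add: hardmax_field_def n_def matrix_vector_mult_scaleR)
  have nn: "norm (n x) = 1" if "x \<in> usphere" for x
  proof -
    have "0 < norm (transpose B *v x)" using lower[OF that] pos by linarith
    then show ?thesis by (simp add: n_def)
  qed
  have lip: "L-lipschitz_on usphere (hardmax_field B V)"
  proof (rule lipschitz_onI)
    fix x y :: "real^'n" assume x: "x \<in> usphere" and y: "y \<in> usphere"
    have "norm (n x - n y) \<le> 2 / sigma_min B * norm (transpose B *v x - transpose B *v y)"
      unfolding n_def using lower[OF x] lower[OF y] pos by (intro normalize_lipschitz) auto
    also have "\<dots> \<le> 2 / sigma_min B * (sigma_max B * norm (x - y))"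
      unfolding matrix_vector_mult_diff_distrib[symmetric]
      using pos by (intro mult_left_mono norm_transpose_le_sigma_max) auto
    finally have "sigma_max V * norm (n x - n y) \<le> sigma_max V * (2 / sigma_min B * (sigma_max B * norm (x - y)))"
      using pos by (intro mult_left_mono) auto
    then have 1: "norm (V *v n x - V *v n y) \<le> sigma_max V * (2 / sigma_min B * (sigma_max B * norm (x - y)))"
      unfolding matrix_vector_mult_diff_distrib[symmetric] using norm_matrix_le_sigma_max[of V "n x - n y"] by linarith
    have "norm (V *v n y) \<le> sigma_max V" using norm_matrix_le_sigma_max[of V "n y"] nn[OF y] by simp
    from tangent_proj_lipschitz[OF x y this, of "V *v n x"] 1
    have "norm (tangent_proj x (V *v n x) - tangent_proj y (V *v n y))
        \<le> sigma_max V * (2 / sigma_min B * (sigma_max B * norm (x - y))) + 2 * sigma_max V * norm (x - y)"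
      by linarith
    then show "dist (hardmax_field B V x) (hardmax_field B V y) \<le> L * dist x y"
      by (simp add: hm dist_norm L_def algebra_simps)
  qed (use pos in \<open>simp add: L_def\<close>)
  show ?thesis
    unfolding sphere_field_def L_def[symmetric]
  proof (intro conjI ballI)
    show "continuous_on ({0..T} \<times> usphere) (\<lambda>(t,x). hardmax_field B V x)"
      by (rule continuous_on_Times_lipschitz[OF lip]) (rule continuous_on_const)
    show "x \<bullet> hardmax_field B V x = 0" if "x \<in> usphere" for x
      unfolding hm by (rule inner_tangent_proj[OF that])
  qed (rule lip)
qed

definition attention_weight :: "real \<Rightarrow> real^'n^'n \<Rightarrow> (real^'n) measure \<Rightarrow> real^'n \<Rightarrow> real^'n \<Rightarrow> real" where
  "attention_weight \<beta> B \<mu> x y = exp (\<beta> * (x \<bullet> (B *v y))) / (LINT z|\<mu>. exp (\<beta> * (x \<bullet> (B *v z))))"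

lemma attention_field_eq:
  "attention_field \<beta> B V \<mu> x = tangent_proj x (LINT y|\<mu>. attention_weight \<beta> B \<mu> x y *\<^sub>R (V *v y))"
  by (simp add: attention_field_def attention_weight_def)

lemma continuous_kernel: "continuous_on S (\<lambda>y. exp (\<beta> * (x \<bullet> ((B :: real^'n^'n) *v y))))"
  by (intro continuous_intros matrix_vector_mult_linear_continuous_on)

lemma partition_function_ge:
  fixes B :: "real^'n^'n"
  assumes \<mu>: "\<mu> \<in> sphere_probs" and c: "\<And>y. y \<in> usphere \<Longrightarrow> c \<le> exp (\<beta> * (x \<bullet> (B *v y)))"
  shows "c \<le> (LINT z|\<mu>. exp (\<beta> * (x \<bullet> (B *v z))))"
proof -
  interpret prob_space \<mu> using \<mu> by (simp add: sphere_probs_def)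
  show ?thesis
    by (intro integral_ge_const sphere_probs_integrable[OF \<mu>] continuous_kernel AE_I2)
       (use c sphere_probs_space[OF \<mu>] in auto)
qed

lemma kernel_bounds:
  fixes B :: "real^'n^'n"
  assumes "0 \<le> \<beta>" "x \<in> usphere" "y \<in> usphere"
  shows "\<bar>\<beta> * (x \<bullet> (B *v y))\<bar> \<le> \<beta> * sigma_max B"
proof -
  have "\<bar>x \<bullet> (B *v y)\<bar> \<le> norm x * norm (B *v y)" by (rule Cauchy_Schwarz_ineq2)
  also have "\<dots> \<le> sigma_max B" using norm_matrix_le_sigma_max[of B y] assms by simp
  finally have "\<beta> * \<bar>x \<bullet> (B *v y)\<bar> \<le> \<beta> * sigma_max B" using assms by (intro mult_left_mono)
  then show ?thesis using assms by (simp add: abs_mult)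
qed

lemma attention_weight_average:
  fixes B :: "real^'n^'n"
  assumes \<mu>: "\<mu> \<in> sphere_probs" and \<beta>: "0 \<le> \<beta>" and x: "x \<in> usphere"
  shows "continuous_on usphere (attention_weight \<beta> B \<mu> x)" "0 < attention_weight \<beta> B \<mu> x y"
    "(LINT y|\<mu>. attention_weight \<beta> B \<mu> x y) = 1"
proof -
  have "exp (- (\<beta> * sigma_max B)) \<le> (LINT z|\<mu>. exp (\<beta> * (x \<bullet> (B *v z))))"
    using kernel_bounds[OF \<beta> x, of _ B] by (intro partition_function_ge[OF \<mu>]) (simp, fastforce)
  then have Z: "0 < (LINT z|\<mu>. exp (\<beta> * (x \<bullet> (B *v z))))" by (rule less_le_trans[OF exp_gt_zero])
  then show "continuous_on usphere (attention_weight \<beta> B \<mu> x)" "0 < attention_weight \<beta> B \<mu> x y"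
    "(LINT y|\<mu>. attention_weight \<beta> B \<mu> x y) = 1"
    unfolding attention_weight_def by (auto intro!: continuous_intros continuous_kernel)
qed

lemma norm_attention_average_le:
  fixes B V :: "real^'n^'n"
  assumes \<mu>: "\<mu> \<in> sphere_probs" and \<beta>: "0 \<le> \<beta>" and x: "x \<in> usphere"
    and f: "continuous_on usphere f" "\<And>y. y \<in> usphere \<Longrightarrow> norm (f y :: real^'n) \<le> M"
  shows "norm (LINT y|\<mu>. attention_weight \<beta> B \<mu> x y *\<^sub>R f y) \<le> M"
proof -
  note a = attention_weight_average[OF \<mu> \<beta> x, of B]
  have "norm (LINT y|\<mu>. attention_weight \<beta> B \<mu> x y *\<^sub>R f y) \<le> (LINT y|\<mu>. norm (attention_weight \<beta> B \<mu> x y *\<^sub>R f y))"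
    by (rule integral_norm_bound)
  also have "\<dots> \<le> (LINT y|\<mu>. attention_weight \<beta> B \<mu> x y * M)"
  proof (rule integral_mono)
    show "integrable \<mu> (\<lambda>y. norm (attention_weight \<beta> B \<mu> x y *\<^sub>R f y))"
      by (intro integrable_norm sphere_probs_integrable[OF \<mu>] continuous_on_scaleR a f)
    show "integrable \<mu> (\<lambda>y. attention_weight \<beta> B \<mu> x y * M)"
      by (intro integrable_mult_left sphere_probs_integrable[OF \<mu>] a)
    fix y assume "y \<in> space \<mu>"
    then show "norm (attention_weight \<beta> B \<mu> x y *\<^sub>R f y) \<le> attention_weight \<beta> B \<mu> x y * M"
      using f(2)[of y] a(2)[of y] sphere_probs_space[OF \<mu>] by (simp add: mult_left_mono)
  qed
  also have "\<dots> = M" using a(3) by simp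
  finally show ?thesis .
qed

text \<open>
  Exchanging \<open>x'\<close> for \<open>x\<close> changes the exponential and the partition function by a factor of at most
  \<open>exp (\<beta> * sigma_max B * norm (x - x'))\<close> each.
\<close>

lemma attention_weight_ratio:
  fixes B :: "real^'n^'n"
  assumes \<mu>: "\<mu> \<in> sphere_probs" and \<beta>: "0 \<le> \<beta>" and x: "x \<in> usphere" "x' \<in> usphere" and y: "y \<in> usphere"
  shows "attention_weight \<beta> B \<mu> x y \<le> exp (2 * (\<beta> * sigma_max B * norm (x - x'))) * attention_weight \<beta> B \<mu> x' y"
proof -
  define e where "e x y = exp (\<beta> * (x \<bullet> (B *v y)))" for x y
  define Z where "Z x = (LINT z|\<mu>. e x z)" for x
  define k where "k = \<beta> * sigma_max B * norm (x - x')"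
  have e_le: "e x y \<le> exp (\<beta> * sigma_max B * norm (x - x')) * e x' y" if y: "y \<in> usphere" for x x' y
  proof -
    have "(x - x') \<bullet> (B *v y) \<le> norm (x - x') * norm (B *v y)" by (rule norm_cauchy_schwarz)
    also have "\<dots> \<le> norm (x - x') * sigma_max B"
      using norm_matrix_le_sigma_max[of B y] y by (intro mult_left_mono) auto
    finally have "\<beta> * ((x - x') \<bullet> (B *v y)) \<le> \<beta> * (norm (x - x') * sigma_max B)"
      using \<beta> by (rule mult_left_mono)
    then show ?thesis
      unfolding e_def exp_add[symmetric] by (simp add: inner_diff_left algebra_simps)
  qed
  have ec: "continuous_on usphere (e x)" for x unfolding e_def by (rule continuous_kernel)
  have ei: "integrable \<mu> (e x)" for x by (rule sphere_probs_integrable[OF \<mu> ec])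
  have "Z x' \<le> (LINT z|\<mu>. exp k * e x z)"
    unfolding Z_def using e_le[of _ x' x] sphere_probs_space[OF \<mu>]
    by (intro integral_mono ei integrable_mult_right) (simp add: k_def norm_minus_commute)
  then have Z: "Z x' \<le> exp k * Z x" by (simp add: Z_def)
  have pos: "0 < Z x" "0 < Z x'"
    using attention_weight_average(2)[OF \<mu> \<beta> x(1), of B] attention_weight_average(2)[OF \<mu> \<beta> x(2), of B]
    by (simp_all add: attention_weight_def Z_def e_def zero_less_divide_iff)
  have "e x y * Z x' \<le> (exp k * e x' y) * (exp k * Z x)"
    using e_le[OF y, of x x'] Z pos by (intro mult_mono) (auto simp: k_def e_def)
  also have "\<dots> = (exp k * exp k) * (e x' y * Z x)" by (simp only: mult_ac)
  also have "exp k * exp k = exp (2 * k)" by (simp add: exp_add[symmetric])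
  finally have "e x y / Z x \<le> exp (2 * k) * (e x' y / Z x')" using pos by (simp add: field_simps)
  then show ?thesis unfolding attention_weight_def e_def Z_def k_def .
qed

text \<open>
  This constant grows exponentially with \<open>\<beta>\<close>. It serves only to make the attention flow well posed
  and does not enter the final estimate.
\<close>

lemma attention_field_lipschitz:
  fixes B V :: "real^'n^'n"
  assumes \<mu>: "\<mu> \<in> sphere_probs" and \<beta>: "0 \<le> \<beta>"
  defines "c \<equiv> \<beta> * sigma_max B"
  shows "(4 * c * exp (4 * c) * sigma_max V + 2 * sigma_max V)-lipschitz_on usphere (attention_field \<beta> B V \<mu>)"
proof (rule lipschitz_onI)
  have c0: "0 \<le> c" using \<beta> sigma_max_nonneg[of B] by (simp add: c_def)
  then show "0 \<le> 4 * c * exp (4 * c) * sigma_max V + 2 * sigma_max V" using sigma_max_nonneg[of V] by simp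
  have Vc: "continuous_on S (\<lambda>y. V *v y)" for S by (rule matrix_vector_mult_linear_continuous_on)
  have Vb: "norm (V *v y) \<le> sigma_max V" if "y \<in> usphere" for y
    using norm_matrix_le_sigma_max[of V y] that by simp
  fix x x' :: "real^'n" assume x: "x \<in> usphere" and x': "x' \<in> usphere"
  define w where "w = attention_weight \<beta> B \<mu>"
  note a = attention_weight_average[OF \<mu> \<beta> x, of B, folded w_def]
  note a' = attention_weight_average[OF \<mu> \<beta> x', of B, folded w_def]
  define m where "m x = (LINT y|\<mu>. w x y *\<^sub>R (V *v y))" for x
  define u where "u = 2 * (c * norm (x - x'))"
  define q where "q = exp u - 1"
  have q: "0 \<le> q" "q \<le> u * exp (4 * c)"
  proof -
    have u: "0 \<le> u" using c0 by (simp add: u_def)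
    then show "0 \<le> q" by (simp add: q_def)
    have "norm (x - x') \<le> 2" using norm_triangle_ineq4[of x x'] x x' by simp
    then have "u \<le> 4 * c" using mult_left_mono[of "norm (x - x')" 2 c] c0 by (simp add: u_def)
    then have "u * exp u \<le> u * exp (4 * c)" using u by (intro mult_left_mono) auto
    moreover have "exp u * (1 - u) \<le> exp u * exp (- u)"
      using exp_ge_add_one_self[of "- u"] by (intro mult_left_mono) auto
    ultimately show "q \<le> u * exp (4 * c)" by (simp add: q_def exp_minus algebra_simps)
  qed
  have w_diff: "\<bar>w x y - w x' y\<bar> \<le> q * (w x y + w x' y)" if y: "y \<in> usphere" for y
  proof -
    have "w x y \<le> (1 + q) * w x' y" "w x' y \<le> (1 + q) * w x y"
      using attention_weight_ratio[OF \<mu> \<beta> x x' y, of B] attention_weight_ratio[OF \<mu> \<beta> x' x y, of B]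
      by (simp_all add: w_def q_def u_def c_def norm_minus_commute mult.assoc)
    moreover have "0 \<le> q * w x y" "0 \<le> q * w x' y" using q(1) a(2)[of y] a'(2)[of y] by simp_all
    ultimately show ?thesis by (simp add: algebra_simps abs_le_iff)
  qed
  have iw: "integrable \<mu> (w x)" "integrable \<mu> (w x')" by (intro sphere_probs_integrable[OF \<mu>] a a')+
  have cd: "continuous_on usphere (\<lambda>y. (w x y - w x' y) *\<^sub>R (V *v y))"
    by (intro continuous_on_scaleR continuous_on_diff a a' Vc)
  have "m x - m x' = (LINT y|\<mu>. (w x y - w x' y) *\<^sub>R (V *v y))"
    unfolding m_def scaleR_diff_left
    by (intro Bochner_Integration.integral_diff[symmetric] sphere_probs_integrable[OF \<mu>] continuous_on_scaleR a a' Vc)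
  also have "norm \<dots> \<le> (LINT y|\<mu>. norm ((w x y - w x' y) *\<^sub>R (V *v y)))" by (rule integral_norm_bound)
  also have "\<dots> \<le> (LINT y|\<mu>. q * (w x y + w x' y) * sigma_max V)"
  proof (rule integral_mono)
    show "integrable \<mu> (\<lambda>y. norm ((w x y - w x' y) *\<^sub>R (V *v y)))"
      by (intro integrable_norm sphere_probs_integrable[OF \<mu> cd])
    fix y assume "y \<in> space \<mu>"
    then have y: "y \<in> usphere" by (simp only: sphere_probs_space[OF \<mu>])
    show "norm ((w x y - w x' y) *\<^sub>R (V *v y)) \<le> q * (w x y + w x' y) * sigma_max V"
      unfolding norm_scaleR real_norm_def using w_diff[OF y] Vb[OF y] by (intro mult_mono) auto
  qed (intro integrable_mult_left integrable_mult_right Bochner_Integration.integrable_add iw)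
  also have "\<dots> = 2 * q * sigma_max V" using iw a(3) a'(3) by simp
  also have "\<dots> \<le> 2 * (u * exp (4 * c)) * sigma_max V"
    using q(2) sigma_max_nonneg[of V] by (intro mult_right_mono) auto
  finally have 1: "norm (m x - m x') \<le> 4 * c * exp (4 * c) * sigma_max V * norm (x - x')"
    by (simp add: u_def mult_ac)
  have "norm (m x') \<le> sigma_max V"
    unfolding m_def w_def by (rule norm_attention_average_le[OF \<mu> \<beta> x' Vc Vb])
  from tangent_proj_lipschitz[OF x x' this, of "m x"] 1
  show "dist (attention_field \<beta> B V \<mu> x) (attention_field \<beta> B V \<mu> x') \<le>
      (4 * c * exp (4 * c) * sigma_max V + 2 * sigma_max V) * dist x x'"
    unfolding attention_field_eq w_def[symmetric] m_def[symmetric] by (simp add: dist_norm algebra_simps)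
qed

lemma attention_sphere_field:
  fixes B V :: "real^'n^'n"
  assumes \<rho>: "\<And>t. t \<in> {0..T} \<Longrightarrow> \<rho> t \<in> sphere_probs" and nc: "narrowly_continuous T \<rho>" and \<beta>: "0 \<le> \<beta>"
  obtains L where "sphere_field T L (\<lambda>t. attention_field \<beta> B V (\<rho> t))"
proof -
  define c where "c = \<beta> * sigma_max B"
  define L where "L = 4 * c * exp (4 * c) * sigma_max V + 2 * sigma_max V"
  have lip: "L-lipschitz_on usphere (attention_field \<beta> B V (\<rho> t))" if "t \<in> {0..T}" for t
    unfolding L_def c_def by (rule attention_field_lipschitz[OF \<rho>[OF that] \<beta>])
  have cont: "continuous_on {0..T} (\<lambda>t. attention_field \<beta> B V (\<rho> t) x)" if x: "x \<in> usphere" for x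
  proof -
    define N where "N t = (LINT y|\<rho> t. exp (\<beta> * (x \<bullet> (B *v y))) *\<^sub>R (V *v y))" for t
    define Z where "Z t = (LINT y|\<rho> t. exp (\<beta> * (x \<bullet> (B *v y))))" for t
    have eV: "continuous_on usphere (\<lambda>y. exp (\<beta> * (x \<bullet> (B *v y))) *\<^sub>R (V *v y))"
      by (intro continuous_on_scaleR continuous_kernel matrix_vector_mult_linear_continuous_on)
    have m: "(LINT y|\<rho> t. attention_weight \<beta> B (\<rho> t) x y *\<^sub>R (V *v y)) = (1 / Z t) *\<^sub>R N t" for t
    proof -
      have "attention_weight \<beta> B (\<rho> t) x y *\<^sub>R (V *v y) = (1 / Z t) *\<^sub>R (exp (\<beta> * (x \<bullet> (B *v y))) *\<^sub>R (V *v y))" for y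
        by (simp add: attention_weight_def Z_def)
      then show ?thesis unfolding N_def by (simp only: integral_scaleR_right)
    qed
    have Z: "continuous_on {0..T} Z"
      unfolding Z_def using nc continuous_kernel[of usphere \<beta> x B] unfolding narrowly_continuous_def by blast
    have Z0: "Z t \<noteq> 0" if "t \<in> {0..T}" for t
    proof -
      have "exp (- (\<beta> * sigma_max B)) \<le> Z t"
        unfolding Z_def using kernel_bounds[OF \<beta> x, of _ B] by (intro partition_function_ge[OF \<rho>[OF that]]) (simp, fastforce)
      then show ?thesis using exp_gt_zero[of "- (\<beta> * sigma_max B)"] by linarith
    qed
    have "continuous_on {0..T} (\<lambda>t. N t \<bullet> i)" for i
    proof -
      have "continuous_on usphere (\<lambda>y. (exp (\<beta> * (x \<bullet> (B *v y))) *\<^sub>R (V *v y)) \<bullet> i)"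
        by (intro continuous_on_inner eV continuous_on_const)
      then have "continuous_on {0..T} (\<lambda>t. LINT y|\<rho> t. (exp (\<beta> * (x \<bullet> (B *v y))) *\<^sub>R (V *v y)) \<bullet> i)"
        using nc unfolding narrowly_continuous_def by blast
      moreover have "(LINT y|\<rho> t. (exp (\<beta> * (x \<bullet> (B *v y))) *\<^sub>R (V *v y)) \<bullet> i) = N t \<bullet> i" if "t \<in> {0..T}" for t
        unfolding N_def using sphere_probs_integrable[OF \<rho>[OF that] eV] by (rule integral_inner_left)
      ultimately show ?thesis by (rule continuous_on_eq)
    qed
    then have N: "continuous_on {0..T} N" by (subst continuous_on_componentwise) simp
    show ?thesis
      unfolding attention_field_eq m tangent_proj_def
      by (intro continuous_on_diff continuous_on_scaleR continuous_on_inner continuous_on_divide continuous_on_const Z N)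
         (use Z0 in auto)
  qed
  have "sphere_field T L (\<lambda>t. attention_field \<beta> B V (\<rho> t))"
    unfolding sphere_field_def
  proof (intro conjI ballI lip)
    show "continuous_on ({0..T} \<times> usphere) (\<lambda>(t,x). attention_field \<beta> B V (\<rho> t) x)"
      by (rule continuous_on_Times_lipschitz[OF lip cont])
    show "x \<bullet> attention_field \<beta> B V (\<rho> t) x = 0" if "x \<in> usphere" for t x
      unfolding attention_field_eq by (rule inner_tangent_proj[OF that])
  qed
  then show ?thesis by (rule that)
qed

section \<open>Concentration of the attention weights\<close>

text \<open>
  The average of \<open>exp (\<theta> * q y)\<close> under the Gibbs weights \<open>exp (- \<theta> * q y) / Z\<close> is \<open>1 / Z\<close>, so
  this is Jensen's inequality; the proof integrates the tangent line of the exponential at the mean.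
\<close>

lemma gibbs_average_le:
  fixes q :: "'a::euclidean_space \<Rightarrow> real" and \<theta> :: real
  assumes \<mu>: "\<mu> \<in> sphere_probs" and q: "continuous_on usphere q"
  defines "Z \<equiv> (LINT y|\<mu>. exp (- \<theta> * q y))"
  shows "0 < Z" "\<theta> * (LINT y|\<mu>. exp (- \<theta> * q y) / Z * q y) \<le> - ln Z"
proof -
  interpret prob_space \<mu> using \<mu> by (simp add: sphere_probs_def)
  have sp: "space \<mu> = usphere" by (rule sphere_probs_space[OF \<mu>])
  have ec: "continuous_on usphere (\<lambda>y. exp (- \<theta> * q y))" by (intro continuous_intros q)
  have ie: "integrable \<mu> (\<lambda>y. exp (- \<theta> * q y))" by (rule sphere_probs_integrable[OF \<mu> ec])
  obtain y0 :: 'a where "y0 \<in> usphere" and y0: "\<And>y. y \<in> usphere \<Longrightarrow> exp (- \<theta> * q y0) \<le> exp (- \<theta> * q y)"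
    using continuous_attains_inf[OF compact_sphere _ ec] by auto
  have "exp (- \<theta> * q y0) \<le> Z"
    unfolding Z_def by (intro integral_ge_const ie AE_I2) (use y0 sp in auto)
  then show Z: "0 < Z" by (rule less_le_trans[OF exp_gt_zero])
  define g where "g y = exp (- \<theta> * q y) / Z" for y
  have gc: "continuous_on usphere g" unfolding g_def by (intro continuous_intros q) (use Z in auto)
  have g0: "0 < g y" for y using Z by (simp add: g_def)
  have g1: "(LINT y|\<mu>. g y) = 1" using Z by (simp add: g_def Z_def)
  define m where "m = (LINT y|\<mu>. g y * q y)"
  have ig: "integrable \<mu> g" "integrable \<mu> (\<lambda>y. g y * q y)"
    by (intro sphere_probs_integrable[OF \<mu>] continuous_on_mult gc q)+
  have "exp (\<theta> * m) = (LINT y|\<mu>. exp (\<theta> * m) * ((1 - \<theta> * m) * g y + \<theta> * (g y * q y)))"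
  proof -
    have "(LINT y|\<mu>. (1 - \<theta> * m) * g y + \<theta> * (g y * q y)) = (1 - \<theta> * m) * 1 + \<theta> * m"
      using ig g1 by (simp add: m_def[symmetric])
    then show ?thesis by simp
  qed
  also have "\<dots> \<le> (LINT y|\<mu>. 1 / Z)"
  proof (rule integral_mono)
    show "integrable \<mu> (\<lambda>y. exp (\<theta> * m) * ((1 - \<theta> * m) * g y + \<theta> * (g y * q y)))"
      by (intro integrable_mult_right Bochner_Integration.integrable_add ig)
    fix y
    have "exp (\<theta> * m) * ((1 - \<theta> * m) * g y + \<theta> * (g y * q y)) = exp (\<theta> * m) * (1 + (\<theta> * q y - \<theta> * m)) * g y"
      by (simp add: algebra_simps)
    also have "\<dots> \<le> exp (\<theta> * m) * exp (\<theta> * q y - \<theta> * m) * g y"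
      using g0[of y] exp_ge_add_one_self[of "\<theta> * q y - \<theta> * m"] by (intro mult_right_mono mult_left_mono) auto
    also have "\<dots> = 1 / Z" by (simp add: g_def exp_diff exp_minus)
    finally show "exp (\<theta> * m) * ((1 - \<theta> * m) * g y + \<theta> * (g y * q y)) \<le> 1 / Z" .
  qed simp
  also have "\<dots> = 1 / Z" using prob_space by simp
  finally have "ln (exp (\<theta> * m)) \<le> ln (1 / Z)" using Z by (subst ln_le_cancel_iff) auto
  then show "\<theta> * (LINT y|\<mu>. exp (- \<theta> * q y) / Z * q y) \<le> - ln Z"
    using Z by (simp add: m_def g_def ln_div)
qed

definition hardmax_point :: "real^'n^'n \<Rightarrow> real^'n \<Rightarrow> real^'n" where
  "hardmax_point B x = (1 / norm (transpose B *v x)) *\<^sub>R (transpose B *v x)"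

lemma hardmax_point_sphere:
  assumes "transpose B *v x \<noteq> 0" shows "hardmax_point B x \<in> usphere"
  using assms by (simp add: hardmax_point_def del: transpose_matrix_vector)

text \<open>
  Since \<open>x \<bullet> B y = \<parallel>B\<^sup>T x\<parallel> (1 - \<parallel>y - p\<parallel>\<^sup>2 / 2)\<close> on the sphere, with \<open>p\<close> the hardmax point, the
  attention weights are Gibbs weights for \<open>\<parallel>y - p\<parallel>\<^sup>2 / 2\<close>. Their mean square distance to \<open>p\<close> controls
  the difference of the fields, because the hardmax field is the value that the attention field would have if
  all the weight sat at \<open>p\<close>.
\<close>

lemma attention_error_le_partition:
  fixes B V :: "real^'n^'n"
  assumes \<mu>: "\<mu> \<in> sphere_probs" and \<beta>: "0 < \<beta>" and x: "x \<in> usphere" and B: "transpose B *v x \<noteq> 0"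
  defines "\<theta> \<equiv> \<beta> * norm (transpose B *v x)"
  defines "Z \<equiv> (LINT y|\<mu>. exp (- \<theta> * ((norm (y - hardmax_point B x))\<^sup>2 / 2)))"
  shows "0 < Z" "norm (attention_field \<beta> B V \<mu> x - hardmax_field B V x) \<le> sigma_max V * sqrt (2 / \<theta> * (- ln Z))"
proof -
  define ys where "ys = hardmax_point B x"
  define q where "q y = (norm (y - ys))\<^sup>2 / 2" for y
  have \<theta>: "0 < \<theta>" using \<beta> B by (simp add: \<theta>_def del: transpose_matrix_vector)
  have ysS: "norm ys = 1" using hardmax_point_sphere[OF B] by (simp add: ys_def)
  have qc: "continuous_on usphere q" unfolding q_def by (auto intro!: continuous_intros)
  have Z: "0 < Z" and gibbs: "\<theta> * (LINT y|\<mu>. exp (- \<theta> * q y) / Z * q y) \<le> - ln Z"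
    using gibbs_average_le[OF \<mu> qc, of \<theta>] by (simp_all add: Z_def q_def ys_def)
  show "0 < Z" by (rule Z)
  have kernel: "exp (\<beta> * (x \<bullet> (B *v y))) = exp \<theta> * exp (- \<theta> * q y)" if y: "y \<in> usphere" for y
  proof -
    have "transpose B *v x = norm (transpose B *v x) *\<^sub>R ys"
      using B by (simp add: ys_def hardmax_point_def del: transpose_matrix_vector)
    then have "\<beta> * (x \<bullet> (B *v y)) = \<theta> * (ys \<bullet> y)"
      unfolding inner_transpose_matrix \<theta>_def by (metis inner_scaleR_left mult.assoc)
    moreover have "ys \<bullet> y = 1 - q y"
    proof -
      have "(norm (y - ys))\<^sup>2 = y \<bullet> y - 2 * (ys \<bullet> y) + ys \<bullet> ys"
        unfolding power2_norm_eq_inner by (simp add: inner_diff_left inner_diff_right inner_commute)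
      moreover have "y \<bullet> y = 1" "ys \<bullet> ys = 1" using y ysS by (simp_all add: dot_square_norm)
      ultimately show ?thesis by (simp add: q_def field_simps)
    qed
    ultimately show ?thesis by (simp add: exp_add[symmetric] algebra_simps)
  qed
  have "(LINT z|\<mu>. exp (\<beta> * (x \<bullet> (B *v z)))) = (LINT z|\<mu>. exp \<theta> * exp (- \<theta> * q z))"
    by (intro Bochner_Integration.integral_cong refl kernel) (simp add: sphere_probs_space[OF \<mu>])
  then have part: "(LINT z|\<mu>. exp (\<beta> * (x \<bullet> (B *v z)))) = exp \<theta> * Z"
    by (simp add: Z_def q_def ys_def)
  have w: "attention_weight \<beta> B \<mu> x y = exp (- \<theta> * q y) / Z" if "y \<in> usphere" for y
    unfolding attention_weight_def part kernel[OF that] by simp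
  define W where "W = attention_weight \<beta> B \<mu> x"
  note a = attention_weight_average[OF \<mu> less_imp_le[OF \<beta>] x, of B, folded W_def]
  have iW: "integrable \<mu> W" "integrable \<mu> (\<lambda>y. W y * norm (y - ys))" "integrable \<mu> (\<lambda>y. W y * (norm (y - ys))\<^sup>2)"
    by (intro sphere_probs_integrable[OF \<mu>] continuous_intros a)+
  define m where "m = (LINT y|\<mu>. W y * norm (y - ys))"
  have "m\<^sup>2 \<le> (LINT y|\<mu>. W y * (norm (y - ys))\<^sup>2)"
  proof -
    have "0 \<le> (LINT y|\<mu>. W y * (norm (y - ys) - m)\<^sup>2)"
      using a(2) by (intro Bochner_Integration.integral_nonneg) (simp add: less_imp_le)
    also have "(\<lambda>y. W y * (norm (y - ys) - m)\<^sup>2) = (\<lambda>y. W y * (norm (y - ys))\<^sup>2 - 2 * m * (W y * norm (y - ys)) + m\<^sup>2 * W y)"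
      by (simp add: power2_diff algebra_simps)
    also have "(LINT y|\<mu>. W y * (norm (y - ys))\<^sup>2 - 2 * m * (W y * norm (y - ys)) + m\<^sup>2 * W y)
        = (LINT y|\<mu>. W y * (norm (y - ys))\<^sup>2) - m\<^sup>2"
      using iW a(3) by (simp add: m_def[symmetric] power2_eq_square)
    finally show ?thesis by simp
  qed
  also have "\<dots> = 2 * (LINT y|\<mu>. exp (- \<theta> * q y) / Z * q y)"
  proof -
    have "(LINT y|\<mu>. W y * (norm (y - ys))\<^sup>2) = (LINT y|\<mu>. 2 * (exp (- \<theta> * q y) / Z * q y))"
      by (intro Bochner_Integration.integral_cong refl)
         (simp add: W_def w sphere_probs_space[OF \<mu>] q_def del: transpose_matrix_vector)
    then show ?thesis by simp
  qed
  also have "\<dots> \<le> 2 / \<theta> * (- ln Z)"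
  proof -
    have "\<theta> * I \<le> c \<Longrightarrow> 2 * I \<le> 2 / \<theta> * c" for I c using \<theta> by (simp add: field_simps)
    from this[OF gibbs] show ?thesis .
  qed
  finally have m: "m \<le> sqrt (2 / \<theta> * (- ln Z))" by (rule real_le_rsqrt)
  have Vc: "continuous_on S (\<lambda>y. V *v y)" for S by (rule matrix_vector_mult_linear_continuous_on)
  have "V *v ys = (LINT y|\<mu>. W y *\<^sub>R (V *v ys))"
    using iW(1) a(3) by simp
  then have "(LINT y|\<mu>. W y *\<^sub>R (V *v y)) - V *v ys = (LINT y|\<mu>. W y *\<^sub>R (V *v y)) - (LINT y|\<mu>. W y *\<^sub>R (V *v ys))"
    by simp
  also have "\<dots> = (LINT y|\<mu>. W y *\<^sub>R (V *v (y - ys)))"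
    unfolding matrix_vector_mult_diff_distrib scaleR_diff_right
    by (intro Bochner_Integration.integral_diff[symmetric] sphere_probs_integrable[OF \<mu>] continuous_on_scaleR a(1) Vc continuous_on_const)
  finally have diff: "(LINT y|\<mu>. W y *\<^sub>R (V *v y)) - V *v ys = (LINT y|\<mu>. W y *\<^sub>R (V *v (y - ys)))" .
  have "norm (LINT y|\<mu>. W y *\<^sub>R (V *v (y - ys))) \<le> (LINT y|\<mu>. norm (W y *\<^sub>R (V *v (y - ys))))"
    by (rule integral_norm_bound)
  also have "\<dots> \<le> (LINT y|\<mu>. sigma_max V * (W y * norm (y - ys)))"
  proof (rule integral_mono)
    have "continuous_on usphere (\<lambda>y. V *v (y - ys))"
      unfolding matrix_vector_mult_diff_distrib by (intro continuous_intros Vc)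
    then show "integrable \<mu> (\<lambda>y. norm (W y *\<^sub>R (V *v (y - ys))))"
      by (intro integrable_norm sphere_probs_integrable[OF \<mu>] continuous_on_scaleR a(1))
    show "norm (W y *\<^sub>R (V *v (y - ys))) \<le> sigma_max V * (W y * norm (y - ys))" for y
      using mult_left_mono[OF norm_matrix_le_sigma_max[of V "y - ys"], of "W y"] a(2)[of y] by (simp add: mult_ac)
  qed (use iW in simp)
  also have "\<dots> = sigma_max V * m" by (simp add: m_def)
  also have "\<dots> \<le> sigma_max V * sqrt (2 / \<theta> * (- ln Z))" by (rule mult_left_mono[OF m sigma_max_nonneg])
  finally have "norm ((LINT y|\<mu>. W y *\<^sub>R (V *v y)) - V *v ys) \<le> sigma_max V * sqrt (2 / \<theta> * (- ln Z))"
    unfolding diff .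
  note bound = this
  have eq: "attention_field \<beta> B V \<mu> x - hardmax_field B V x = tangent_proj x ((LINT y|\<mu>. W y *\<^sub>R (V *v y)) - V *v ys)"
    unfolding tangent_proj_diff attention_field_eq W_def hardmax_field_def ys_def hardmax_point_def
    by (simp add: matrix_vector_mult_scaleR)
  show "norm (attention_field \<beta> B V \<mu> x - hardmax_field B V x) \<le> sigma_max V * sqrt (2 / \<theta> * (- ln Z))"
    unfolding eq by (rule order_trans[OF norm_tangent_proj_le[OF x] bound])
qed

lemma field_norm_le_sigma_max:
  fixes B V :: "real^'n^'n"
  assumes x: "x \<in> usphere"
  shows "\<mu> \<in> sphere_probs \<Longrightarrow> 0 \<le> \<beta> \<Longrightarrow> norm (attention_field \<beta> B V \<mu> x) \<le> sigma_max V"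
    and "norm (hardmax_field B V x) \<le> sigma_max V"
proof -
  have Vb: "norm (V *v y) \<le> sigma_max V" if "norm y \<le> 1" for y
    using norm_matrix_le_sigma_max[of V y] mult_left_mono[OF that sigma_max_nonneg[of V]] by simp
  show "norm (attention_field \<beta> B V \<mu> x) \<le> sigma_max V" if "\<mu> \<in> sphere_probs" "0 \<le> \<beta>"
    unfolding attention_field_eq
    by (intro order_trans[OF norm_tangent_proj_le[OF x]] norm_attention_average_le that x
        matrix_vector_mult_linear_continuous_on Vb) simp
  have "norm (hardmax_point B x) \<le> 1" by (simp add: hardmax_point_def del: transpose_matrix_vector)
  from order_trans[OF norm_tangent_proj_le[OF x] Vb[OF this]]
  show "norm (hardmax_field B V x) \<le> sigma_max V"
    by (simp add: hardmax_field_def hardmax_point_def matrix_vector_mult_scaleR)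
qed

text \<open>
  Only the mass that the map brings within distance \<open>R\<close> of \<open>p\<close> is counted.
\<close>

lemma partition_lower_bound:
  fixes \<Phi> :: "'a::euclidean_space \<Rightarrow> 'a"
  assumes \<mu>: "\<mu> \<in> sphere_probs" and \<rho>: "\<rho>0 \<in> sphere_probs" and \<Phi>: "continuous_on usphere \<Phi>" "\<Phi> ` usphere \<subseteq> usphere"
    and push: "\<mu> = distr \<rho>0 \<mu> \<Phi>" and \<theta>: "0 \<le> \<theta>" and C: "C \<in> sets \<rho>0"
    and R: "\<And>x. x \<in> C \<Longrightarrow> norm (\<Phi> x - p) \<le> R"
  shows "exp (- \<theta> * (R\<^sup>2 / 2)) * measure \<rho>0 C \<le> (LINT y|\<mu>. exp (- \<theta> * ((norm (y - p))\<^sup>2 / 2)))"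
proof -
  interpret prob_space \<rho>0 using \<rho> by (simp add: sphere_probs_def)
  define k where "k y = exp (- \<theta> * ((norm (y - p))\<^sup>2 / 2))" for y
  have kc: "continuous_on S k" for S unfolding k_def by (auto intro!: continuous_intros)
  have \<Phi>m: "\<Phi> \<in> measurable \<rho>0 \<mu>" by (rule sphere_map_measurable[OF \<rho> \<mu> \<Phi>])
  have "(LINT y|\<mu>. k y) = (LINT x|\<rho>0. k (\<Phi> x))"
    by (subst push) (rule integral_distr[OF \<Phi>m sphere_probs_measurable[OF \<mu> kc]])
  moreover have "(LINT x|\<rho>0. exp (- \<theta> * (R\<^sup>2 / 2)) * indicator C x) \<le> (LINT x|\<rho>0. k (\<Phi> x))"
  proof (rule integral_mono)
    show "integrable \<rho>0 (\<lambda>x. exp (- \<theta> * (R\<^sup>2 / 2)) * indicator C x)"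
      using C by (intro integrable_mult_right integrable_real_indicator) (auto simp: emeasure_eq_measure)
    show "integrable \<rho>0 (\<lambda>x. k (\<Phi> x))"
      by (intro sphere_probs_integrable[OF \<rho>] continuous_on_compose2[OF kc[of UNIV] \<Phi>(1)]) simp
    fix x
    show "exp (- \<theta> * (R\<^sup>2 / 2)) * indicator C x \<le> k (\<Phi> x)"
    proof (cases "x \<in> C")
      case True
      have "(norm (\<Phi> x - p))\<^sup>2 \<le> R\<^sup>2" using R[OF True] by (intro power_mono) auto
      then show ?thesis using True \<theta> by (simp add: k_def mult_left_mono)
    qed (simp add: k_def)
  qed
  ultimately show ?thesis using C by (simp add: k_def)
qed

lemma measure_cap_lower_bound:
  fixes \<rho>0 :: "'a::euclidean_space measure"
  assumes \<rho>: "\<rho>0 \<in> sphere_probs" and f: "continuous_on usphere f" and \<rho>f: "\<rho>0 = density surface_measure (\<lambda>x. ennreal (f x))"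
    and l: "0 < l" "\<And>x. x \<in> usphere \<Longrightarrow> l \<le> f x"
    and cap: "ennreal a \<le> emeasure surface_measure (usphere \<inter> cball z s)" and a: "0 \<le> a"
  shows "usphere \<inter> cball z s \<in> sets \<rho>0" "l * a \<le> measure \<rho>0 (usphere \<inter> cball z s)"
proof -
  interpret prob_space \<rho>0 using \<rho> by (simp add: sphere_probs_def)
  let ?C = "usphere \<inter> cball z s"
  have sets: "sets (surface_measure :: 'a measure) = sets (restrict_space borel usphere)"
    unfolding surface_measure_def by (intro sets_restrict_space_cong) simp
  have sp: "space (surface_measure :: 'a measure) = usphere"
    by (simp add: surface_measure_def space_restrict_space)
  have C: "?C \<in> sets surface_measure" unfolding sets by (subst sets_restrict_space_iff) auto
  then show "?C \<in> sets \<rho>0" by (simp add: \<rho>f)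
  have fm: "(\<lambda>x. ennreal (f x)) \<in> borel_measurable surface_measure"
  proof -
    have "f \<in> borel_measurable (surface_measure :: 'a measure)"
      using borel_measurable_continuous_on_restrict[OF f] sets by (simp cong: measurable_cong_sets)
    then show ?thesis by simp
  qed
  have "ennreal (l * a) \<le> ennreal l * emeasure surface_measure ?C"
    using l a cap by (simp add: ennreal_mult mult_left_mono)
  also have "\<dots> = (\<integral>\<^sup>+x. ennreal l * indicator ?C x \<partial>surface_measure)"
    by (rule nn_integral_cmult_indicator[OF C, symmetric])
  also have "\<dots> \<le> (\<integral>\<^sup>+x. ennreal (f x) * indicator ?C x \<partial>surface_measure)"
    using l by (intro nn_integral_mono mult_right_mono) (auto simp: sp intro: ennreal_leI)
  also have "\<dots> = emeasure \<rho>0 ?C"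
    unfolding \<rho>f by (rule emeasure_density[OF fm C, symmetric])
  finally show "l * a \<le> measure \<rho>0 ?C"
    using l a by (simp add: emeasure_eq_measure)
qed

section \<open>Hardmax trajectories through a given point and couplings\<close>

text \<open>
  The reversed field \<open>- h\<close> leads from \<open>y\<close> back to the starting point.
\<close>

lemma autonomous_flow_surjective:
  fixes h :: "'a::euclidean_space \<Rightarrow> 'a"
  assumes h: "\<And>T. sphere_field T L (\<lambda>_. h)" and X: "sphere_flow T (\<lambda>_. h) X"
    and s: "s \<in> {0..T}" and y: "y \<in> usphere"
  obtains z where "z \<in> usphere" "X s z = y"
proof -
  have hs: "sphere_field s L (\<lambda>_. h)" by (rule h)
  have "continuous_on ({0..s} \<times> usphere) (\<lambda>p. - (\<lambda>(t,x). h x) p)"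
    using hs unfolding sphere_field_def by (intro continuous_on_minus) blast
  then have f: "sphere_field s L (\<lambda>_ x. - h x)"
    using hs unfolding sphere_field_def by (simp add: case_prod_beta lipschitz_on_def dist_minus)
  have s0: "0 \<le> s" using s by simp
  obtain Y where Y: "sphere_flow s (\<lambda>_ x. - h x) Y"
    by (rule sphere_flow_exists[OF s0 f]) (rule that)
  define z where "z = Y s y"
  have z: "z \<in> usphere" using Y y s by (simp add: z_def sphere_flow_def)
  have "norm (X s z - Y (s - s) y) \<le> norm (X 0 z - Y (s - 0) y) * exp (L * s)"
  proof (rule flow_curves_diverge_exponentially[OF hs, where u = "\<lambda>t. X t z" and v = "\<lambda>t. Y (s - t) y"])
    fix t assume t: "t \<in> {0..s}"
    have tT: "t \<in> {0..T}" and st: "s - t \<in> {0..s}" using t s by auto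
    have "((\<lambda>t. X t z) has_vector_derivative h (X t z)) (at t within {0..T})"
      using X z tT by (simp add: sphere_flow_def)
    then have "((\<lambda>t. X t z) has_vector_derivative h (X t z)) (at t within {0..s})"
      by (rule has_vector_derivative_within_subset) (use s in auto)
    then show "X t z \<in> usphere \<and> ((\<lambda>t. X t z) has_vector_derivative h (X t z)) (at t within {0..s})"
      using X z tT by (simp add: sphere_flow_def)
    have "((\<lambda>t. Y t y) has_vector_derivative - h (Y (s - t) y)) (at (s - t) within {0..s})"
      using Y y st by (simp add: sphere_flow_def)
    then have "((\<lambda>t. Y t y) has_vector_derivative - h (Y (s - t) y)) (at (s - t) within (\<lambda>t. s - t) ` {0..s})"
      by (rule has_vector_derivative_within_subset) auto
    moreover have "((\<lambda>t. s - t) has_vector_derivative -1) (at t within {0..s})"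
      by (auto intro!: derivative_eq_intros)
    ultimately have "((\<lambda>t. Y t y) \<circ> (\<lambda>t. s - t) has_vector_derivative (-1) *\<^sub>R (- h (Y (s - t) y))) (at t within {0..s})"
      by (rule vector_diff_chain_within[rotated])
    then show "Y (s - t) y \<in> usphere \<and> ((\<lambda>t. Y (s - t) y) has_vector_derivative h (Y (s - t) y)) (at t within {0..s})"
      using Y y st by (simp add: o_def sphere_flow_def)
  qed (use s in auto)
  moreover have "X 0 z = z" "Y 0 y = y" using X Y y z by (auto simp: sphere_flow_def)
  ultimately have "X s z = y" by (simp add: z_def)
  with z show ?thesis by (rule that)
qed

lemma wasserstein2_le_sup_dist:
  fixes \<Phi> \<Psi> :: "'a::euclidean_space \<Rightarrow> 'a"
  assumes \<rho>: "\<rho>0 \<in> sphere_probs" and \<mu>: "\<mu> \<in> sphere_probs" and \<nu>: "\<nu> \<in> sphere_probs"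
    and \<Phi>: "continuous_on usphere \<Phi>" "\<Phi> ` usphere \<subseteq> usphere" "\<mu> = distr \<rho>0 \<mu> \<Phi>"
    and \<Psi>: "continuous_on usphere \<Psi>" "\<Psi> ` usphere \<subseteq> usphere" "\<nu> = distr \<rho>0 \<nu> \<Psi>"
    and d: "0 \<le> d" "\<And>x. x \<in> usphere \<Longrightarrow> norm (\<Phi> x - \<Psi> x) \<le> d"
  shows "wasserstein2 \<mu> \<nu> \<le> d"
proof -
  interpret prob_space \<rho>0 using \<rho> by (simp add: sphere_probs_def)
  have sp: "space \<rho>0 = usphere" by (rule sphere_probs_space[OF \<rho>])
  have m: "\<Phi> \<in> measurable \<rho>0 \<mu>" "\<Psi> \<in> measurable \<rho>0 \<nu>"
    by (rule sphere_map_measurable[OF \<rho> \<mu> \<Phi>(1,2)] sphere_map_measurable[OF \<rho> \<nu> \<Psi>(1,2)])+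
  then have pm: "(\<lambda>x. (\<Phi> x, \<Psi> x)) \<in> measurable \<rho>0 (\<mu> \<Otimes>\<^sub>M \<nu>)" by (rule measurable_Pair)
  define \<pi> where "\<pi> = distr \<rho>0 (\<mu> \<Otimes>\<^sub>M \<nu>) (\<lambda>x. (\<Phi> x, \<Psi> x))"
  have "\<pi> \<in> couplings \<mu> \<nu>"
    unfolding couplings_def \<pi>_def using pm \<Phi>(3) \<Psi>(3) by (simp add: distr_distr o_def)
  then have "(INF \<pi>\<in>couplings \<mu> \<nu>. \<integral>\<^sup>+p. ennreal ((dist (fst p) (snd p))\<^sup>2) \<partial>\<pi>) \<le> (\<integral>\<^sup>+p. ennreal ((dist (fst p) (snd p))\<^sup>2) \<partial>\<pi>)"
    by (rule INF_lower)
  also have "\<dots> = (\<integral>\<^sup>+x. ennreal ((dist (\<Phi> x) (\<Psi> x))\<^sup>2) \<partial>\<rho>0)"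
  proof -
    have "(\<lambda>p. ennreal ((dist (fst p) (snd p))\<^sup>2)) \<in> borel_measurable (\<mu> \<Otimes>\<^sub>M \<nu>)"
    proof -
      have "(\<lambda>x. x) \<in> borel_measurable \<mu>" "(\<lambda>x. x) \<in> borel_measurable \<nu>"
        by (rule sphere_probs_measurable[OF \<mu> continuous_on_id] sphere_probs_measurable[OF \<nu> continuous_on_id])+
      then have "(\<lambda>p. fst p) \<in> borel_measurable (\<mu> \<Otimes>\<^sub>M \<nu>)" "(\<lambda>p. snd p) \<in> borel_measurable (\<mu> \<Otimes>\<^sub>M \<nu>)"
        using measurable_compose[OF measurable_fst] measurable_compose[OF measurable_snd] by blast+
      then show ?thesis by measurable
    qed
    then show ?thesis unfolding \<pi>_def using pm by (subst nn_integral_distr) simp_all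
  qed
  also have "\<dots> \<le> (\<integral>\<^sup>+x. ennreal (d\<^sup>2) \<partial>\<rho>0)"
    using d sp by (intro nn_integral_mono ennreal_leI power_mono) (auto simp: dist_norm)
  also have "\<dots> = ennreal (d\<^sup>2)" by (simp add: emeasure_space_1)
  finally have "enn2real (INF \<pi>\<in>couplings \<mu> \<nu>. \<integral>\<^sup>+p. ennreal ((dist (fst p) (snd p))\<^sup>2) \<partial>\<pi>) \<le> d\<^sup>2"
    by (intro enn2real_leI) auto
  then show ?thesis unfolding wasserstein2_def using d(1) by (rule real_le_lsqrt[rotated 1])
qed

section \<open>Distance between the two flows\<close>

lemma inverse_temperature_rate:
  fixes \<beta> :: real
  assumes \<beta>: "0 < \<beta>"
  defines "\<epsilon> \<equiv> sqrt (ln (\<beta> + 1) / \<beta>)"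
  shows "0 < \<epsilon>" "\<epsilon>\<^sup>2 = ln (\<beta> + 1) / \<beta>" "1 / sqrt (\<beta> + 1) \<le> \<epsilon>"
    "\<beta> \<le> 1 \<Longrightarrow> 1 / 2 \<le> \<epsilon>" "1 \<le> \<beta> \<Longrightarrow> 1 / \<beta> \<le> 2 * \<epsilon>\<^sup>2"
proof -
  have ln: "\<beta> / (\<beta> + 1) \<le> ln (\<beta> + 1)"
    using ln_le_minus_one[of "1 / (\<beta> + 1)"] \<beta> by (simp add: ln_div field_simps)
  have lnp: "0 < ln (\<beta> + 1)" using \<beta> by simp
  then show "0 < \<epsilon>" using \<beta> by (simp add: \<epsilon>_def)
  show sq: "\<epsilon>\<^sup>2 = ln (\<beta> + 1) / \<beta>" using \<beta> lnp by (simp add: \<epsilon>_def)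
  have le: "1 / (\<beta> + 1) \<le> ln (\<beta> + 1) / \<beta>" using ln \<beta> by (simp add: field_simps)
  then have "sqrt (1 / (\<beta> + 1)) \<le> \<epsilon>" unfolding \<epsilon>_def by (rule real_sqrt_le_mono)
  then show "1 / sqrt (\<beta> + 1) \<le> \<epsilon>" by (simp add: real_sqrt_divide)
  show "1 / 2 \<le> \<epsilon>" if "\<beta> \<le> 1"
  proof -
    have "1 / 4 \<le> 1 / (\<beta> + 1)" using that \<beta> by (simp add: field_simps)
    then have "sqrt (1 / 4) \<le> \<epsilon>" unfolding \<epsilon>_def using le by (intro real_sqrt_le_mono) linarith
    then show ?thesis by (simp add: real_sqrt_divide)
  qed
  show "1 / \<beta> \<le> 2 * \<epsilon>\<^sup>2" if "1 \<le> \<beta>"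
  proof -
    have "1 / 2 \<le> \<beta> / (\<beta> + 1)" using that by (simp add: field_simps)
    then have "1 \<le> 2 * ln (\<beta> + 1)" using ln by linarith
    then show ?thesis using \<beta> unfolding sq by (simp add: field_simps)
  qed
qed

text \<open>
  The number \<open>P\<close> stands for the mass of a cap whose radius, after the flow has expanded it by
  \<open>exp Ls\<close>, is the length scale \<open>1 / sqrt (\<beta> + 1)\<close> of the attention weights. A power of
  that scale costs only a logarithm, and for \<open>\<beta> \<ge> 1\<close> the remaining constants are absorbed
  since \<open>1 / \<beta>\<close> is at most \<open>2 ln (\<beta> + 1) / \<beta>\<close>.
\<close>

lemma log_mass_deficit_le:
  fixes \<beta> :: real
  assumes \<beta>: "1 \<le> \<beta>" and m: "0 < m" "m \<le> b" and a: "0 < a" and Ls: "0 \<le> Ls"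
    and P: "a * (1 / sqrt (\<beta> + 1) * exp (- Ls)) ^ d \<le> P"
  shows "2 / (\<beta> * b) * (- ln P) \<le> (sqrt (ln (\<beta> + 1) / \<beta>))\<^sup>2 * (4 / m * (\<bar>ln a\<bar> + real d + real d * Ls))"
proof -
  define e2 where "e2 = ln (\<beta> + 1) / \<beta>"
  have \<beta>0: "0 < \<beta>" using \<beta> by simp
  note rate = inverse_temperature_rate[OF \<beta>0]
  have e2: "(sqrt (ln (\<beta> + 1) / \<beta>))\<^sup>2 = e2" using rate(2) by (simp add: e2_def)
  have e20: "0 < e2" using rate(1) \<beta>0 by (simp add: e2_def)
  have inv: "1 / \<beta> \<le> 2 * e2" using rate(5)[OF \<beta>] unfolding e2 .
  have r: "0 < 1 / sqrt (\<beta> + 1) * exp (- Ls)" using \<beta>0 by simp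
  have lnr: "ln (1 / sqrt (\<beta> + 1) * exp (- Ls)) = - (ln (\<beta> + 1) / 2) - Ls"
    using \<beta>0 by (simp add: ln_mult ln_div ln_sqrt)
  have "ln (a * (1 / sqrt (\<beta> + 1) * exp (- Ls)) ^ d) \<le> ln P"
    using P a r by (subst ln_le_cancel_iff) (auto intro: less_le_trans[OF mult_pos_pos[OF a zero_less_power[OF r]] P])
  moreover have "ln (a * (1 / sqrt (\<beta> + 1) * exp (- Ls)) ^ d) = ln a + real d * (- (ln (\<beta> + 1) / 2) - Ls)"
    using a r by (simp only: ln_mult_pos[OF a zero_less_power[OF r]] ln_realpow lnr)
  ultimately have "- ln P \<le> - ln a + real d * (ln (\<beta> + 1) / 2 + Ls)" by (simp add: algebra_simps)
  also have "\<dots> \<le> (\<bar>ln a\<bar> + real d * Ls) + real d * (ln (\<beta> + 1) / 2)" by (simp add: algebra_simps)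
  finally have lnP: "- ln P \<le> (\<bar>ln a\<bar> + real d * Ls) + real d * (ln (\<beta> + 1) / 2)" .
  define Q where "Q = (\<bar>ln a\<bar> + real d * Ls) + real d * (ln (\<beta> + 1) / 2)"
  have Q0: "0 \<le> Q" using Ls \<beta> by (simp add: Q_def)
  have bb: "0 < \<beta> * b" "0 < b" using m \<beta>0 by auto
  have "2 / (\<beta> * b) * (- ln P) \<le> 2 / (\<beta> * b) * Q"
    using lnP bb unfolding Q_def by (intro mult_left_mono) auto
  also have "\<dots> \<le> 2 / (\<beta> * m) * Q"
    using Q0 m \<beta>0 by (intro mult_right_mono divide_left_mono mult_left_mono) auto
  also have "\<dots> = 2 / m * ((1 / \<beta>) * (\<bar>ln a\<bar> + real d * Ls) + real d * (e2 / 2))"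
    using m \<beta>0 by (simp add: Q_def e2_def field_simps)
  also have "\<dots> \<le> 2 / m * ((2 * e2) * (\<bar>ln a\<bar> + real d * Ls) + real d * (2 * e2))"
    using m e20 Ls inv by (intro mult_left_mono add_mono mult_right_mono) auto
  also have "\<dots> = e2 * (4 / m * (\<bar>ln a\<bar> + real d + real d * Ls))" by (simp add: algebra_simps)
  finally show ?thesis unfolding e2 .
qed

text \<open>
  The partition function at \<open>x\<close> is bounded below by following mass from time \<open>0\<close>. Points that the
  hardmax flow \<open>X\<close> brings within \<open>r\<close> of the hardmax point are brought within \<open>\<delta> + r\<close> of it by \<open>\<Phi>\<close>, and
  they include a cap of radius \<open>r exp (- L * s)\<close> around the preimage of that point, whose initial
  mass is known. This yields the field error in terms of the deviation \<open>\<delta>\<close> of the flows themselves, with a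
  factor \<open>sigma_max V\<close> independent of \<open>\<beta>\<close>. For \<open>\<beta> < 1\<close> the trivial bound \<open>2 * sigma_max V\<close>
  suffices, as \<open>\<epsilon>\<close> is then at least \<open>1 / 2\<close>.
\<close>

lemma field_error:
  fixes B V :: "real^'n^'n"
  assumes B: "invertible B" and \<beta>: "0 < \<beta>" and \<mu>: "\<mu> \<in> sphere_probs" and \<rho>: "\<rho>0 \<in> sphere_probs"
    and \<Phi>: "continuous_on usphere \<Phi>" "\<Phi> ` usphere \<subseteq> usphere" "\<mu> = distr \<rho>0 \<mu> \<Phi>"
    and X: "sphere_flow T (\<lambda>_. hardmax_field B V) X" and s: "s \<in> {0..T}"
    and \<delta>: "\<And>x. x \<in> usphere \<Longrightarrow> norm (\<Phi> x - X s x) \<le> \<delta>"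
    and a: "0 < a" and mass: "\<And>z r. z \<in> usphere \<Longrightarrow> 0 < r \<Longrightarrow> r \<le> 1 \<Longrightarrow> usphere \<inter> cball z r \<in> sets \<rho>0 \<and>
       a * r ^ CARD('n) \<le> measure \<rho>0 (usphere \<inter> cball z r)"
    and x: "x \<in> usphere"
  defines "L \<equiv> 2 * sigma_max V * (sigma_max B / sigma_min B + 1)"
  defines "\<epsilon> \<equiv> sqrt (ln (\<beta> + 1) / \<beta>)"
  defines "K \<equiv> 4 * sigma_max V * (1 + (\<bar>ln a\<bar> + real CARD('n) + real CARD('n) * L) / sigma_min B)"
  shows "norm (attention_field \<beta> B V \<mu> x - hardmax_field B V x) \<le> sigma_max V * \<delta> + K * \<epsilon> * exp s"
proof -
  define d where "d = CARD('n)"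
  define m where "m = sigma_min B"
  have pos: "0 \<le> sigma_max V" "0 \<le> sigma_max B" "0 < m"
    using sigma_max_nonneg sigma_min_pos[OF B] by (auto simp: m_def)
  have L0: "0 \<le> L" using pos by (simp add: L_def m_def)
  have s0: "0 \<le> s" using s by simp
  have es: "1 \<le> exp s" "s \<le> exp s" using s0 exp_ge_add_one_self[of s] by linarith+
  note rate = inverse_temperature_rate[OF \<beta>, folded \<epsilon>_def]
  have \<delta>0: "0 \<le> \<delta>" using \<delta>[OF x] norm_ge_zero order_trans by blast
  define c where "c = (\<bar>ln a\<bar> + real d + real d * L) / m"
  have c0: "0 \<le> c" using pos L0 by (simp add: c_def)
  have K: "K = 4 * sigma_max V * (1 + c)" by (simp add: K_def c_def d_def m_def)
  show ?thesis
  proof (cases "\<beta> < 1")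
    case True
    have "norm (attention_field \<beta> B V \<mu> x - hardmax_field B V x) \<le> sigma_max V + sigma_max V"
      using field_norm_le_sigma_max(1)[OF x \<mu> less_imp_le[OF \<beta>], of B V] field_norm_le_sigma_max(2)[OF x, of B V]
        norm_triangle_ineq4[of "attention_field \<beta> B V \<mu> x" "hardmax_field B V x"] by linarith
    also have "\<dots> = 4 * sigma_max V * 1 * (1 / 2) * 1" by simp
    also have "\<dots> \<le> 4 * sigma_max V * (1 + c) * \<epsilon> * exp s"
      using pos c0 rate(4) True es by (intro mult_mono mult_nonneg_nonneg) auto
    also have "\<dots> \<le> sigma_max V * \<delta> + K * \<epsilon> * exp s" using pos \<delta>0 by (simp add: K)
    finally show ?thesis .
  next
    case False
    define b where "b = norm (transpose B *v x)"
    have b: "m \<le> b" using sigma_min_le_norm_transpose[OF B, of x] x by (simp add: b_def m_def del: transpose_matrix_vector)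
    then have Bx: "transpose B *v x \<noteq> 0" using pos by (auto simp: b_def simp del: transpose_matrix_vector)
    define ys where "ys = hardmax_point B x"
    have ys: "ys \<in> usphere" unfolding ys_def by (rule hardmax_point_sphere[OF Bx])
    \<comment> \<open>the length scale on which the attention weights concentrate\<close>
    define r where "r = 1 / sqrt (\<beta> + 1)"
    have r: "0 < r" "r \<le> 1" "r \<le> \<epsilon>" using \<beta> rate(3) by (auto simp: r_def)
    \<comment> \<open>the hardmax flow expands distances by at most \<open>exp (L * s)\<close> up to time \<open>s\<close>\<close>
    define r0 where "r0 = r * exp (- (L * s))"
    have r0: "0 < r0" "r0 \<le> 1" using r L0 s0 by (auto simp: r0_def intro: mult_le_one)
    have hX: "sphere_field T L (\<lambda>_. hardmax_field B V)" for T
      unfolding L_def by (rule hardmax_sphere_field[OF B])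
    obtain z where z: "z \<in> usphere" "X s z = ys"
      by (rule autonomous_flow_surjective[OF hX X s ys]) (rule that)
    define C where "C = usphere \<inter> cball z r0"
    define P where "P = measure \<rho>0 C"
    have C: "C \<in> sets \<rho>0" "a * r0 ^ d \<le> P" using mass[OF z(1) r0] by (simp_all add: C_def P_def d_def)
    have "0 < a * r0 ^ d" using a r0 by simp
    then have P0: "0 < P" using C(2) by linarith
    have R: "norm (\<Phi> y - ys) \<le> \<delta> + r" if y: "y \<in> C" for y
    proof -
      have yS: "y \<in> usphere" and yz: "norm (y - z) \<le> r0" using y by (auto simp: C_def dist_norm norm_minus_commute)
      have "norm (X s y - X s z) \<le> exp (L * s) * norm (y - z)"
        by (rule sphere_flow_lipschitz[OF hX X s yS z(1)])
      also have "\<dots> \<le> exp (L * s) * r0" by (rule mult_left_mono[OF yz]) simp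
      also have "\<dots> = r" by (simp add: r0_def exp_minus)
      finally have "norm (X s y - ys) \<le> r" by (simp add: z(2))
      then show ?thesis using \<delta>[OF yS] norm_triangle_ineq[of "\<Phi> y - X s y" "X s y - ys"] by simp
    qed
    define \<theta> where "\<theta> = \<beta> * b"
    have \<theta>: "0 < \<theta>" using \<beta> b pos by (simp add: \<theta>_def)
    define Z where "Z = (LINT y|\<mu>. exp (- \<theta> * ((norm (y - ys))\<^sup>2 / 2)))"
    have Z: "0 < Z" "norm (attention_field \<beta> B V \<mu> x - hardmax_field B V x) \<le> sigma_max V * sqrt (2 / \<theta> * (- ln Z))"
      using attention_error_le_partition[OF \<mu> \<beta> x Bx] unfolding Z_def \<theta>_def b_def ys_def by blast+
    have "exp (- \<theta> * ((\<delta> + r)\<^sup>2 / 2)) * P \<le> Z"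
      unfolding Z_def P_def by (rule partition_lower_bound[OF \<mu> \<rho> \<Phi> less_imp_le[OF \<theta>] C(1) R])
    then have "ln (exp (- \<theta> * ((\<delta> + r)\<^sup>2 / 2)) * P) \<le> ln Z"
      using P0 Z(1) by (subst ln_le_cancel_iff) auto
    then have "- ln Z \<le> \<theta> * ((\<delta> + r)\<^sup>2 / 2) + - ln P" using P0 by (simp add: ln_mult)
    then have "2 / \<theta> * (- ln Z) \<le> 2 / \<theta> * (\<theta> * ((\<delta> + r)\<^sup>2 / 2) + - ln P)"
      by (rule mult_left_mono) (use \<theta> in simp)
    also have "\<dots> = (\<delta> + r)\<^sup>2 + 2 / \<theta> * (- ln P)" using \<theta> by (simp add: field_simps)
    finally have "2 / \<theta> * (- ln Z) \<le> (\<delta> + r)\<^sup>2 + 2 / (\<beta> * b) * (- ln P)" unfolding \<theta>_def .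
    moreover have "2 / (\<beta> * b) * (- ln P) \<le> \<epsilon>\<^sup>2 * (4 / m * (\<bar>ln a\<bar> + real d + real d * (L * s)))"
      unfolding \<epsilon>_def by (rule log_mass_deficit_le) (use False pos b a L0 s0 C(2) in \<open>auto simp: r0_def r_def\<close>)
    moreover have "4 / m * (\<bar>ln a\<bar> + real d + real d * (L * s)) \<le> 4 * c * exp s"
    proof -
      have "\<bar>ln a\<bar> * 1 + real d * 1 + real d * L * s \<le> \<bar>ln a\<bar> * exp s + real d * exp s + real d * L * exp s"
        using es L0 by (intro add_mono mult_left_mono) auto
      then have "\<bar>ln a\<bar> + real d + real d * (L * s) \<le> (\<bar>ln a\<bar> + real d + real d * L) * exp s" by (simp add: algebra_simps)
      then have "4 / m * (\<bar>ln a\<bar> + real d + real d * (L * s)) \<le> 4 / m * ((\<bar>ln a\<bar> + real d + real d * L) * exp s)"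
        by (rule mult_left_mono) (use pos in simp)
      moreover have "4 / m * (N * e) = 4 * (N / m) * e" for N e :: real by simp
      ultimately show ?thesis unfolding c_def by metis
    qed
    ultimately have "2 / \<theta> * (- ln Z) \<le> (\<delta> + r)\<^sup>2 + \<epsilon>\<^sup>2 * (4 * c * exp s)"
      using mult_left_mono[of "4 / m * (\<bar>ln a\<bar> + real d + real d * (L * s))" "4 * c * exp s" "\<epsilon>\<^sup>2"] by simp
    also have "\<dots> \<le> (\<delta> + r)\<^sup>2 + (\<epsilon> * (1 + 4 * c * exp s))\<^sup>2"
    proof -
      define q where "q = 4 * c * exp s"
      have "q \<le> (1 + q)\<^sup>2" using c0 by (simp add: q_def power2_eq_square algebra_simps)
      then show ?thesis unfolding q_def[symmetric] power_mult_distrib by (intro add_left_mono mult_left_mono) auto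
    qed
    finally have "sqrt (2 / \<theta> * (- ln Z)) \<le> sqrt ((\<delta> + r)\<^sup>2 + (\<epsilon> * (1 + 4 * c * exp s))\<^sup>2)"
      by (rule real_sqrt_le_mono)
    also have "\<dots> \<le> (\<delta> + r) + \<epsilon> * (1 + 4 * c * exp s)"
      using \<delta>0 r rate(1) c0 by (intro sqrt_sum_squares_le_sum) auto
    also have "\<dots> \<le> \<delta> + \<epsilon> * (4 * (1 + c) * exp s)"
    proof -
      have "\<epsilon> * 1 \<le> \<epsilon> * exp s" using rate(1) es by (intro mult_left_mono) auto
      moreover have "0 \<le> \<epsilon> * exp s" using rate(1) by simp
      moreover have "\<epsilon> * (4 * (1 + c) * exp s) = 4 * (\<epsilon> * exp s) + \<epsilon> * (4 * c * exp s)" by (simp add: algebra_simps)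
      ultimately show ?thesis using r(3) by (simp add: distrib_left)
    qed
    finally have "sigma_max V * sqrt (2 / \<theta> * (- ln Z)) \<le> sigma_max V * (\<delta> + \<epsilon> * (4 * (1 + c) * exp s))"
      by (rule mult_left_mono[OF _ pos(1)])
    then show ?thesis using Z(2) by (simp add: K algebra_simps)
  qed
qed

text \<open>
  The largest deviation \<open>\<delta>(t)\<close> over all starting points satisfies
  \<open>\<delta>' \<le> (L + \<sigma>) \<delta> + K \<epsilon> e\<^sup>t\<close> in integrated form. The claimed bound is a supersolution that
  vanishes at \<open>0\<close>: its rate \<open>L + \<sigma> + 2 + K\<close> exceeds \<open>L + \<sigma>\<close> by enough to absorb both the forcing
  and the term \<open>- exp t\<close>.
\<close>

lemma flow_deviation:
  fixes w h :: "real \<Rightarrow> 'a::euclidean_space \<Rightarrow> 'a"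
  assumes X: "sphere_flow T w X" and Y: "sphere_flow T h Y"
    and hL: "\<And>t. t \<in> {0..T} \<Longrightarrow> L-lipschitz_on usphere (h t)" and L0: "0 \<le> L" and \<sigma>: "0 \<le> \<sigma>"
    and wb: "\<And>t x. t \<in> {0..T} \<Longrightarrow> x \<in> usphere \<Longrightarrow> norm (w t x) \<le> M"
    and hb: "\<And>t x. t \<in> {0..T} \<Longrightarrow> x \<in> usphere \<Longrightarrow> norm (h t x) \<le> M"
    and err: "\<And>t x \<delta>. t \<in> {0..T} \<Longrightarrow> x \<in> usphere \<Longrightarrow> (\<And>x. x \<in> usphere \<Longrightarrow> norm (X t x - Y t x) \<le> \<delta>) \<Longrightarrow>
        norm (w t x - h t x) \<le> \<sigma> * \<delta> + K * \<epsilon> * exp t"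
    and K: "0 \<le> K" and \<epsilon>: "0 \<le> \<epsilon>" and t: "t \<in> {0..T}" and x: "x \<in> usphere"
  shows "norm (X t x - Y t x) \<le> 2 * \<epsilon> * (exp ((L + \<sigma> + 2 + K) * t) - exp t)"
proof -
  define D where "D t x = X t x - Y t x" for t x
  define \<delta> where "\<delta> t = (SUP x\<in>usphere. norm (D t x))" for t
  define C1 where "C1 = L + \<sigma> + 2 + K"
  have S: "X t x \<in> usphere" "Y t x \<in> usphere" if "t \<in> {0..T}" "x \<in> usphere" for t x
    using X Y that by (simp_all add: sphere_flow_def)
  have Dd: "((\<lambda>t. D t x) has_vector_derivative w t (X t x) - h t (Y t x)) (at t within {0..T})"
    if "t \<in> {0..T}" "x \<in> usphere" for t x
    unfolding D_def using X Y that by (intro has_vector_derivative_diff) (simp_all add: sphere_flow_def)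
  have bdd: "bdd_above ((\<lambda>x. norm (D t x)) ` usphere)" if "t \<in> {0..T}" for t
  proof (rule bdd_aboveI2)
    fix x :: 'a assume "x \<in> usphere"
    then show "norm (D t x) \<le> 2"
      using S[OF that, of x] norm_triangle_ineq4[of "X t x" "Y t x"] by (simp add: D_def)
  qed
  have le\<delta>: "norm (D t x) \<le> \<delta> t" if "t \<in> {0..T}" "x \<in> usphere" for t x
    unfolding \<delta>_def by (rule cSUP_upper[OF that(2) bdd[OF that(1)]])
  have \<delta>le: "\<delta> t \<le> c" if "\<And>x. x \<in> usphere \<Longrightarrow> norm (D t x) \<le> c" for t c
    unfolding \<delta>_def by (rule cSUP_least) (use that in auto)
  have D_lip: "norm (D b x - D a x) \<le> 2 * M * (b - a)" if "0 \<le> a" "a \<le> b" "b \<le> T" "x \<in> usphere" for a b x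
  proof -
    have "norm (D b x - D a x - (b - a) *\<^sub>R 0) \<le> 2 * M * (b - a)"
    proof (rule norm_increment_le_const[OF that(2)])
      fix t assume "t \<in> {a..b}"
      then have tT: "t \<in> {0..T}" using that by auto
      show "((\<lambda>t. D t x) has_vector_derivative w t (X t x) - h t (Y t x)) (at t within {a..b})"
        by (rule has_vector_derivative_within_subset[OF Dd[OF tT that(4)]]) (use that in auto)
      show "norm (w t (X t x) - h t (Y t x) - 0) \<le> 2 * M"
        using wb[OF tT S(1)[OF tT that(4)]] hb[OF tT S(2)[OF tT that(4)]]
          norm_triangle_ineq4[of "w t (X t x)" "h t (Y t x)"] by simp
    qed
    then show ?thesis by simp
  qed
  have M0: "0 \<le> M" using wb[OF t x] norm_ge_zero order_trans by blast
  have \<delta>_incr: "\<bar>\<delta> b - \<delta> a\<bar> \<le> 2 * M * (b - a)" if ab: "0 \<le> a" "a \<le> b" "b \<le> T" for a b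
  proof -
    have T: "a \<in> {0..T}" "b \<in> {0..T}" using ab by auto
    have "\<delta> b \<le> \<delta> a + 2 * M * (b - a)"
    proof (rule \<delta>le)
      fix x :: 'a assume x: "x \<in> usphere"
      show "norm (D b x) \<le> \<delta> a + 2 * M * (b - a)"
        using D_lip[OF ab x] le\<delta>[OF T(1) x] norm_triangle_ineq2[of "D b x" "D a x"] by linarith
    qed
    moreover have "\<delta> a \<le> \<delta> b + 2 * M * (b - a)"
    proof (rule \<delta>le)
      fix x :: 'a assume x: "x \<in> usphere"
      show "norm (D a x) \<le> \<delta> b + 2 * M * (b - a)"
        using D_lip[OF ab x] le\<delta>[OF T(2) x] norm_triangle_ineq2[of "D a x" "D b x"] norm_minus_commute[of "D a x" "D b x"] by linarith
    qed
    ultimately show ?thesis by linarith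
  qed
  have "(2 * M)-lipschitz_on {0..T} \<delta>"
  proof (rule lipschitz_onI)
    fix a b assume "a \<in> {0..T}" "b \<in> {0..T}"
    then show "dist (\<delta> a) (\<delta> b) \<le> 2 * M * dist a b"
      using \<delta>_incr[of a b] \<delta>_incr[of b a] by (cases "a \<le> b") (auto simp: dist_real_def abs_minus_commute)
  qed (use M0 in simp)
  then have \<delta>c: "continuous_on {0..T} \<delta>" by (rule lipschitz_on_continuous_on)
  have kc: "continuous_on {0..T} (\<lambda>t. K * \<epsilon> * exp t)" by (intro continuous_intros)
  have "\<delta> t \<le> 2 * \<epsilon> * (exp (C1 * t) - exp t)"
  proof (rule gronwall_compare[OF _ \<delta>c kc, where U = "\<lambda>t. 2 * \<epsilon> * (exp (C1 * t) - exp t)"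
        and A = "L + \<sigma>" and U' = "\<lambda>t. 2 * \<epsilon> * (C1 * exp (C1 * t) - exp t)"])
    show "0 \<le> L + \<sigma>" using L0 \<sigma> by simp
    show "t \<in> {0..T}" by (rule t)
    fix t assume t: "t \<in> {0..T}"
    show "((\<lambda>t. 2 * \<epsilon> * (exp (C1 * t) - exp t)) has_real_derivative 2 * \<epsilon> * (C1 * exp (C1 * t) - exp t)) (at t within {0..T})"
      by (rule derivative_eq_intros refl | simp)+
    show "(L + \<sigma>) * (2 * \<epsilon> * (exp (C1 * t) - exp t)) + K * \<epsilon> * exp t \<le> 2 * \<epsilon> * (C1 * exp (C1 * t) - exp t)"
    proof -
      have "1 * t \<le> C1 * t" using t L0 \<sigma> K by (intro mult_right_mono) (auto simp: C1_def)
      then have "(2 + K) * exp t \<le> (2 + K) * exp (C1 * t)" using K by (intro mult_left_mono) auto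
      moreover have "0 \<le> (L + \<sigma>) * exp t" using L0 \<sigma> by simp
      moreover have "0 \<le> (2 + K) * exp (C1 * t)" using K by simp
      ultimately have "0 \<le> 2 * (2 + K) * exp (C1 * t) - (2 + K) * exp t + 2 * ((L + \<sigma>) * exp t)" by linarith
      then have "0 \<le> \<epsilon> * (2 * (2 + K) * exp (C1 * t) - (2 + K) * exp t + 2 * ((L + \<sigma>) * exp t))"
        using \<epsilon> by (rule mult_nonneg_nonneg[rotated])
      then show ?thesis unfolding C1_def by (simp add: algebra_simps)
    qed
    show "\<delta> t \<le> 2 * \<epsilon> * (exp (C1 * 0) - exp 0) + integral {0..t} (\<lambda>s. (L + \<sigma>) * \<delta> s + K * \<epsilon> * exp s)"
    proof (rule \<delta>le)
      fix x :: 'a assume x: "x \<in> usphere"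
      have "norm (D t x - D 0 x) \<le> integral {0..t} (\<lambda>s. (L + \<sigma>) * \<delta> s + K * \<epsilon> * exp s)"
      proof (rule norm_increment_le)
        show "0 \<le> t" using t by simp
        have "continuous_on {0..T} (\<lambda>s. (L + \<sigma>) * \<delta> s + K * \<epsilon> * exp s)" by (intro continuous_intros \<delta>c)
        then show "(\<lambda>s. (L + \<sigma>) * \<delta> s + K * \<epsilon> * exp s) integrable_on {0..t}"
          using t by (intro integrable_continuous_interval) (auto elim: continuous_on_subset)
        fix s assume "s \<in> {0..t}"
        then have sT: "s \<in> {0..T}" using t by auto
        show "((\<lambda>t. D t x) has_vector_derivative w s (X s x) - h s (Y s x)) (at s within {0..t})"
          by (rule has_vector_derivative_within_subset[OF Dd[OF sT x]]) (use t in auto)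
        have "norm (w s (X s x) - h s (X s x)) \<le> \<sigma> * \<delta> s + K * \<epsilon> * exp s"
          by (rule err[OF sT S(1)[OF sT x]]) (use le\<delta>[OF sT] in \<open>simp add: D_def\<close>)
        moreover have "norm (h s (X s x) - h s (Y s x)) \<le> L * \<delta> s"
        proof -
          have "norm (h s (X s x) - h s (Y s x)) \<le> L * norm (D s x)"
            using lipschitz_onD[OF hL[OF sT] S[OF sT x]] by (simp add: dist_norm D_def)
          also have "\<dots> \<le> L * \<delta> s" by (rule mult_left_mono[OF le\<delta>[OF sT x] L0])
          finally show ?thesis .
        qed
        ultimately show "norm (w s (X s x) - h s (Y s x)) \<le> (L + \<sigma>) * \<delta> s + K * \<epsilon> * exp s"
          using norm_triangle_ineq[of "w s (X s x) - h s (X s x)" "h s (X s x) - h s (Y s x)"] by (simp add: algebra_simps)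
      qed
      moreover have "D 0 x = 0" using X Y x by (simp add: D_def sphere_flow_def)
      ultimately show "norm (D t x) \<le> 2 * \<epsilon> * (exp (C1 * 0) - exp 0) + integral {0..t} (\<lambda>s. (L + \<sigma>) * \<delta> s + K * \<epsilon> * exp s)"
        by simp
    qed
  qed
  then show ?thesis using le\<delta>[OF t x] by (simp add: D_def C1_def)
qed

theorem proposition6:
  "\<exists>(C\<^sub>0 :: real \<Rightarrow> real \<Rightarrow> real) (C\<^sub>1 :: real \<Rightarrow> real \<Rightarrow> real \<Rightarrow> real \<Rightarrow> real).
     \<forall>(B :: real^'n^'n) (V :: real^'n^'n) (\<rho>\<^sub>0 :: (real^'n) measure) (f\<^sub>0 :: real^'n \<Rightarrow> real).
       invertible B \<longrightarrow>
       \<rho>\<^sub>0 \<in> sphere_probs \<longrightarrow>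
       (\<exists>L. L-lipschitz_on usphere f\<^sub>0) \<longrightarrow>
       \<rho>\<^sub>0 = density surface_measure (\<lambda>x. ennreal (f\<^sub>0 x)) \<longrightarrow>
       0 < (INF x\<in>usphere. f\<^sub>0 x) \<longrightarrow>
       (let c\<^sub>0 = C\<^sub>0 (sigma_max B) (sigma_max V);
            c\<^sub>1 = C\<^sub>1 (sigma_max B) (sigma_max V) (sigma_min B) (INF x\<in>usphere. f\<^sub>0 x)
        in 0 < c\<^sub>0 \<and> c\<^sub>0 < c\<^sub>1 \<and>
          (\<forall>\<beta> > 0. \<forall>T > 0. \<forall>\<rho>\<beta> \<rho>.
             weak_solution T (attention_field \<beta> B V) \<rho>\<beta> \<longrightarrow>
             weak_solution T (\<lambda>_. hardmax_field B V) \<rho> \<longrightarrow>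
             \<rho>\<beta> 0 = \<rho>\<^sub>0 \<longrightarrow> \<rho> 0 = \<rho>\<^sub>0 \<longrightarrow>
             (\<forall>t\<in>{0..T}. wasserstein2 (\<rho>\<beta> t) (\<rho> t)
                \<le> 2 * sqrt (ln (\<beta> + 1) / \<beta>) * (exp (c\<^sub>1 * t) - exp (c\<^sub>0 * t)))))"
proof -
  obtain \<kappa> where \<kappa>: "0 < \<kappa>"
    "\<And>(z::real^'n) s. z \<in> usphere \<Longrightarrow> 0 < s \<Longrightarrow> s \<le> 1 \<Longrightarrow>
       ennreal (\<kappa> * s ^ DIM(real^'n)) \<le> emeasure surface_measure (usphere \<inter> cball z s)"
    by (rule surface_measure_cap_lower_bound) (rule that)
  define lip where "lip \<sigma>B \<sigma>V m = 2 * \<sigma>V * (\<sigma>B / m + 1)" for \<sigma>B \<sigma>V m :: real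
  define K where "K \<sigma>B \<sigma>V m l = 4 * \<sigma>V * (1 + (\<bar>ln (l * \<kappa>)\<bar> + real CARD('n) + real CARD('n) * lip \<sigma>B \<sigma>V m) / m)"
    for \<sigma>B \<sigma>V m l :: real
  define C1 where "C1 \<sigma>B \<sigma>V m l = lip \<sigma>B \<sigma>V m + \<sigma>V + 2 + K \<sigma>B \<sigma>V m l" for \<sigma>B \<sigma>V m l :: real
  \<comment> \<open>any positive \<open>C\<^sub>0\<close> would do, since \<open>C\<^sub>1\<close> absorbs the linear growth in time of the logarithm of the mass\<close>
  show ?thesis
  proof (intro exI[of _ "\<lambda>_ _. 1"] exI[of _ C1] allI impI)
    fix B V :: "real^'n^'n" and \<rho>0 :: "(real^'n) measure" and f :: "real^'n \<Rightarrow> real"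
    assume B: "invertible B" and \<rho>0: "\<rho>0 \<in> sphere_probs" and flip: "\<exists>L. L-lipschitz_on usphere f"
      and \<rho>f: "\<rho>0 = density surface_measure (\<lambda>x. ennreal (f x))" and l: "0 < (INF x\<in>usphere. f x)"
    define l where "l = (INF x\<in>usphere. f x)"
    define L where "L = lip (sigma_max B) (sigma_max V) (sigma_min B)"
    define k where "k = K (sigma_max B) (sigma_max V) (sigma_min B) l"
    have pos: "0 \<le> sigma_max V" "0 \<le> sigma_max B" "0 < sigma_min B"
      using sigma_max_nonneg sigma_min_pos[OF B] by auto
    have L0: "0 \<le> L" using pos by (simp add: L_def lip_def)
    have k0: "0 \<le> k" using pos L0 by (simp add: k_def K_def L_def)
    have fc: "continuous_on usphere f" using flip lipschitz_on_continuous_on by blast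
    have "bdd_below (f ` usphere)"
      by (intro bounded_imp_bdd_below compact_imp_bounded compact_continuous_image fc compact_sphere)
    then have lf: "l \<le> f x" if "x \<in> usphere" for x
      unfolding l_def using that by (rule cINF_lower)
    have l0: "0 < l" using l by (simp add: l_def)
    have mass: "usphere \<inter> cball z r \<in> sets \<rho>0 \<and> (l * \<kappa>) * r ^ CARD('n) \<le> measure \<rho>0 (usphere \<inter> cball z r)"
      if "z \<in> usphere" "0 < r" "r \<le> 1" for z :: "real^'n" and r
      using measure_cap_lower_bound[OF \<rho>0 fc \<rho>f l0 lf \<kappa>(2)[OF that]] \<kappa>(1) that
      by (simp add: mult.assoc)
    have "wasserstein2 (\<rho>\<beta> t) (\<rho> t) \<le> 2 * sqrt (ln (\<beta> + 1) / \<beta>) * (exp ((L + sigma_max V + 2 + k) * t) - exp t)"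
      if \<beta>: "0 < \<beta>" and T: "0 < T" and sol\<beta>: "weak_solution T (attention_field \<beta> B V) \<rho>\<beta>"
        and sol: "weak_solution T (\<lambda>_. hardmax_field B V) \<rho>" and init: "\<rho>\<beta> 0 = \<rho>0" "\<rho> 0 = \<rho>0" and t: "t \<in> {0..T}"
      for \<beta> T t :: real and \<rho>\<beta> \<rho>
    proof -
      have sp: "\<rho>\<beta> s \<in> sphere_probs" "\<rho> s \<in> sphere_probs" if "s \<in> {0..T}" for s
        using sol\<beta> sol that by (simp_all add: weak_solution_def)
      have nc: "narrowly_continuous T \<rho>\<beta>" using sol\<beta> by (simp add: weak_solution_def)
      have T0: "0 \<le> T" and \<beta>0: "0 \<le> \<beta>" using T \<beta> by simp_all
      obtain L\<beta> where w: "sphere_field T L\<beta> (\<lambda>t. attention_field \<beta> B V (\<rho>\<beta> t))"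
        by (rule attention_sphere_field[OF sp(1) nc \<beta>0]) (assumption, rule that)
      have h: "sphere_field T L (\<lambda>t. (\<lambda>_. hardmax_field B V) (\<rho> t))" for T
        unfolding L_def lip_def by (rule hardmax_sphere_field[OF B])
      obtain X where X: "sphere_flow T (\<lambda>t. attention_field \<beta> B V (\<rho>\<beta> t)) X"
        by (rule sphere_flow_exists[OF T0 w]) (rule that)
      obtain Y where Y: "sphere_flow T (\<lambda>t. (\<lambda>_. hardmax_field B V) (\<rho> t)) Y"
        by (rule sphere_flow_exists[OF T0 h]) (rule that)
      have pX: "\<rho>\<beta> s = distr \<rho>0 (\<rho>\<beta> s) (X s)" and pY: "\<rho> s = distr \<rho>0 (\<rho> s) (Y s)" if "s \<in> {0..T}" for s
        using weak_solution_transported[OF sol\<beta> w X that] weak_solution_transported[OF sol h Y that]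
        by (simp_all only: init)
      have XS: "X s ` usphere \<subseteq> usphere" "Y s ` usphere \<subseteq> usphere" if "s \<in> {0..T}" for s
        using X Y that unfolding sphere_flow_def by blast+
      define \<epsilon> where "\<epsilon> = sqrt (ln (\<beta> + 1) / \<beta>)"
      have \<epsilon>: "0 < \<epsilon>" unfolding \<epsilon>_def by (rule inverse_temperature_rate(1)[OF \<beta>])
      have dev: "norm (X t x - Y t x) \<le> 2 * \<epsilon> * (exp ((L + sigma_max V + 2 + k) * t) - exp t)" if x: "x \<in> usphere" for x
      proof (rule flow_deviation[OF X Y _ L0 pos(1) _ _ _ k0 less_imp_le[OF \<epsilon>] t x])
        fix s assume s: "s \<in> {0..T}"
        show "L-lipschitz_on usphere (hardmax_field B V)" using h[of T] s unfolding sphere_field_def by blast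
        fix x :: "real^'n" assume x: "x \<in> usphere"
        show "norm (attention_field \<beta> B V (\<rho>\<beta> s) x) \<le> sigma_max V" by (rule field_norm_le_sigma_max(1)[OF x sp(1)[OF s] \<beta>0])
        show "norm (hardmax_field B V x) \<le> sigma_max V" by (rule field_norm_le_sigma_max(2)[OF x])
        fix \<delta> assume \<delta>: "\<And>x. x \<in> usphere \<Longrightarrow> norm (X s x - Y s x) \<le> \<delta>"
        show "norm (attention_field \<beta> B V (\<rho>\<beta> s) x - hardmax_field B V x) \<le> sigma_max V * \<delta> + k * \<epsilon> * exp s"
          unfolding k_def K_def lip_def \<epsilon>_def
          by (rule field_error[OF B \<beta> sp(1)[OF s] \<rho>0 sphere_flow_continuous[OF w X s] XS(1)[OF s] pX[OF s] Y s \<delta> _ mass x])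
             (use l0 \<kappa>(1) in auto)
      qed
      obtain x :: "real^'n" where x: "x \<in> usphere" using vector_choose_size[of 1] by auto
      show ?thesis
        unfolding \<epsilon>_def[symmetric]
        by (rule wasserstein2_le_sup_dist[OF \<rho>0 sp(1)[OF t] sp(2)[OF t] sphere_flow_continuous[OF w X t] XS(1)[OF t] pX[OF t]
              sphere_flow_continuous[OF h Y t] XS(2)[OF t] pY[OF t] order_trans[OF norm_ge_zero dev[OF x]] dev])
    qed
    moreover have "C1 (sigma_max B) (sigma_max V) (sigma_min B) (INF x\<in>usphere. f x) = L + sigma_max V + 2 + k"
      by (simp add: C1_def L_def k_def l_def)
    moreover have "1 < L + sigma_max V + 2 + k" using L0 k0 pos by linarith
    ultimately show "let c\<^sub>0 = 1; c\<^sub>1 = C1 (sigma_max B) (sigma_max V) (sigma_min B) (INF x\<in>usphere. f x)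
        in 0 < c\<^sub>0 \<and> c\<^sub>0 < c\<^sub>1 \<and>
          (\<forall>\<beta> > 0. \<forall>T > 0. \<forall>\<rho>\<beta> \<rho>.
             weak_solution T (attention_field \<beta> B V) \<rho>\<beta> \<longrightarrow>
             weak_solution T (\<lambda>_. hardmax_field B V) \<rho> \<longrightarrow>
             \<rho>\<beta> 0 = \<rho>0 \<longrightarrow> \<rho> 0 = \<rho>0 \<longrightarrow>
             (\<forall>t\<in>{0..T}. wasserstein2 (\<rho>\<beta> t) (\<rho> t)
                \<le> 2 * sqrt (ln (\<beta> + 1) / \<beta>) * (exp (c\<^sub>1 * t) - exp (c\<^sub>0 * t))))"
      by (simp add: Let_def)
  qed
qed

end
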